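(* Let $W=\mathfrak S_4$ with $S=\{1,2,3\}$, where $i$ stands for the transposition $(i,i+1)$, and let $\mathcal K$ be the kernel of the surjective $\mathbb Z[q]$-algebra homomorphism $\mathcal Q_q\to E_q(\mathfrak S_4)$ given by $e_K\mapsto1_K$, $\upsilon_{I,J}\mapsto u_{I,J}$, $\delta_{J,I}\mapsto d'_{J,I}$. Then the ideal $\mathcal K$ is generated by the following relations, which therefore give a presentation of $E_q(\mathfrak S_4)$ over $\mathbb Z[q]$. Quasi-idempotent relations: $\delta_{J,I}\upsilon_{I,J}=\frac{\pi(J)}{\pi(I)}e_J$ for all $I\sqsubset J$. Sandwich relations: $\upsilon_{I,J}\upsilon_{J,K}=\upsilon_{I,J'}\upsilon_{J',K}$ and $\delta_{K,J}\delta_{J,I}=\delta_{K,J'}\delta_{J',I}$ whenever $I\sqsubset J\sqsubset K$ and $I\sqsubset J'\sqsubset K$. Torsion relations: (T1) $\delta_{\{s\},\emptyset}\,\chi_t\,\upsilon_{\emptyset,\{s\}}=\upsilon_{\{s\},\{s,t\}}\delta_{\{s,t\},\{s\}}+q\,e_{\{s\}}$ for $(s,t)\in\{(1,2),(2,1),(2,3),(3,2)\}$; (T2) $\delta_{\{s\},\emptyset}\upsilon_{\emptyset,\{t\}}=\upsilon_{\{s\},\{1,3\}}\delta_{\{1,3\},\{t\}}$ for $(s,t)\in\{(1,3),(3,1)\}$; (T3) $\delta_{\{s,2\},\{s\}}\upsilon_{\{s\},\{1,3\}}\delta_{\{1,3\},\{s\}}\upsilon_{\{s\},\{s,2\}}=\upsilon_{\{s,2\},S}\delta_{S,\{s,2\}}+q(q+1)e_{\{s,2\}}$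 for $s\in\{1,3\}$; (T4) for $(s,t)\in\{(1,3),(3,1)\}$, $\delta_{\{s,2\},\{2\}}\upsilon_{\{2\},\{2,t\}}\delta_{\{2,t\},\{t\}}\upsilon_{\{t\},\{1,3\}}=\upsilon_{\{s,2\},S}\delta_{S,\{1,3\}}+q\,\delta_{\{s,2\},\{s\}}\upsilon_{\{s\},\{1,3\}}$ and $\delta_{\{1,3\},\{t\}}\upsilon_{\{t\},\{2,t\}}\delta_{\{2,t\},\{2\}}\upsilon_{\{2\},\{s,2\}}=\upsilon_{\{1,3\},S}\delta_{S,\{s,2\}}+q\,\delta_{\{1,3\},\{s\}}\upsilon_{\{s\},\{s,2\}}$.
   Context: $\ell$ is the length function on $W=\mathfrak S_4$; $\Lambda$ is the set of all subsets of $S$; $W_I=\langle I\rangle$; $\pi(I)=\sum_{w\in W_I}q^{\ell(w)}$; $I\sqsubset J$ means $I\subset J$ and $|I|=|J|-1$. $H_q$ is the Hecke algebra over $\mathbb Z[q]$ with basis $T_w$ ($w\in W$), generated by $T_s$ ($s\in S$) with $T_s^2=(q-1)T_s+q$ and the braid relations. $x_I=\sum_{w\in W_I}T_w$ and $E_q(\mathfrak S_4)=\mathrm{End}_{H_q}(\bigoplus_{I\in\Lambda}x_IH_q)$ (right modules). In $E_q$: $1_K$ is the identity on $x_KH_q$; for $I\sqsubset J$, $u_{I,J}:x_JH_q\to x_IH_q$ is the inclusion and $d'_{J,I}:x_IH_q\to x_JH_q$ is left multiplication by $h_{J,I}=\sum_wT_w$, the sum over those $w\in W_J$ of minimal length in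 $wW_I$ (so $x_J=h_{J,I}x_I$); all are extended by zero to the other summands. The Hasse quiver $\mathcal Q$ has vertex set $\Lambda$ with trivial paths $e_K$ and, for all $I\sqsubset J$, arrows $\upsilon_{I,J}$ from $J$ to $I$ and $\delta_{J,I}$ from $I$ to $J$. $\mathcal Q_q=\mathbb Z[q]\mathcal Q$ is its path algebra; $\alpha\beta$ is concatenation if the starting vertex of $\alpha$ is the ending vertex of $\beta$, and $0$ otherwise. $\chi_s=\upsilon_{\emptyset,\{s\}}\delta_{\{s\},\emptyset}$. *)

theory Defs
  imports
    "HOL-Combinatorics.Transposition"
    "HOL-Computational_Algebra.Polynomial"
    "HOL-Library.FuncSet"
    "HOL-Library.Poly_Mapping"
    "Graph_Theory.Digraph"
    "Graph_Theory.Arc_Walk"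
    "HOL-Algebra.Module"
    "HOL-Algebra.RingHom"
    "HOL-Algebra.Sym_Groups"
begin

section \<open>Algebras, and the path algebra of a quiver\<close>

text \<open>
  An algebra over a commutative ring given as a type 'k is rendered by the record
  \<^typ>\<open>('k, 'a) module\<close>, which extends the ring record by a scalar multiplication.
  Free modules are carried by finitely supported functions \<^typ>\<open>'b \<Rightarrow>\<^sub>0 'k\<close>.
\<close>

definition algebra_hom :: "('k, 'a) module \<Rightarrow> ('k, 'b) module \<Rightarrow> ('a \<Rightarrow> 'b) set" where
  "algebra_hom A B =
     {f \<in> ring_hom A B. \<forall>c. \<forall>x \<in> carrier A. f (c \<odot>\<^bsub>A\<^esub> x) = c \<odot>\<^bsub>B\<^esub> f x}"

definition scale :: "'k::comm_ring_1 \<Rightarrow> ('b \<Rightarrow>\<^sub>0 'k) \<Rightarrow> ('b \<Rightarrow>\<^sub>0 'k)" where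
  "scale c f = Poly_Mapping.map (\<lambda>x. c * x) f"

text \<open>
  A path is a pair of its starting vertex and the list of its arrows in the order in which they
  are traversed. The product of \<alpha> and \<beta> is nonzero if \<alpha> starts where \<beta> ends, so
  \<beta> is traversed first.
\<close>

type_synonym ('v, 'a) path = "'v \<times> 'a list"

definition paths :: "('v, 'a) pre_digraph \<Rightarrow> ('v, 'a) path set" where
  "paths G = {(u, p). \<exists>v. pre_digraph.awalk G u p v}"

definition path_mult ::
  "('v, 'a) pre_digraph \<Rightarrow> ('v, 'a) path \<Rightarrow> ('v, 'a) path \<Rightarrow> ('v, 'a) path \<Rightarrow>\<^sub>0 'k::comm_ring_1" where
  "path_mult G \<alpha> \<beta> =
     (if fst \<alpha> = pre_digraph.awlast G (fst \<beta>) (snd \<beta>)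
      then Poly_Mapping.single (fst \<beta>, snd \<beta> @ snd \<alpha>) 1 else 0)"

definition path_algebra ::
  "('v, 'a) pre_digraph \<Rightarrow> ('k::comm_ring_1, ('v, 'a) path \<Rightarrow>\<^sub>0 'k) module" where
  "path_algebra G =
     \<lparr> carrier = {f. Poly_Mapping.keys f \<subseteq> paths G},
       mult = (\<lambda>f g. \<Sum>\<alpha>\<in>Poly_Mapping.keys f. \<Sum>\<beta>\<in>Poly_Mapping.keys g.
                  scale (Poly_Mapping.lookup f \<alpha> * Poly_Mapping.lookup g \<beta>) (path_mult G \<alpha> \<beta>)),
       one = (\<Sum>v\<in>verts G. Poly_Mapping.single (v, []) 1),
       ring.zero = 0,
       add = (+),
       smult = scale \<rparr>"


section \<open>The symmetric group and its length function\<close>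

abbreviation W :: "(nat \<Rightarrow> nat) set" where
  "W \<equiv> carrier (sym_group 4)"

abbreviation S :: "nat set" where
  "S \<equiv> {1, 2, 3}"

abbreviation \<Lambda> :: "nat set set" where
  "\<Lambda> \<equiv> Pow S"

abbreviation simple :: "nat \<Rightarrow> nat \<Rightarrow> nat" where
  "simple i \<equiv> transpose i (i + 1)"

definition word :: "nat list \<Rightarrow> nat \<Rightarrow> nat" where
  "word is = foldr (\<lambda>i w. simple i \<circ> w) is id"

definition len :: "(nat \<Rightarrow> nat) \<Rightarrow> nat" where
  "len w = (LEAST n. \<exists>is. set is \<subseteq> S \<and> word is = w \<and> length is = n)"

definition reduced_word :: "(nat \<Rightarrow> nat) \<Rightarrow> nat list" where
  "reduced_word w = (SOME is. set is \<subseteq> S \<and> word is = w \<and> length is = len w)"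

definition parabolic :: "nat set \<Rightarrow> (nat \<Rightarrow> nat) set" where
  "parabolic I = generate (sym_group 4) (simple ` I)"

definition hasse_cover :: "nat set \<Rightarrow> nat set \<Rightarrow> bool" (infix \<open>\<lessdot>\<close> 50) where
  "I \<lessdot> J \<longleftrightarrow> J \<in> \<Lambda> \<and> I \<subset> J \<and> card I = card J - 1"


section \<open>The Hecke algebra\<close>

abbreviation q :: "int poly" where
  "q \<equiv> monom 1 1"

definition poincare :: "nat set \<Rightarrow> int poly" where
  "poincare I = (\<Sum>w\<in>parabolic I. q ^ len w)"

type_synonym hecke = "(nat \<Rightarrow> nat) \<Rightarrow>\<^sub>0 int poly"

abbreviation T :: "(nat \<Rightarrow> nat) \<Rightarrow> hecke" where
  "T w \<equiv> Poly_Mapping.single w 1"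

text \<open>
  The algebra is constructed on the free module with basis \<^term>\<open>T w\<close>. The following is
  left multiplication by the generator \<^term>\<open>T (simple i)\<close>, as it is forced by the quadratic
  relation and by T_v T_w = T_vw when lengths add. A basis element \<^term>\<open>T w\<close> is the product
  of the generators along a reduced word of w, the choice of which is immaterial by the
  braid relations.
\<close>

definition hecke_gen_left :: "nat \<Rightarrow> hecke \<Rightarrow> hecke" where
  "hecke_gen_left i h =
     (\<Sum>w\<in>Poly_Mapping.keys h. scale (Poly_Mapping.lookup h w)
        (if len w < len (simple i \<circ> w) then T (simple i \<circ> w)
         else scale (q - 1) (T w) + scale q (T (simple i \<circ> w))))"

definition hecke_mult :: "hecke \<Rightarrow> hecke \<Rightarrow> hecke" where
  "hecke_mult a h =
     (\<Sum>w\<in>Poly_Mapping.keys a.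
        scale (Poly_Mapping.lookup a w) (foldr hecke_gen_left (reduced_word w) h))"

definition Hecke :: "(int poly, hecke) module" where
  "Hecke =
     \<lparr> carrier = {h. Poly_Mapping.keys h \<subseteq> W},
       mult = hecke_mult,
       one = T id,
       ring.zero = 0,
       add = (+),
       smult = scale \<rparr>"

definition xelt :: "nat set \<Rightarrow> hecke" where
  "xelt I = (\<Sum>w\<in>parabolic I. T w)"

definition xmod :: "nat set \<Rightarrow> hecke set" where
  "xmod I = {xelt I \<otimes>\<^bsub>Hecke\<^esub> h | h. h \<in> carrier Hecke}"

definition helt :: "nat set \<Rightarrow> nat set \<Rightarrow> hecke" where
  "helt J I = (\<Sum>w\<in>{w \<in> parabolic J. \<forall>v\<in>parabolic I. len w \<le> len (w \<circ> v)}. T w)"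


section \<open>The endomorphism algebra\<close>

text \<open>
  Elements of the direct sum of the right ideals \<^term>\<open>xmod I\<close> are families that vanish
  outside \<^term>\<open>\<Lambda>\<close>; endomorphisms are extensional functions on it.
\<close>

definition Xsum :: "(nat set \<Rightarrow> hecke) set" where
  "Xsum = {m. (\<forall>I\<in>\<Lambda>. m I \<in> xmod I) \<and> (\<forall>I. I \<notin> \<Lambda> \<longrightarrow> m I = 0)}"

definition Eq :: "(int poly, (nat set \<Rightarrow> hecke) \<Rightarrow> (nat set \<Rightarrow> hecke)) module" where
  "Eq =
     \<lparr> carrier = {f \<in> Xsum \<rightarrow>\<^sub>E Xsum.
          (\<forall>m\<in>Xsum. \<forall>n\<in>Xsum. f (\<lambda>I. m I + n I) = (\<lambda>I. f m I + f n I)) \<and>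
          (\<forall>m\<in>Xsum. \<forall>h\<in>carrier Hecke.
             f (\<lambda>I. m I \<otimes>\<^bsub>Hecke\<^esub> h) = (\<lambda>I. f m I \<otimes>\<^bsub>Hecke\<^esub> h))},
       mult = (\<lambda>f g. compose Xsum f g),
       one = (\<lambda>m\<in>Xsum. m),
       ring.zero = (\<lambda>m\<in>Xsum. \<lambda>I. 0),
       add = (\<lambda>f g. \<lambda>m\<in>Xsum. \<lambda>I. f m I + g m I),
       smult = (\<lambda>c f. \<lambda>m\<in>Xsum. \<lambda>I. scale c (f m I)) \<rparr>"

definition id_map :: "nat set \<Rightarrow> (nat set \<Rightarrow> hecke) \<Rightarrow> (nat set \<Rightarrow> hecke)" where
  "id_map K = (\<lambda>m\<in>Xsum. \<lambda>L. if L = K then m K else 0)"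

definition u_map :: "nat set \<Rightarrow> nat set \<Rightarrow> (nat set \<Rightarrow> hecke) \<Rightarrow> (nat set \<Rightarrow> hecke)" where
  "u_map I J = (\<lambda>m\<in>Xsum. \<lambda>L. if L = I then m J else 0)"

definition d_map :: "nat set \<Rightarrow> nat set \<Rightarrow> (nat set \<Rightarrow> hecke) \<Rightarrow> (nat set \<Rightarrow> hecke)" where
  "d_map J I = (\<lambda>m\<in>Xsum. \<lambda>L. if L = J then helt J I \<otimes>\<^bsub>Hecke\<^esub> m I else 0)"


section \<open>The Hasse quiver and the relations\<close>

text \<open>In both constructors the first argument is the end of the arrow, the second its start.\<close>

datatype arrow = Upsilon "nat set" "nat set" | Delta "nat set" "nat set"

fun arrow_start :: "arrow \<Rightarrow> nat set" where
  "arrow_start (Upsilon I J) = J"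
| "arrow_start (Delta J I) = I"

fun arrow_end :: "arrow \<Rightarrow> nat set" where
  "arrow_end (Upsilon I J) = I"
| "arrow_end (Delta J I) = J"

definition hasse_quiver :: "(nat set, arrow) pre_digraph" where
  "hasse_quiver =
     \<lparr> verts = \<Lambda>,
       arcs = {Upsilon I J | I J. I \<lessdot> J} \<union> {Delta J I | I J. I \<lessdot> J},
       tail = arrow_start,
       head = arrow_end \<rparr>"

type_synonym hasse_elt = "(nat set, arrow) path \<Rightarrow>\<^sub>0 int poly"

definition Qq :: "(int poly, hasse_elt) module" where
  "Qq = path_algebra hasse_quiver"

definition e :: "nat set \<Rightarrow> hasse_elt" where
  "e K = Poly_Mapping.single (K, []) 1"

definition \<upsilon> :: "nat set \<Rightarrow> nat set \<Rightarrow> hasse_elt" where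
  "\<upsilon> I J = Poly_Mapping.single (J, [Upsilon I J]) 1"

definition \<delta> :: "nat set \<Rightarrow> nat set \<Rightarrow> hasse_elt" where
  "\<delta> J I = Poly_Mapping.single (I, [Delta J I]) 1"

abbreviation Qq_mult :: "hasse_elt \<Rightarrow> hasse_elt \<Rightarrow> hasse_elt" (infixl \<open>\<star>\<close> 70) where
  "x \<star> y \<equiv> x \<otimes>\<^bsub>Qq\<^esub> y"

abbreviation Qq_add :: "hasse_elt \<Rightarrow> hasse_elt \<Rightarrow> hasse_elt" (infixl \<open>\<boxplus>\<close> 65) where
  "x \<boxplus> y \<equiv> x \<oplus>\<^bsub>Qq\<^esub> y"

abbreviation Qq_smult :: "int poly \<Rightarrow> hasse_elt \<Rightarrow> hasse_elt" (infixr \<open>\<cdot>\<close> 75) where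
  "c \<cdot> x \<equiv> c \<odot>\<^bsub>Qq\<^esub> x"

definition \<chi> :: "nat \<Rightarrow> hasse_elt" where
  "\<chi> s = \<upsilon> {} {s} \<star> \<delta> {s} {}"

text \<open>
  The division in the first relation is exact division of integer polynomials.
\<close>

inductive_set relations :: "(hasse_elt \<times> hasse_elt) set" where
  quasi_idempotent:
    "I \<lessdot> J \<Longrightarrow> (\<delta> J I \<star> \<upsilon> I J, (poincare J div poincare I) \<cdot> e J) \<in> relations"
| sandwich_\<upsilon>:
    "\<lbrakk>I \<lessdot> J; J \<lessdot> K; I \<lessdot> J'; J' \<lessdot> K\<rbrakk> \<Longrightarrow> (\<upsilon> I J \<star> \<upsilon> J K, \<upsilon> I J' \<star> \<upsilon> J' K) \<in> relations"
| sandwich_\<delta>: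
    "\<lbrakk>I \<lessdot> J; J \<lessdot> K; I \<lessdot> J'; J' \<lessdot> K\<rbrakk> \<Longrightarrow> (\<delta> K J \<star> \<delta> J I, \<delta> K J' \<star> \<delta> J' I) \<in> relations"
| T1:
    "(s, t) \<in> {(1, 2), (2, 1), (2, 3), (3, 2)} \<Longrightarrow>
     (\<delta> {s} {} \<star> \<chi> t \<star> \<upsilon> {} {s}, \<upsilon> {s} {s, t} \<star> \<delta> {s, t} {s} \<boxplus> q \<cdot> e {s}) \<in> relations"
| T2:
    "(s, t) \<in> {(1, 3), (3, 1)} \<Longrightarrow>
     (\<delta> {s} {} \<star> \<upsilon> {} {t}, \<upsilon> {s} {1, 3} \<star> \<delta> {1, 3} {t}) \<in> relations"
| T3:
    "s \<in> {1, 3} \<Longrightarrow>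
     (\<delta> {s, 2} {s} \<star> \<upsilon> {s} {1, 3} \<star> \<delta> {1, 3} {s} \<star> \<upsilon> {s} {s, 2},
      \<upsilon> {s, 2} S \<star> \<delta> S {s, 2} \<boxplus> (q * (q + 1)) \<cdot> e {s, 2}) \<in> relations"
| T4_left:
    "(s, t) \<in> {(1, 3), (3, 1)} \<Longrightarrow>
     (\<delta> {s, 2} {2} \<star> \<upsilon> {2} {2, t} \<star> \<delta> {2, t} {t} \<star> \<upsilon> {t} {1, 3},
      \<upsilon> {s, 2} S \<star> \<delta> S {1, 3} \<boxplus> q \<cdot> (\<delta> {s, 2} {s} \<star> \<upsilon> {s} {1, 3})) \<in> relations"
| T4_right:
    "(s, t) \<in> {(1, 3), (3, 1)} \<Longrightarrow>
     (\<delta> {1, 3} {t} \<star> \<upsilon> {t} {2, t} \<star> \<delta> {2, t} {2} \<star> \<upsilon> {2} {s, 2},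
      \<upsilon> {1, 3} S \<star> \<delta> S {s, 2} \<boxplus> q \<cdot> (\<delta> {1, 3} {s} \<star> \<upsilon> {s} {s, 2})) \<in> relations"

definition relators :: "hasse_elt set" where
  "relators = {l \<ominus>\<^bsub>Qq\<^esub> r | l r. (l, r) \<in> relations}"

definition canonical_homs ::
  "(hasse_elt \<Rightarrow> (nat set \<Rightarrow> hecke) \<Rightarrow> (nat set \<Rightarrow> hecke)) set" where
  "canonical_homs = {\<phi> \<in> algebra_hom Qq Eq.
     (\<forall>K\<in>\<Lambda>. \<phi> (e K) = id_map K) \<and>
     (\<forall>I J. I \<lessdot> J \<longrightarrow> \<phi> (\<upsilon> I J) = u_map I J \<and> \<phi> (\<delta> J I) = d_map J I)}"

end

theory Submission
  imports Defs
begin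

text \<open>
  A path is determined by the list of vertices it visits. Read from left to right, the relations become
  a rewriting system on such words. Resolving overlaps of left-hand sides adds 21 consequences, after
  which only finitely many words are irreducible; as every rule decreases a weight, each element is
  congruent modulo the ideal to a combination of irreducible words.

  A word from I to J maps the generator x_I to an element of x_J H that is also invariant under W_I on
  the right, and such an element is determined by its coefficients at the representatives of the
  (W_J, W_I) double cosets. A computation in the Hecke algebra shows that the irreducible words from I
  to J correspond bijectively to these representatives, in such a way that the coefficients form a
  unitriangular matrix. Hence the images of the irreducible words form a basis of Hom(x_I H, x_J H):
  the homomorphism is surjective, and a combination of irreducible words in its kernel is zero.
  Confluence of the rewriting system is not needed.
\<close>

text \<open>The product \<open>hecke_mult\<close> follows an arbitrarily chosen reduced word, so
  even its associativity has to be earned. This is done with operators: left and right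
  multiplications by generators commute, and a linear operator that commutes with all the right ones
  is determined by its value at the identity. Associativity and independence of the reduced word
  follow without a separate treatment of the braid relations. What remains of the Hecke algebra is
  finite computation, and everything is encoded for it: subsets become constructors of
  \<open>vertex\<close>, polynomials coefficient lists, Hecke elements lists of 24 of these;
  \<open>represents\<close> and \<open>sem\<close> carry the results back. The diagonal coefficients
  are 1 and not merely nonzero. So the elimination that proves surjectivity divides by nothing and
  works over Z[q] itself, and the same triangular shape gives independence; no ranks are compared.
  All canonical homomorphisms agree on the carrier, so one explicit map, \<open>phi0\<close>, is
  studied.\<close>

abbreviation lookup :: "('b \<Rightarrow>\<^sub>0 'k::zero) \<Rightarrow> 'b \<Rightarrow> 'k" where "lookup \<equiv> Poly_Mapping.lookup"
abbreviation keys :: "('b \<Rightarrow>\<^sub>0 'k::zero) \<Rightarrow> 'b set" where "keys \<equiv> Poly_Mapping.keys"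
abbreviation single :: "'b \<Rightarrow> 'k::zero \<Rightarrow> 'b \<Rightarrow>\<^sub>0 'k" where "single \<equiv> Poly_Mapping.single"

section \<open>Linear extension\<close>

lemma lookup_scale [simp]: "lookup (scale c f) x = c * lookup f x"
  unfolding scale_def by transfer (auto simp: when_def)

global_interpretation scale: Modules.module scale
  by standard (auto intro!: poly_mapping_eqI simp: lookup_add algebra_simps)

lemma scale_single [simp]: "scale c (single a d) = single a (c * d)"
  by (rule poly_mapping_eqI) (simp add: lookup_single when_def)

lemma keys_scale_subset: "keys (scale c f) \<subseteq> keys f"
  by (auto simp: in_keys_iff)

definition lin :: "('a \<Rightarrow> ('b \<Rightarrow>\<^sub>0 'k::comm_ring_1)) \<Rightarrow> ('a \<Rightarrow>\<^sub>0 'k) \<Rightarrow> ('b \<Rightarrow>\<^sub>0 'k)" where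
  "lin F f = (\<Sum>a\<in>keys f. scale (lookup f a) (F a))"

lemma lin_superset:
  assumes "finite A" "keys f \<subseteq> A"
  shows "lin F f = (\<Sum>a\<in>A. scale (lookup f a) (F a))"
  unfolding lin_def using assms
  by (intro sum.mono_neutral_left) (auto simp: in_keys_iff)

lemma lin_0 [simp]: "lin F 0 = 0"
  by (simp add: lin_def)

lemma lin_add [simp]: "lin F (f + g) = lin F f + lin F g"
proof -
  let ?A = "keys f \<union> keys g"
  have "lin F (f + g) = (\<Sum>a\<in>?A. scale (lookup (f + g) a) (F a))"
    by (rule lin_superset) (auto simp: keys_add)
  also have "\<dots> = lin F f + lin F g"
    by (simp add: lookup_add scale.scale_left_distrib sum.distrib
        lin_superset[of ?A f] lin_superset[of ?A g])
  finally show ?thesis .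
qed

lemma lin_scale [simp]: "lin F (scale c f) = scale c (lin F f)"
proof -
  have "lin F (scale c f) = (\<Sum>a\<in>keys f. scale (lookup (scale c f) a) (F a))"
    by (rule lin_superset) (auto simp: in_keys_iff)
  then show ?thesis
    by (simp add: lin_def scale.scale_sum_right)
qed

lemma lin_minus [simp]: "lin F (- f) = - lin F f"
  using lin_scale[of F "- 1" f] by simp

lemma lin_diff [simp]: "lin F (f - g) = lin F f - lin F g"
  using lin_add[of F f "- g"] by simp

lemma lin_single [simp]: "lin F (single a c) = scale c (F a)"
  by (cases "c = 0") (simp_all add: lin_def)

lemma lin_fun_add: "lin (\<lambda>a. F a + G a) f = lin F f + lin G f"
  by (simp add: lin_def scale.scale_right_distrib sum.distrib)

lemma lin_fun_scale: "lin (\<lambda>a. scale c (F a)) f = scale c (lin F f)"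
  by (simp add: lin_def scale.scale_sum_right mult.commute)

lemma lin_fun_0 [simp]: "lin (\<lambda>a. 0) f = 0"
  by (simp add: lin_def)

lemma lin_id: "lin (\<lambda>a. single a 1) f = f"
proof (rule poly_mapping_eqI)
  fix x
  have "lookup (lin (\<lambda>a. single a 1) f) x
      = (\<Sum>a\<in>keys f. if a = x then lookup f a else 0)"
    by (auto simp: lin_def lookup_sum lookup_single when_def intro!: sum.cong)
  then show "lookup (lin (\<lambda>a. single a 1) f) x = lookup f x"
    by (auto simp: in_keys_iff)
qed

lemma keys_lin:
  assumes "\<And>a. a \<in> keys f \<Longrightarrow> keys (F a) \<subseteq> B"
  shows "keys (lin F f) \<subseteq> B"
proof -
  have "keys (lin F f)
      \<subseteq> (\<Union>a\<in>keys f. keys (scale (lookup f a) (F a)))"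
    unfolding lin_def by (rule keys_sum)
  also have "\<dots> \<subseteq> B"
    using assms by (intro UN_least order_trans[OF keys_scale_subset])
  finally show ?thesis .
qed

text \<open>Induction for the free module on \<open>A\<close>. The added summand keeps the form of a
  scalar times a basis vector, so that linearity reduces each later claim to the basis vector
  itself.\<close>

lemma poly_mapping_carrier_induct [consumes 1, case_names zero step]:
  assumes "keys f \<subseteq> A" "P 0"
    "\<And>a c g. \<lbrakk>a \<in> A; keys g \<subseteq> A; P g\<rbrakk> \<Longrightarrow> P (scale c (single a 1) + g)"
  shows "P f"
proof -
  have "keys (\<Sum>a\<in>B. scale (lookup f a) (single a 1)) \<subseteq> A \<and>
      P (\<Sum>a\<in>B. scale (lookup f a) (single a 1))"
    if "finite B" "B \<subseteq> A" for B
    using that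
  proof (induction B rule: finite_induct)
    case (insert a B)
    let ?g = "\<Sum>a\<in>B. scale (lookup f a) (single a 1)"
    have "keys ?g \<subseteq> A" "P ?g" "a \<in> A"
      using insert by auto
    moreover from this have
      "keys (scale (lookup f a) (single a 1) + ?g) \<subseteq> A"
      using keys_add[of "scale (lookup f a) (single a 1)" ?g]
        keys_scale_subset[of "lookup f a" "single a 1"]
      by (auto simp del: scale_single)
    ultimately show ?case
      using insert assms(3) by simp
  qed (simp add: assms(2))
  from this[of "keys f"] assms(1) show ?thesis
    using lin_id[of f] by (simp add: lin_def)
qed

lemmas poly_mapping_single_induct [case_names zero step] =
  poly_mapping_carrier_induct[OF subset_UNIV]

section \<open>The path algebra is a ring\<close>

definition bilin ::
  "('a \<Rightarrow> 'a \<Rightarrow> ('a \<Rightarrow>\<^sub>0 'k::comm_ring_1)) \<Rightarrow> ('a \<Rightarrow>\<^sub>0 'k) \<Rightarrow> ('a \<Rightarrow>\<^sub>0 'k) \<Rightarrow> ('a \<Rightarrow>\<^sub>0 'k)" where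
  "bilin M f g = lin (\<lambda>a. lin (M a) g) f"

lemma bilin_simps [simp]:
  "bilin M (f + g) h = bilin M f h + bilin M g h"
  "bilin M f (g + h) = bilin M f g + bilin M f h"
  "bilin M (scale c f) h = scale c (bilin M f h)"
  "bilin M f (scale c h) = scale c (bilin M f h)"
  "bilin M 0 h = 0" "bilin M f 0 = 0"
  "bilin M (- f) h = - bilin M f h"
  "bilin M f (- h) = - bilin M f h"
  "bilin M (f - g) h = bilin M f h - bilin M g h"
  "bilin M f (g - h) = bilin M f g - bilin M f h"
  using lin_fun_scale[of "- 1" "\<lambda>a. lin (M a) h" f]
    lin_fun_add[of "\<lambda>a. lin (M a) g" "\<lambda>a. - lin (M a) h" f]
  by (simp_all add: bilin_def lin_fun_add lin_fun_scale)

lemma bilin_single [simp]: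
  "bilin M (single a c) (single b d) = scale (c * d) (M a b)"
  by (simp add: bilin_def)

lemma bilin_sum_left: "bilin M (sum f A) h = (\<Sum>a\<in>A. bilin M (f a) h)"
  by (induction A rule: infinite_finite_induct) auto

lemma bilin_sum_right: "bilin M h (sum f A) = (\<Sum>a\<in>A. bilin M h (f a))"
  by (induction A rule: infinite_finite_induct) auto

text \<open>Both sides are linear in each of the three arguments, so the identity for basis elements
  is enough.\<close>

lemma bilin_assoc:
  assumes "\<And>a b c. bilin M (M a b) (single c 1) = bilin M (single a 1) (M b c)"
  shows "bilin M (bilin M f g) h = bilin M f (bilin M g h)"
proof (induction f rule: poly_mapping_single_induct)
  case (step a c f)
  have "bilin M (bilin M (single a 1) g) h = bilin M (single a 1) (bilin M g h)"
  proof (induction g rule: poly_mapping_single_induct)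
    case (step b c g)
    have "bilin M (bilin M (single a 1) (single b 1)) h
        = bilin M (single a 1) (bilin M (single b 1) h)"
      by (induction h rule: poly_mapping_single_induct)
        (simp_all add: assms del: scale_single)
    with step show ?case by (simp del: scale_single)
  qed auto
  with step show ?case by (simp del: scale_single)
qed auto

lemma path_algebra_mult: "mult (path_algebra G) f g = bilin (path_mult G) f g"
  by (simp add: path_algebra_def bilin_def lin_def scale.scale_sum_right)

lemma path_algebra_simps [simp]:
  "carrier (path_algebra G) = {f. keys f \<subseteq> paths G}"
  "\<one>\<^bsub>path_algebra G\<^esub> = (\<Sum>v\<in>verts G. single (v, []) 1)"
  "\<zero>\<^bsub>path_algebra G\<^esub> = 0"
  "add (path_algebra G) = (+)"
  "smult (path_algebra G) = scale"
  by (simp_all add: path_algebra_def)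

lemma awlast_conv:
  "pre_digraph.awlast G u p = (if p = [] then u else head G (last p))"
proof (induction p arbitrary: u)
  case (Cons a p)
  then show ?case
    by (cases p) (auto simp: pre_digraph.awalk_verts.simps)
qed (simp add: pre_digraph.awalk_verts.simps)

lemma awlast_append:
  "pre_digraph.awlast G u (p @ p') = pre_digraph.awlast G (pre_digraph.awlast G u p) p'"
  by (simp add: awlast_conv)

lemma path_mult_assoc:
  "bilin (path_mult G) (path_mult G \<alpha> \<beta>) (single \<gamma> 1)
    = bilin (path_mult G) (single \<alpha> 1) (path_mult G \<beta> \<gamma>)"
  by (auto simp: path_mult_def awlast_append)

lemma (in pre_digraph) cas_awlast: "cas u p v \<Longrightarrow> v = awlast u p"
  by (induction p arbitrary: u) auto

lemma paths_iff:
  "(u, p) \<in> paths G \<longleftrightarrow> pre_digraph.awalk G u p (pre_digraph.awlast G u p)"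
  using pre_digraph.cas_awlast[of G u p] by (auto simp: paths_def pre_digraph.awalk_def)

lemma paths_append:
  "(u, p @ p') \<in> paths G \<longleftrightarrow> (u, p) \<in> paths G \<and> set p' \<subseteq> arcs G \<and>
    pre_digraph.cas G (pre_digraph.awlast G u p) p' (pre_digraph.awlast G u (p @ p'))"
  by (auto simp: paths_iff pre_digraph.awalk_def pre_digraph.cas_append_iff
      simp flip: pre_digraph.cas_awlast dest: pre_digraph.cas_awlast)

lemma (in wf_digraph) paths_awlast_verts:
  "\<alpha> \<in> paths G \<Longrightarrow> awlast (fst \<alpha>) (snd \<alpha>) \<in> verts G"
  by (cases \<alpha>) (auto simp: paths_iff)

lemma keys_path_mult:
  assumes "\<alpha> \<in> paths G" "\<beta> \<in> paths G"
  shows "keys (path_mult G \<alpha> \<beta> :: _ \<Rightarrow>\<^sub>0 'k::comm_ring_1) \<subseteq> paths G"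
proof (cases "fst \<alpha> = pre_digraph.awlast G (fst \<beta>) (snd \<beta>)")
  case True
  have "pre_digraph.awalk G (fst \<alpha>) (snd \<alpha>) (pre_digraph.awlast G (fst \<alpha>) (snd \<alpha>))"
    using assms(1) paths_iff[of "fst \<alpha>" "snd \<alpha>" G] by simp
  with True assms(2) have "(fst \<beta>, snd \<beta> @ snd \<alpha>) \<in> paths G"
    unfolding paths_append awlast_append[of G "fst \<beta>" "snd \<beta>" "snd \<alpha>"]
    by (auto simp: pre_digraph.awalk_def)
  with True show ?thesis
    by (simp add: path_mult_def)
qed (simp add: path_mult_def)

lemma (in wf_digraph) ring_path_algebra:
  assumes "finite (verts G)"
  shows "ring (path_algebra G :: ('k::comm_ring_1, ('a, 'b) path \<Rightarrow>\<^sub>0 'k) module)"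
proof -
  let ?A = "path_algebra G :: ('k, ('a, 'b) path \<Rightarrow>\<^sub>0 'k) module"
  have one_l: "bilin (path_mult G) (\<Sum>v\<in>verts G. single (v, []) 1) f = f"
    if "keys f \<subseteq> paths G" for f :: "('a, 'b) path \<Rightarrow>\<^sub>0 'k"
    using that
  proof (induction f rule: poly_mapping_carrier_induct)
    case (step \<alpha> c g)
    \<comment> \<open>Of all trivial paths only the one at the end of \<open>\<alpha>\<close>
      survives in the product; \<open>finite (verts G)\<close> makes the sum meaningful.\<close>
    have "(\<Sum>v\<in>verts G. path_mult G (v, []) \<alpha> :: ('a, 'b) path \<Rightarrow>\<^sub>0 'k) = single \<alpha> 1"
      using assms paths_awlast_verts[OF step(1)] by (simp add: path_mult_def sum.delta)
    then show ?case
      using step by (simp add: bilin_sum_left flip: scale.scale_sum_right del: scale_single)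
  qed simp
  have one_r: "bilin (path_mult G) f (\<Sum>v\<in>verts G. single (v, []) 1) = f"
    if "keys f \<subseteq> paths G" for f :: "('a, 'b) path \<Rightarrow>\<^sub>0 'k"
    using that
  proof (induction f rule: poly_mapping_carrier_induct)
    case (step \<alpha> c g)
    have "fst \<alpha> \<in> verts G"
      using step(1) by (auto simp: paths_def)
    then have "(\<Sum>v\<in>verts G. path_mult G \<alpha> (v, []) :: ('a, 'b) path \<Rightarrow>\<^sub>0 'k) = single \<alpha> 1"
      using assms by (simp add: path_mult_def if_distrib[of "\<lambda>x. single x _"] sum.delta' cong: if_cong)
    then show ?case
      using step by (simp add: bilin_sum_right sum.distrib flip: scale.scale_sum_right del: scale_single)
  qed simp
  have closed: "keys (bilin (path_mult G) f g) \<subseteq> paths G"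
    if "keys f \<subseteq> paths G" "keys g \<subseteq> paths G"
    for f g :: "('a, 'b) path \<Rightarrow>\<^sub>0 'k"
    unfolding bilin_def using that by (intro keys_lin keys_path_mult) auto
  show ?thesis
  proof (rule ringI)
    show "abelian_group ?A"
    proof (rule abelian_groupI)
      show "\<exists>y\<in>carrier ?A. y \<oplus>\<^bsub>?A\<^esub> x = \<zero>\<^bsub>?A\<^esub>" if "x \<in> carrier ?A" for x
        using that by (intro bexI[of _ "- x"]) auto
    qed (auto simp: algebra_simps dest: keys_add[THEN subsetD])
    show "monoid ?A"
    proof (rule monoidI)
      have "(v, []) \<in> paths G" if "v \<in> verts G" for v
        using that by (auto simp: paths_def awalk_Nil_iff)
      then show "\<one>\<^bsub>?A\<^esub> \<in> carrier ?A"
        by (auto dest!: keys_sum[THEN subsetD] split: if_splits)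
    qed (simp_all add: path_algebra_mult one_l one_r closed bilin_assoc path_mult_assoc)
  qed (simp_all add: path_algebra_mult)
qed

section \<open>Length and inversions\<close>

definition enc :: "(nat \<Rightarrow> nat) \<Rightarrow> nat list" where
  "enc w = [w 1, w 2, w 3, w 4]"

text \<open>Sorted by length and then lexicographically. Group elements are later addressed by their
  index in this order, and the coefficient matrices are triangular with respect to it.\<close>

definition perms4 :: "nat list list" where
  "perms4 =
   [[1, 2, 3, 4], [1, 2, 4, 3], [1, 3, 2, 4], [2, 1, 3, 4], [1, 3, 4, 2], [1, 4, 2, 3],
    [2, 1, 4, 3], [2, 3, 1, 4], [3, 1, 2, 4], [1, 4, 3, 2], [2, 3, 4, 1], [2, 4, 1, 3],
    [3, 1, 4, 2], [3, 2, 1, 4], [4, 1, 2, 3], [2, 4, 3, 1], [3, 2, 4, 1], [3, 4, 1, 2],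
    [4, 1, 3, 2], [4, 2, 1, 3], [3, 4, 2, 1], [4, 2, 3, 1], [4, 3, 1, 2], [4, 3, 2, 1]]"

fun inversions :: "nat list \<Rightarrow> nat" where
  "inversions [] = 0"
| "inversions (x # xs) = length (filter (\<lambda>y. y < x) xs) + inversions xs"

text \<open>
  Named copies of simple reflections, the identity and products, which keep the simplifier from rewriting
  compositions and transpositions.
\<close>

definition sg :: "nat \<Rightarrow> nat \<Rightarrow> nat" where
  "sg i = simple i"

definition wid :: "nat \<Rightarrow> nat" where
  "wid = id"

definition lact :: "nat \<Rightarrow> (nat \<Rightarrow> nat) \<Rightarrow> nat \<Rightarrow> nat" where
  "lact i w = sg i \<circ> w"

definition ract :: "nat \<Rightarrow> (nat \<Rightarrow> nat) \<Rightarrow> nat \<Rightarrow> nat" where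
  "ract i w = w \<circ> sg i"

definition gens :: "nat set" where
  "gens = S"

lemma gens_set: "gens = set [1, 2, 3]"
  by (simp add: gens_def)

lemma W_iff: "w \<in> W \<longleftrightarrow> w permutes {1..4}"
  by (simp add: sym_group_carrier)

lemma wid_W [simp]: "wid \<in> W"
  by (simp add: W_iff wid_def permutes_id)

lemma simple_W: "i \<in> gens \<Longrightarrow> sg i \<in> W"
  by (auto simp: sg_def gens_def W_iff intro!: permutes_swap_id)

lemma comp_W: "v \<in> W \<Longrightarrow> w \<in> W \<Longrightarrow> v \<circ> w \<in> W"
  by (simp add: W_iff permutes_compose)

lemma act_W [simp]:
  "i \<in> gens \<Longrightarrow> w \<in> W \<Longrightarrow> lact i w \<in> W" "i \<in> gens \<Longrightarrow> w \<in> W \<Longrightarrow> ract i w \<in> W"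
  unfolding lact_def ract_def by (intro comp_W simple_W; assumption)+

lemma lact_ract: "lact i (ract j w) = ract j (lact i w)"
  by (simp add: lact_def ract_def comp_assoc)

lemma act_act [simp]: "lact i (lact i w) = w" "ract i (ract i w) = w"
  by (auto simp: fun_eq_iff lact_def ract_def sg_def)

lemma act_id: "lact i wid = sg i" "ract i wid = sg i"
  by (simp_all add: wid_def lact_def ract_def)

lemma distinct_perms4:
  "\<forall>a\<in>set [1, 2, 3, 4]. \<forall>b\<in>set [1, 2, 3, 4]. \<forall>c\<in>set [1, 2, 3, 4]. \<forall>d\<in>set [1, 2, 3, 4].
    distinct [a, b, c, d] \<longrightarrow> [a, b, c, d] \<in> set perms4"
  by code_simp

lemma enc_W: assumes "w \<in> W" shows "enc w \<in> set perms4"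
proof -
  have w: "w permutes {1..4}" using assms by (simp add: W_iff)
  have image: "w i \<in> set [1, 2, 3, 4]" if "i \<in> set [1, 2, 3, 4]" for i
  proof -
    have "i \<in> {1..4}" using that by auto
    then have "w i \<in> {1..4}" using permutes_in_image[OF w] by blast
    then show ?thesis by auto
  qed
  have "w 1 \<noteq> w 2" "w 1 \<noteq> w 3" "w 1 \<noteq> w 4" "w 2 \<noteq> w 3" "w 2 \<noteq> w 4" "w 3 \<noteq> w 4"
    using permutes_inj[OF w] by (simp_all add: inj_eq)
  then have "distinct [w 1, w 2, w 3, w 4]"
    by simp
  then show ?thesis
    unfolding enc_def
    by (intro distinct_perms4[THEN bspec, THEN bspec, THEN bspec, THEN bspec, THEN mp] image) simp_all
qed

lemma enc_inj:
  assumes "v \<in> W" "w \<in> W" "enc v = enc w" shows "v = w"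
proof
  fix i
  show "v i = w i"
  proof (cases "i \<in> {1..4}")
    case True
    then have "i = 1 \<or> i = 2 \<or> i = 3 \<or> i = 4" by auto
    then show ?thesis using assms(3) by (auto simp: enc_def)
  next
    case False
    with assms(1,2) show ?thesis
      by (simp add: W_iff permutes_not_in)
  qed
qed

lemma enc_lact: "enc (lact i w) = map (sg i) (enc w)"
  by (simp add: enc_def lact_def)

text \<open>Right multiplication by a simple reflection exchanges the entries at positions
  \<open>i\<close> and \<open>i + 1\<close> of the one-line notation, whereas left multiplication
  exchanges the values \<open>i\<close> and \<open>i + 1\<close>. The shift by one is due to lists
  starting at index 0.\<close>

definition swap_at :: "nat \<Rightarrow> nat list \<Rightarrow> nat list" where
  "swap_at i l = map (\<lambda>j. l ! (sg i j - 1)) [1, 2, 3, 4]"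

lemma enc_ract: "i \<in> gens \<Longrightarrow> enc (ract i w) = swap_at i (enc w)"
  by (auto simp: ract_def gens_def sg_def enc_def swap_at_def transpose_def numeral_nat)

lemma inversions_step:
  "\<forall>l\<in>set perms4. \<forall>i\<in>gens.
    inversions (map (sg i) l) = inversions l + 1 \<or> inversions l = inversions (map (sg i) l) + 1"
  unfolding gens_set by code_simp

text \<open>If l is not the identity, some value i + 1 stands before i; exchanging these two values
  removes exactly one inversion.\<close>

lemma inversions_descent:
  "\<forall>l\<in>set perms4. l = [1, 2, 3, 4] \<or>
    (\<exists>i\<in>gens. inversions l = inversions (map (sg i) l) + 1)"
  unfolding gens_set by code_simp

lemma word_simps:
  "word [] = wid" "word (i # is) = lact i (word is)"
  by (simp_all add: wid_def word_def lact_def sg_def)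

lemma word_snoc: "word (is @ [i]) = ract i (word is)"
  by (induction "is") (simp_all add: word_simps lact_ract act_id)

lemma word_W: "set is \<subseteq> gens \<Longrightarrow> word is \<in> W"
  by (induction "is") (auto simp: word_simps)

lemma inversions_word_le: "set is \<subseteq> gens \<Longrightarrow> inversions (enc (word is)) \<le> length is"
proof (induction "is")
  case Nil
  then show ?case by (simp add: word_simps wid_def enc_def)
next
  case (Cons i "is")
  then have "enc (word is) \<in> set perms4" "i \<in> gens"
    by (auto intro: enc_W word_W)
  moreover have "enc (word (i # is)) = map (sg i) (enc (word is))"
    by (simp only: word_simps enc_lact)
  ultimately show ?case
    using Cons inversions_step[rule_format, of "enc (word is)" i] by auto
qed

lemma inversions_word_ex:
  assumes "w \<in> W"
  shows "\<exists>is. set is \<subseteq> gens \<and> word is = w \<and> length is = inversions (enc w)"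
  using assms
proof (induction "inversions (enc w)" arbitrary: w rule: less_induct)
  case less
  show ?case
  proof (cases "enc w = [1, 2, 3, 4]")
    case True
    then have "w = wid"
      by (intro enc_inj less.prems wid_W) (simp add: wid_def enc_def)
    then show ?thesis by (intro exI[of _ "[]"]) (simp add: word_simps wid_def enc_def)
  next
    case False
    then obtain i where i: "i \<in> gens" "inversions (enc w) = inversions (enc (lact i w)) + 1"
      using inversions_descent[rule_format, OF enc_W[OF less.prems]] by (auto simp: enc_lact)
    then obtain "is" where "set is \<subseteq> gens" "word is = lact i w"
      "length is = inversions (enc (lact i w))"
      using less.hyps[of "lact i w"] less.prems by auto
    with i show ?thesis
      by (intro exI[of _ "i # is"]) (auto simp: word_simps)
  qed
qed

text \<open>A generator changes the number of inversions by one, so a word cannot have more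
  inversions than letters; conversely inversions can be removed one at a time by generators.\<close>

lemma len_inversions:
  assumes "w \<in> W" shows "len w = inversions (enc w)"
  unfolding len_def gens_def[symmetric]
proof (rule Least_equality)
  show "inversions (enc w) \<le> n" if "\<exists>is. set is \<subseteq> gens \<and> word is = w \<and> length is = n" for n
    using that inversions_word_le by blast
qed (rule inversions_word_ex[OF assms])

lemma len_le_length: "set is \<subseteq> gens \<Longrightarrow> len (word is) \<le> length is"
  using inversions_word_le by (simp add: len_inversions word_W)

lemma reduced_word:
  assumes "w \<in> W"
  shows "set (reduced_word w) \<subseteq> gens" "word (reduced_word w) = w" "length (reduced_word w) = len w"
proof -
  have "\<exists>is. set is \<subseteq> gens \<and> word is = w \<and> length is = len w"
    using inversions_word_ex[OF assms] len_inversions[OF assms] by simp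
  then have "\<exists>is. set is \<subseteq> S \<and> word is = w \<and> length is = len w"
    by (simp add: gens_def)
  from someI_ex[OF this] show "set (reduced_word w) \<subseteq> gens" "word (reduced_word w) = w"
    "length (reduced_word w) = len w"
    unfolding reduced_word_def gens_def by auto
qed

lemma len_lact:
  assumes "w \<in> W" "i \<in> gens"
  shows "len (lact i w) = len w + 1 \<or> len w = len (lact i w) + 1"
proof -
  have "lact i w \<in> W" using assms by simp
  then show ?thesis
    using assms inversions_step[rule_format, OF enc_W[OF assms(1)] assms(2)] by (auto simp: len_inversions enc_lact)
qed

lemma inversions_swap_at:
  "\<forall>l\<in>set perms4. \<forall>i\<in>gens.
    inversions (swap_at i l) = inversions l + 1 \<or> inversions l = inversions (swap_at i l) + 1"
  unfolding gens_set by code_simp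

lemma len_ract:
  assumes "w \<in> W" "i \<in> gens"
  shows "len (ract i w) = len w + 1 \<or> len w = len (ract i w) + 1"
proof -
  have "ract i w \<in> W" using assms by simp
  then show ?thesis
    using assms inversions_swap_at[rule_format, OF enc_W[OF assms(1)] assms(2)] by (auto simp: len_inversions enc_ract)
qed

text \<open>The consequence of the exchange condition behind the construction of Hecke algebras:
  unless sw = wt, whether s lengthens w is unaffected by passing from w to wt, and whether t
  lengthens w is unaffected by passing from w to sw.\<close>

lemma inversions_exchange:
  "\<forall>l\<in>set perms4. \<forall>i\<in>gens. \<forall>j\<in>gens.
    map (sg i) l = swap_at j l \<or>
    (inversions l < inversions (map (sg i) l)) =
      (inversions (swap_at j l) < inversions (map (sg i) (swap_at j l))) \<and>
    (inversions l < inversions (swap_at j l)) =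
      (inversions (map (sg i) l) < inversions (swap_at j (map (sg i) l)))"
  unfolding gens_set by code_simp

lemma len_exchange:
  assumes "w \<in> W" "i \<in> gens" "j \<in> gens" "lact i w \<noteq> ract j w"
  shows "len w < len (lact i w) \<longleftrightarrow> len (ract j w) < len (lact i (ract j w))"
    and "len w < len (ract j w) \<longleftrightarrow> len (lact i w) < len (ract j (lact i w))"
proof -
  have W: "lact i w \<in> W" "ract j w \<in> W" "lact i (ract j w) \<in> W"
      "ract j (lact i w) \<in> W"
    using assms by (auto )
  have "enc (lact i w) \<noteq> enc (ract j w)"
    using enc_inj W assms(4) by blast
  then have "map (sg i) (enc w) \<noteq> swap_at j (enc w)"
    using assms(3) by (simp add: enc_lact enc_ract)
  then have "(inversions (enc w) < inversions (map (sg i) (enc w))) =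
      (inversions (swap_at j (enc w)) < inversions (map (sg i) (swap_at j (enc w)))) \<and>
    (inversions (enc w) < inversions (swap_at j (enc w))) =
      (inversions (map (sg i) (enc w)) < inversions (swap_at j (map (sg i) (enc w))))"
    using inversions_exchange[rule_format, OF enc_W[OF assms(1)] assms(2,3)] by (auto simp del: map_map)
  then show "len w < len (lact i w) \<longleftrightarrow> len (ract j w) < len (lact i (ract j w))"
    and "len w < len (ract j w) \<longleftrightarrow> len (lact i w) < len (ract j (lact i w))"
    using W assms(1,3) by (simp_all add: len_inversions enc_lact enc_ract del: map_map)
qed

section \<open>The Hecke algebra\<close>

definition HW :: "hecke set" where
  "HW = {h. keys h \<subseteq> W}"

lemma HW_simps [simp]:
  "0 \<in> HW" "a \<in> HW \<Longrightarrow> b \<in> HW \<Longrightarrow> a + b \<in> HW" "a \<in> HW \<Longrightarrow> - a \<in> HW"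
  "a \<in> HW \<Longrightarrow> b \<in> HW \<Longrightarrow> a - b \<in> HW" "a \<in> HW \<Longrightarrow> scale c a \<in> HW"
  "w \<in> W \<Longrightarrow> single w c \<in> HW"
  using keys_add[of a b] keys_diff[of a b] keys_scale_subset[of c a]
  by (auto simp: HW_def)

lemma HW_induct [consumes 1, case_names zero step]:
  assumes "h \<in> HW" "P 0"
    "\<And>w c g. \<lbrakk>w \<in> W; g \<in> HW; P g\<rbrakk> \<Longrightarrow> P (scale c (T w) + g)"
  shows "P h"
  using assms unfolding HW_def by (auto intro: poly_mapping_carrier_induct[of h W P])

lemma HW_eqI:
  assumes "a \<in> HW" "b \<in> HW" "\<And>w. w \<in> W \<Longrightarrow> lookup a w = lookup b w"
  shows "a = b"
proof (rule poly_mapping_eqI)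
  fix w
  show "lookup a w = lookup b w"
  proof (cases "w \<in> W")
    case False
    then have "w \<notin> keys a" "w \<notin> keys b"
      using assms(1,2) unfolding HW_def by blast+
    then show ?thesis by (simp add: in_keys_iff)
  qed (rule assms(3))
qed

lemma HW_lin: "(\<And>w. w \<in> W \<Longrightarrow> F w \<in> HW) \<Longrightarrow> h \<in> HW \<Longrightarrow> lin F h \<in> HW"
  unfolding HW_def mem_Collect_eq by (rule keys_lin) blast

definition gen_left :: "nat \<Rightarrow> hecke \<Rightarrow> hecke" where
  "gen_left i = lin (\<lambda>w. if len w < len (lact i w) then T (lact i w)
      else scale (q - 1) (T w) + scale q (T (lact i w)))"

text \<open>Right multiplication by a generator is introduced as an operator in its own right,
  before the product is known to be associative. These operators are the test family of
  \<open>HW_operator_eqI\<close>; only afterwards does \<open>hecke_mult_simple\<close> identify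
  them with multiplication by T_s.\<close>

definition gen_right :: "nat \<Rightarrow> hecke \<Rightarrow> hecke" where
  "gen_right i = lin (\<lambda>w. if len w < len (ract i w) then T (ract i w)
      else scale (q - 1) (T w) + scale q (T (ract i w)))"

lemma hecke_gen_left_eq: "hecke_gen_left = gen_left"
  by (intro ext) (simp only: lact_def sg_def hecke_gen_left_def gen_left_def lin_def)

lemma gen_linear [simp]:
  "gen_left i 0 = 0" "gen_left i (a + b) = gen_left i a + gen_left i b"
  "gen_left i (scale c a) = scale c (gen_left i a)"
  "gen_right i 0 = 0" "gen_right i (a + b) = gen_right i a + gen_right i b"
  "gen_right i (scale c a) = scale c (gen_right i a)"
  by (simp_all add: gen_left_def gen_right_def)

lemma gen_T:
  "gen_left i (T w) = (if len w < len (lact i w) then T (lact i w)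
      else scale (q - 1) (T w) + scale q (T (lact i w)))"
  "gen_right i (T w) = (if len w < len (ract i w) then T (ract i w)
      else scale (q - 1) (T w) + scale q (T (ract i w)))"
  by (simp_all add: gen_left_def gen_right_def)

lemma gen_HW [simp]:
  assumes "i \<in> gens" "h \<in> HW"
  shows "gen_left i h \<in> HW" "gen_right i h \<in> HW"
  unfolding gen_left_def gen_right_def using assms
  by (auto intro!: HW_lin HW_simps simp del: scale_single)

lemma act_eq_iff:
  "lact i v = w \<longleftrightarrow> v = lact i w" "ract i v = w \<longleftrightarrow> v = ract i w"
  by (metis act_act)+

text \<open>The coefficient at w receives contributions from w and sw only. Reading the operator off
  coefficient by coefficient serves the commutation proof, the description of invariants and the
  computation with lists.\<close>

lemma lookup_gen_left:
  assumes "h \<in> HW" "w \<in> W" "i \<in> gens"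
  shows "lookup (gen_left i h) w =
    (if len w < len (lact i w) then q * lookup h (lact i w)
     else lookup h (lact i w) + (q - 1) * lookup h w)"
  using assms(1)
proof (induction h rule: HW_induct)
  case (step v c g)
  have "lact i w \<noteq> w"
    using len_lact[OF assms(2,3)] by auto
  moreover have "len (lact i v) < len v" if "\<not> len v < len (lact i v)"
    using len_lact[OF step(1) assms(3)] that by auto
  moreover have "len (lact i w) < len w" if "\<not> len w < len (lact i w)"
    using len_lact[OF assms(2,3)] that by auto
  moreover have "lact i v = w \<longleftrightarrow> v = lact i w"
    by (rule act_eq_iff)
  ultimately have "lookup (gen_left i (T v)) w =
    (if len w < len (lact i w) then q * lookup (T v) (lact i w)
     else lookup (T v) (lact i w) + (q - 1) * lookup (T v) w)"
    unfolding gen_T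
    by (cases "v = w"; cases "v = lact i w")
      (simp_all add: lookup_add lookup_single when_def del: scale_single)
  with step show ?case
    by (simp add: lookup_add algebra_simps del: scale_single)
qed simp

lemma lookup_gen_right:
  assumes "h \<in> HW" "w \<in> W" "i \<in> gens"
  shows "lookup (gen_right i h) w =
    (if len w < len (ract i w) then q * lookup h (ract i w)
     else lookup h (ract i w) + (q - 1) * lookup h w)"
  using assms(1)
proof (induction h rule: HW_induct)
  case (step v c g)
  have "ract i w \<noteq> w"
    using len_ract[OF assms(2,3)] by auto
  moreover have "len (ract i v) < len v" if "\<not> len v < len (ract i v)"
    using len_ract[OF step(1) assms(3)] that by auto
  moreover have "len (ract i w) < len w" if "\<not> len w < len (ract i w)"
    using len_ract[OF assms(2,3)] that by auto
  moreover have "ract i v = w \<longleftrightarrow> v = ract i w"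
    by (rule act_eq_iff)
  ultimately have "lookup (gen_right i (T v)) w =
    (if len w < len (ract i w) then q * lookup (T v) (ract i w)
     else lookup (T v) (ract i w) + (q - 1) * lookup (T v) w)"
    unfolding gen_T
    by (cases "v = w"; cases "v = ract i w")
      (simp_all add: lookup_add lookup_single when_def del: scale_single)
  with step show ?case
    by (simp add: lookup_add algebra_simps del: scale_single)
qed simp

text \<open>If sw = wt, then s(wt) = w = (sw)t and both sides have the same coefficient formula at
  w. Otherwise w, sw, wt and swt are distinct, and by \<open>len_exchange\<close> each operator acts
  in its own direction by a rule that does not depend on the other direction.\<close>

lemma gen_left_right_commute:
  assumes "h \<in> HW" "i \<in> gens" "j \<in> gens"
  shows "gen_left i (gen_right j h) = gen_right j (gen_left i h)"
proof (rule HW_eqI)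
  fix w assume w: "w \<in> W"
  let ?sw = "lact i w" and ?wt = "ract j w"
  have W: "?sw \<in> W" "?wt \<in> W"
    using w assms by simp_all
  have h: "gen_right j h \<in> HW" "gen_left i h \<in> HW"
    using assms by auto
  note lookups = lookup_gen_left[OF h(1) w assms(2)] lookup_gen_right[OF h(2) w assms(3)]
    lookup_gen_right[OF assms(1) w assms(3)] lookup_gen_right[OF assms(1) W(1) assms(3)]
    lookup_gen_left[OF assms(1) w assms(2)] lookup_gen_left[OF assms(1) W(2) assms(2)]
  show "lookup (gen_left i (gen_right j h)) w
      = lookup (gen_right j (gen_left i h)) w"
  proof (cases "?sw = ?wt")
    case True
    then have "ract j ?sw = w" "lact i ?wt = w"
      by (metis act_act)+
    with True show ?thesis
      unfolding lookups by (simp add: algebra_simps)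
  next
    case False
    have "lact i ?wt = ract j ?sw"
      by (rule lact_ract)
    then show ?thesis
      unfolding lookups len_exchange[OF w assms(2,3) False]
      using len_exchange[OF w assms(2,3) False]
      by (simp add: algebra_simps)
  qed
qed (use assms in auto)

text \<open>The identity generates the whole module under the right operators: removing the last
  letter j of a reduced word of w writes T_w as the image under \<open>gen_right j\<close> of a
  basis element one step shorter. An operator compatible with them is therefore fixed by a single
  value.\<close>

lemma HW_operator_eqI:
  assumes "F (T wid) = G (T wid)"
    and "\<And>a b. a \<in> HW \<Longrightarrow> b \<in> HW \<Longrightarrow> F (a + b) = F a + F b"
    and "\<And>a b. a \<in> HW \<Longrightarrow> b \<in> HW \<Longrightarrow> G (a + b) = G a + G b"
    and "\<And>a c. a \<in> HW \<Longrightarrow> F (scale c a) = scale c (F a)"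
    and "\<And>a c. a \<in> HW \<Longrightarrow> G (scale c a) = scale c (G a)"
    and "\<And>a j. a \<in> HW \<Longrightarrow> j \<in> gens \<Longrightarrow> F (gen_right j a) = gen_right j (F a)"
    and "\<And>a j. a \<in> HW \<Longrightarrow> j \<in> gens \<Longrightarrow> G (gen_right j a) = gen_right j (G a)"
    and "h \<in> HW"
  shows "F h = G h"
proof -
  have T: "F (T w) = G (T w)" if "w \<in> W" for w
    using that
  proof (induction "len w" arbitrary: w)
    case 0
    then have "w = wid" using reduced_word[of w] by (auto simp: word_simps)
    then show ?case using assms(1) by (simp only:)
  next
    case (Suc n)
    then obtain js j where js: "reduced_word w = js @ [j]"
      using reduced_word(3)[of w] by (metis length_0_conv rev_exhaust nat.distinct(2))
    let ?v = "ract j w"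
    have j: "j \<in> gens" "set js \<subseteq> gens" "w = ract j (word js)" "length js = n"
      using reduced_word[OF Suc.prems] js Suc.hyps(2) by (auto simp: word_snoc)
    then have v: "?v = word js" "?v \<in> W"
      using word_W[of js] by simp_all
    then have "len ?v = n"
      using len_le_length[OF j(2)] len_ract[OF Suc.prems j(1)] Suc.hyps(2) j(4) by simp
    then have "gen_right j (T ?v) = T w"
      using Suc.hyps(2) by (simp add: gen_T)
    moreover have "F (T ?v) = G (T ?v)"
      using Suc.hyps(1) \<open>len ?v = n\<close> v by simp
    ultimately show ?case
      using assms(6,7)[of "T ?v" j] v j(1) by simp
  qed
  have "F 0 = 0" "G 0 = 0"
    using assms(4,5)[of 0 0] by simp_all
  with assms(8) show ?thesis
    by (induction h rule: HW_induct) (simp_all add: assms(2-5) T del: scale_single)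
qed

section \<open>The Hecke product, its associativity and independence of reduced words\<close>

lemma foldr_gen_left:
  assumes "set is \<subseteq> gens"
  shows "foldr gen_left is 0 = 0"
    "foldr gen_left is (a + b) = foldr gen_left is a + foldr gen_left is b"
    "foldr gen_left is (scale c a) = scale c (foldr gen_left is a)"
    "a \<in> HW \<Longrightarrow> foldr gen_left is a \<in> HW"
    "a \<in> HW \<Longrightarrow> j \<in> gens \<Longrightarrow> foldr gen_left is (gen_right j a) = gen_right j (foldr gen_left is a)"
  using assms by (induction "is") (auto simp: gen_left_right_commute)

text \<open>Every suffix of a reduced word is reduced, so each letter lengthens what stands to its
  right and the quadratic relation never enters.\<close>

lemma foldr_gen_left_T:
  assumes "set is \<subseteq> gens" "length is = len (word is)"
  shows "foldr gen_left is (T wid) = T (word is)"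
  using assms
proof (induction "is")
  case (Cons i "is")
  have W: "word is \<in> W" "i \<in> gens" using Cons by (auto intro: word_W)
  have "len (word is) = length is" "len (word is) < len (lact i (word is))"
    using len_le_length[of "is"] len_lact[OF W] Cons.prems by (auto simp: word_simps)
  with Cons show ?case
    by (simp add: gen_T word_simps)
qed (simp add: word_simps)

lemma hecke_mult_lin:
  "hecke_mult a h = lin (\<lambda>w. foldr gen_left (reduced_word w) h) a"
  by (simp add: hecke_mult_def lin_def hecke_gen_left_eq)

lemma hecke_mult_left [simp]:
  "hecke_mult 0 h = 0" "hecke_mult (a + b) h = hecke_mult a h + hecke_mult b h"
  "hecke_mult (scale c a) h = scale c (hecke_mult a h)"
  by (simp_all add: hecke_mult_lin)

lemma hecke_mult_right:
  assumes "a \<in> HW"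
  shows "hecke_mult a 0 = 0" "hecke_mult a (g + h) = hecke_mult a g + hecke_mult a h"
    "hecke_mult a (scale c h) = scale c (hecke_mult a h)"
    "h \<in> HW \<Longrightarrow> hecke_mult a h \<in> HW"
    "h \<in> HW \<Longrightarrow> j \<in> gens \<Longrightarrow> hecke_mult a (gen_right j h) = gen_right j (hecke_mult a h)"
  using assms
  by (induction a rule: HW_induct)
    (simp_all add: hecke_mult_lin foldr_gen_left reduced_word scale.scale_right_distrib
      scale.scale_left_commute algebra_simps del: scale_single)

lemma hecke_mult_id_right: "a \<in> HW \<Longrightarrow> hecke_mult a (T wid) = a"
  by (induction a rule: HW_induct)
    (simp_all add: hecke_mult_lin foldr_gen_left_T reduced_word del: scale_single)

text \<open>As functions of \<open>c\<close> both sides commute with the right operators, and at the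
  identity both are the product of \<open>a\<close> and \<open>b\<close>.\<close>

lemma hecke_mult_assoc:
  assumes "a \<in> HW" "b \<in> HW" "c \<in> HW"
  shows "hecke_mult (hecke_mult a b) c = hecke_mult a (hecke_mult b c)"
  by (rule HW_operator_eqI[of "hecke_mult (hecke_mult a b)" "\<lambda>c. hecke_mult a (hecke_mult b c)"])
    (use assms in \<open>simp_all add: hecke_mult_right hecke_mult_id_right\<close>)

text \<open>Frees the product from the choice hidden in \<open>reduced_word\<close>, so that
  explicit words can be used in computations. Both operators send the identity to the basis element
  of the word.\<close>

lemma hecke_mult_T_word:
  assumes "set is \<subseteq> gens" "length is = len (word is)" "h \<in> HW"
  shows "hecke_mult (T (word is)) h = foldr gen_left is h"
proof -
  have W: "T (word is) \<in> HW" using assms by (simp add: word_W)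
  show ?thesis
    by (rule HW_operator_eqI[of "hecke_mult (T (word is))" "foldr gen_left is"])
      (use assms W in \<open>simp_all add: hecke_mult_right hecke_mult_id_right foldr_gen_left foldr_gen_left_T\<close>)
qed

lemma len_wid [simp]: "len wid = 0"
  using len_le_length[of "[]"] by (simp add: word_simps)

lemma len_simple: "i \<in> gens \<Longrightarrow> len (sg i) = 1"
  using len_lact[of wid i] by (simp add: act_id)

lemma hecke_mult_simple:
  assumes "i \<in> gens" "h \<in> HW"
  shows "hecke_mult (T (sg i)) h = gen_left i h" "hecke_mult h (T (sg i)) = gen_right i h"
proof -
  show "hecke_mult (T (sg i)) h = gen_left i h"
    using hecke_mult_T_word[of "[i]" h] assms len_simple[of i] by (simp add: word_simps act_id)
  have "gen_right i (T wid) = T (sg i)"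
    using len_simple[OF assms(1)] by (simp add: gen_T act_id)
  then show "hecke_mult h (T (sg i)) = gen_right i h"
    using hecke_mult_right(5)[OF assms(2), of "T wid" i] assms by (simp add: hecke_mult_id_right)
qed

lemma Hecke_simps [simp]:
  "carrier Hecke = HW" "mult Hecke = hecke_mult"
  by (simp_all add: Hecke_def HW_def)

section \<open>Elements on which the generators of a parabolic subgroup act by q\<close>

definition left_invariant :: "nat set \<Rightarrow> hecke set" where
  "left_invariant I = {h \<in> HW. \<forall>i\<in>I. gen_left i h = scale q h}"

definition right_invariant :: "nat set \<Rightarrow> hecke set" where
  "right_invariant I = {h \<in> HW. \<forall>i\<in>I. gen_right i h = scale q h}"

text \<open>At the longer of w and sw, written v, comparing coefficients gives h(sv) + (q - 1) h(v)
  = q h(v), hence h(sv) = h(v). Thus invariant elements are exactly those with coefficients constant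
  along cosets, the converse being \<open>left_invariantI\<close>.\<close>

lemma left_invariant_lookup:
  assumes "h \<in> left_invariant I" "i \<in> I" "I \<subseteq> gens" "w \<in> W"
  shows "lookup h (lact i w) = lookup h w"
proof -
  have i: "i \<in> gens" and h: "h \<in> HW" "gen_left i h = scale q h"
    using assms by (auto simp: left_invariant_def)
  have sw: "lact i w \<in> W" using i assms by simp
  have eq: "lookup h (lact i v) = lookup h v"
    if "v \<in> W" "\<not> len v < len (lact i v)" for v
    using lookup_gen_left[OF h(1) that(1) i] that(2) h(2) by (simp add: algebra_simps)
  show ?thesis
    using eq[OF assms(4)] eq[OF sw] by (cases "len w < len (lact i w)") simp_all
qed

lemma right_invariant_lookup:
  assumes "h \<in> right_invariant I" "i \<in> I" "I \<subseteq> gens" "w \<in> W"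
  shows "lookup h (ract i w) = lookup h w"
proof -
  have i: "i \<in> gens" and h: "h \<in> HW" "gen_right i h = scale q h"
    using assms by (auto simp: right_invariant_def)
  have sw: "ract i w \<in> W" using i assms by simp
  have eq: "lookup h (ract i v) = lookup h v"
    if "v \<in> W" "\<not> len v < len (ract i v)" for v
    using lookup_gen_right[OF h(1) that(1) i] that(2) h(2) by (simp add: algebra_simps)
  show ?thesis
    using eq[OF assms(4)] eq[OF sw] by (cases "len w < len (ract i w)") simp_all
qed

lemma left_invariantI:
  assumes "h \<in> HW" "I \<subseteq> gens"
    "\<And>i w. i \<in> I \<Longrightarrow> w \<in> W \<Longrightarrow> lookup h (lact i w) = lookup h w"
  shows "h \<in> left_invariant I"
  using assms unfolding left_invariant_def
  by (auto intro!: HW_eqI simp: lookup_gen_left subset_iff algebra_simps)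

lemma right_invariantI:
  assumes "h \<in> HW" "I \<subseteq> gens"
    "\<And>i w. i \<in> I \<Longrightarrow> w \<in> W \<Longrightarrow> lookup h (ract i w) = lookup h w"
  shows "h \<in> right_invariant I"
  using assms unfolding right_invariant_def
  by (auto intro!: HW_eqI simp: lookup_gen_right subset_iff algebra_simps)

section \<open>Parabolic subgroups\<close>

text \<open>One reduced word for each group element, sorted by length.\<close>

definition words4 :: "nat list list" where
  "words4 =
   [[], [3], [2], [1], [2, 3], [3, 2],
   [1, 3], [1, 2], [2, 1], [2, 3, 2], [1, 2, 3], [1, 3, 2],
   [2, 1, 3], [1, 2, 1], [3, 2, 1], [1, 2, 3, 2], [1, 2, 1, 3], [2, 1, 3, 2],
   [2, 3, 2, 1], [1, 3, 2, 1], [1, 2, 1, 3, 2], [1, 2, 3, 2, 1], [2, 1, 3, 2, 1], [1, 2, 1, 3, 2, 1]]"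

definition enc_word :: "nat list \<Rightarrow> nat list" where
  "enc_word is = foldr (\<lambda>i. map (sg i)) is [1, 2, 3, 4]"

lemma enc_word: "enc (word is) = enc_word is"
  by (induction "is") (simp_all add: enc_word_def word_simps enc_lact, simp add: enc_def wid_def)

lemma perms4_words4: "map enc_word words4 = perms4"
  by code_simp

lemma words4_props:
  "\<forall>is\<in>set words4. (\<forall>i\<in>set is. i \<in> set [1, 2, 3]) \<and> length is = inversions (enc_word is)"
  by code_simp

lemma words4_gens: "is \<in> set words4 \<Longrightarrow> set is \<subseteq> gens"
  using words4_props by (auto simp: gens_set)

lemma words4_reduced: "is \<in> set words4 \<Longrightarrow> length is = len (word is)"
  using words4_props words4_gens[of "is"] by (simp add: len_inversions word_W enc_word)

lemma W_words4: "w \<in> W \<Longrightarrow> \<exists>is\<in>set words4. w = word is"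
proof -
  assume w: "w \<in> W"
  then have "enc w \<in> enc_word ` set words4"
    using enc_W[OF w] by (simp flip: perms4_words4)
  then obtain js where js: "js \<in> set words4" "enc w = enc (word js)"
    by (auto simp: enc_word)
  then have "w = word js"
    using w words4_gens by (intro enc_inj) (auto intro: word_W)
  with js show ?thesis by blast
qed

lemma finite_W: "finite W"
  using W_words4 by (intro finite_subset[of W "word ` set words4"]) auto

lemma distinct_perms4_list: "distinct perms4"
  by code_simp

lemma inj_words4: "inj_on word (set words4)"
proof (rule inj_onI)
  fix a b assume ab: "a \<in> set words4" "b \<in> set words4" "word a = word b"
  then have "enc_word a = enc_word b"
    by (metis enc_word)
  moreover have "inj_on enc_word (set words4)"
    using distinct_perms4_list by (simp add: distinct_map flip: perms4_words4)
  ultimately show "a = b"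
    using ab by (auto dest: inj_onD)
qed

lemma distinct_words4: "distinct words4"
  using distinct_perms4_list by (simp add: distinct_map flip: perms4_words4)

text \<open>
  Entry k of the i-th table tells whether left multiplication by the i-th simple reflection lengthens
  the k-th element of \<^const>\<open>words4\<close>, and gives the index of the product.
\<close>

definition ltab :: "nat \<Rightarrow> (bool \<times> nat) list" where
  "ltab i =
   (if i = 1 then
    [(True, 3), (True, 6), (True, 7), (False, 0), (True, 10), (True, 11),
     (False, 1), (False, 2), (True, 13), (True, 15), (False, 4), (False, 5),
     (True, 16), (False, 8), (True, 19), (False, 9), (False, 12), (True, 20),
     (True, 21), (False, 14), (False, 17), (False, 18), (True, 23), (False, 22)]
    else if i = 2 then
    [(True, 2), (True, 4), (False, 0), (True, 8), (False, 1), (True, 9),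
     (True, 12), (True, 13), (False, 3), (False, 5), (True, 16), (True, 17),
     (False, 6), (False, 7), (True, 18), (True, 20), (False, 10), (False, 11),
     (False, 14), (True, 22), (False, 15), (True, 23), (False, 19), (False, 21)]
    else
    [(True, 1), (False, 0), (True, 5), (True, 6), (True, 9), (False, 2),
     (False, 3), (True, 11), (True, 14), (False, 4), (True, 15), (False, 7),
     (True, 18), (True, 19), (False, 8), (False, 10), (True, 21), (True, 22),
     (False, 12), (False, 13), (True, 23), (False, 16), (False, 17), (False, 20)])"

lemma ltab_props:
  "\<forall>i\<in>set [1, 2, 3]. map (\<lambda>(up, j). perms4 ! j) (ltab i) = map (map (sg i)) perms4 \<and>
    map fst (ltab i) = map (\<lambda>p. inversions p < inversions (map (sg i) p)) perms4 \<and>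
    list_all (\<lambda>x. snd x < 24) (ltab i)"
  by code_simp

lemma length_lists: "length perms4 = 24" "length words4 = 24"
proof -
  show "length perms4 = 24" by code_simp
  then show "length words4 = 24" by (simp flip: perms4_words4)
qed

lemma ltab_nth:
  assumes "i \<in> gens" "k < 24"
  shows "snd (ltab i ! k) < 24"
    "lact i (word (words4 ! k)) = word (words4 ! snd (ltab i ! k))"
    "fst (ltab i ! k) \<longleftrightarrow> len (word (words4 ! k)) < len (lact i (word (words4 ! k)))"
proof -
  have *: "map (\<lambda>(up, j). perms4 ! j) (ltab i) = map (map (sg i)) perms4"
    "map fst (ltab i) = map (\<lambda>p. inversions p < inversions (map (sg i) p)) perms4"
    "\<And>x. x \<in> set (ltab i) \<Longrightarrow> snd x < 24"
    using ltab_props[rule_format, of i] assms(1) by (auto simp: gens_set list_all_iff)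
  then have len: "length (ltab i) = 24"
    using length_lists by (metis length_map)
  show j: "snd (ltab i ! k) < 24"
    using *(3) len assms by simp
  have p: "perms4 ! n = enc (word (words4 ! n))" if "n < 24" for n
    using that length_lists by (simp add: enc_word flip: perms4_words4)
  have "perms4 ! snd (ltab i ! k) = map (sg i) (perms4 ! k)"
    using arg_cong[OF *(1), of "\<lambda>l. l ! k"] len assms length_lists by (simp add: case_prod_beta)
  then have e: "enc (word (words4 ! snd (ltab i ! k))) = enc (lact i (word (words4 ! k)))"
    using p assms j by (simp add: enc_lact)
  have W: "word (words4 ! n) \<in> W" if "n < 24" for n
    using that length_lists by (intro word_W words4_gens) simp
  show l: "lact i (word (words4 ! k)) = word (words4 ! snd (ltab i ! k))"
    using e W assms j by (intro enc_inj) auto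
  show "fst (ltab i ! k) \<longleftrightarrow> len (word (words4 ! k)) < len (lact i (word (words4 ! k)))"
    using arg_cong[OF *(2), of "\<lambda>l. l ! k"] len assms length_lists W p
    by (simp add: len_inversions enc_lact)
qed

section \<open>Reduced words of parabolic subgroups and of minimal coset representatives\<close>

definition pwords :: "nat list \<Rightarrow> nat list list" where
  "pwords J = filter (\<lambda>is. list_all (\<lambda>i. i \<in> set J) is) words4"

text \<open>The set of letters of a reduced word depends only on the group element, so one listed
  word decides whether the element lies in W_J. The fact itself is not quoted: closure under left
  multiplication by the generators in J, read from the tables, is enough to exhaust W_J.\<close>

lemma pwords_closed:
  "\<forall>J\<in>set (subseqs [1, 2, 3]). \<forall>i\<in>set J.
    list_all2 (\<lambda>is x. list_all (\<lambda>i. i \<in> set J) is \<longrightarrow> list_all (\<lambda>i. i \<in> set J) (words4 ! snd x)) words4 (ltab i)"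
  by code_simp

lemma word_append: "word (as @ bs) = word as \<circ> word bs"
proof (induction as)
  case Nil
  show ?case by (simp only: append_Nil word_simps wid_def id_comp)
next
  case (Cons a as)
  then show ?case by (simp only: append_Cons word_simps lact_def comp_assoc)
qed

lemma parabolic_subset_word:
  assumes "I \<subseteq> gens"
  shows "w \<in> parabolic I \<Longrightarrow> \<exists>is. set is \<subseteq> I \<and> w = word is"
  unfolding parabolic_def
proof (induction w rule: generate.induct)
  case one
  show ?case
    by (intro exI[of _ "[]"] conjI) (simp, simp only: sym_group_one word_simps wid_def)
next
  case (incl h)
  then obtain i where "i \<in> I" "h = simple i" by auto
  then show ?case
    by (intro exI[of _ "[i]"]) (simp add: word_simps act_id, simp add: sg_def)
next
  case (inv h)
  then obtain i where i: "i \<in> I" "h = simple i" by auto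
  then have "h \<in> W" using assms simple_W[of i] by (auto simp: sg_def)
  then have "inv\<^bsub>sym_group 4\<^esub> h = inv' h" by simp
  also have "\<dots> = h" unfolding i by simp
  finally show ?case using i
    by (intro exI[of _ "[i]"]) (simp add: word_simps act_id, simp add: sg_def)
next
  case (eng a b)
  then obtain as bs where ab: "set as \<subseteq> I" "a = word as" "set bs \<subseteq> I" "b = word bs" by auto
  then show ?case
    by (intro exI[of _ "as @ bs"]) (simp add: sym_group_mult word_append)
qed

lemma word_in_parabolic: "set is \<subseteq> I \<Longrightarrow> word is \<in> parabolic I"
  unfolding parabolic_def
proof (induction "is")
  case Nil
  show ?case
    using generate.one[of "sym_group 4" "simple ` I"] by (simp only: word_simps wid_def sym_group_one)
next
  case (Cons i "is")
  then have "simple i \<otimes>\<^bsub>sym_group 4\<^esub> word is \<in> generate (sym_group 4) (simple ` I)"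
    by (intro generate.eng generate.incl Cons.IH) auto
  then show ?case by (simp only: word_simps lact_def sg_def sym_group_mult)
qed

lemma parabolic_pwords:
  assumes "J \<in> set (subseqs [1, 2, 3])"
  shows "parabolic (set J) = word ` set (pwords J)"
proof
  have J: "set J \<subseteq> gens"
    using assms by (auto simp: gens_set dest: subseqs_powset[THEN equalityD1, THEN subsetD, OF imageI])
  show "parabolic (set J) \<subseteq> word ` set (pwords J)"
  proof
    fix w assume "w \<in> parabolic (set J)"
    then obtain "is" where "is": "set is \<subseteq> set J" "w = word is"
      using parabolic_subset_word[OF J] by blast
    then have "word is \<in> word ` set (pwords J)"
    proof (induction "is" arbitrary: w)
      case Nil
      have "[] \<in> set words4" by (simp add: words4_def)
      then have "[] \<in> set (pwords J)" by (simp add: pwords_def)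
      then show ?case by (rule imageI)
    next
      case (Cons i "is")
      then obtain k where k: "k < 24" "word is = word (words4 ! k)" "words4 ! k \<in> set (pwords J)"
        using length_lists by (auto simp: pwords_def in_set_conv_nth)
      have i: "i \<in> set J" "i \<in> gens" using Cons.prems J by auto
      let ?j = "snd (ltab i ! k)"
      have "list_all (\<lambda>i. i \<in> set J) (words4 ! ?j)"
        using pwords_closed[rule_format, OF assms i(1)] k length_lists
        by (auto simp: list_all2_conv_all_nth pwords_def)
      then have "words4 ! ?j \<in> set (pwords J)"
        using ltab_nth(1)[OF i(2) k(1)] length_lists by (auto simp: pwords_def)
      moreover have "word (i # is) = word (words4 ! ?j)"
        using ltab_nth(2)[OF i(2) k(1)] k(2) by (simp add: word_simps)
      ultimately show ?case by blast
    qed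
    with "is" show "w \<in> word ` set (pwords J)" by simp
  qed
  show "word ` set (pwords J) \<subseteq> parabolic (set J)"
    by (auto simp: pwords_def list_all_iff intro!: word_in_parabolic)
qed

text \<open>The length of the product is computed as a number of inversions, because the
  concatenation \<open>a @ b\<close> need not be reduced.\<close>

definition dwords :: "nat list \<Rightarrow> nat list \<Rightarrow> nat list list" where
  "dwords J I = filter (\<lambda>a. list_all (\<lambda>b. length a \<le> inversions (enc_word (a @ b))) (pwords I)) (pwords J)"

lemma helt_dwords:
  assumes "J \<in> set (subseqs [1, 2, 3])" "I \<in> set (subseqs [1, 2, 3])"
  shows "helt (set J) (set I) = (\<Sum>a\<leftarrow>dwords J I. T (word a))"
proof -
  have len: "len (word a) = length a" "len (word a \<circ> word b) = inversions (enc_word (a @ b))"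
    if "a \<in> set words4" "b \<in> set words4" for a b
    using that words4_reduced[of a] words4_gens[of a] words4_gens[of b]
    by (simp_all add: len_inversions word_W comp_W enc_word flip: word_append)
  have "{w \<in> parabolic (set J). \<forall>v\<in>parabolic (set I). len w \<le> len (w \<circ> v)} = word ` set (dwords J I)"
    unfolding parabolic_pwords[OF assms(1)] parabolic_pwords[OF assms(2)]
    by (auto simp: dwords_def pwords_def list_all_iff len image_iff)
  moreover have "inj_on word (set (dwords J I))"
    using inj_words4 by (rule inj_on_subset) (auto simp: dwords_def pwords_def)
  moreover have "distinct (dwords J I)"
    using distinct_words4 by (simp add: dwords_def pwords_def)
  ultimately show ?thesis
    by (simp add: helt_def sum.reindex sum_list_distinct_conv_sum_set)
qed

lemma xelt_pwords:
  assumes "J \<in> set (subseqs [1, 2, 3])"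
  shows "xelt (set J) = (\<Sum>a\<leftarrow>pwords J. T (word a))"
proof -
  have "inj_on word (set (pwords J))"
    using inj_words4 by (rule inj_on_subset) (auto simp: pwords_def)
  moreover have "distinct (pwords J)"
    using distinct_words4 by (simp add: pwords_def)
  ultimately show ?thesis
    by (simp add: xelt_def parabolic_pwords[OF assms] sum.reindex sum_list_distinct_conv_sum_set)
qed

section \<open>Computing with coefficient lists\<close>

text \<open>
  Polynomials in q are represented by coefficient lists with the constant term first, Hecke algebra
  elements by the lists of their 24 coefficients in the order of \<^const>\<open>words4\<close>.
\<close>

fun padd :: "int list \<Rightarrow> int list \<Rightarrow> int list" where
  "padd [] y = y"
| "padd (a # x) y = (case y of [] \<Rightarrow> a # x | b # z \<Rightarrow> (a + b) # padd x z)"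

lemma Poly_padd: "Poly (padd x y) = Poly x + Poly y"
  by (induction x y rule: padd.induct) (auto split: list.splits)

lemma Poly_uminus: "Poly (map uminus x) = - Poly (x :: int list)"
  by (induction x) auto

lemma Poly_shift: "Poly (0 # x) = q * Poly x"
  by (simp add: monom_altdef)

definition coefs :: "hecke \<Rightarrow> int poly list" where
  "coefs h = map (\<lambda>is. lookup h (word is)) words4"

lemma coefs_eqI:
  assumes "a \<in> HW" "b \<in> HW" "coefs a = coefs b" shows "a = b"
  using assms W_words4 by (intro HW_eqI) (auto simp: coefs_def)

definition hadd :: "int list list \<Rightarrow> int list list \<Rightarrow> int list list" where
  "hadd l l' = map2 padd l l'"

text \<open>This is \<open>lookup_gen_left\<close> with lengths and products taken from the table:
  \<open>0 # p\<close> stands for q p, and \<open>padd (0 # x) (map uminus x)\<close> for (q - 1)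
  x.\<close>

definition hgen :: "nat \<Rightarrow> int list list \<Rightarrow> int list list" where
  "hgen i l = map2 (\<lambda>t x. if fst t then 0 # l ! snd t else padd (l ! snd t) (padd (0 # x) (map uminus x))) (ltab i) l"

primrec hgens :: "nat list \<Rightarrow> int list list \<Rightarrow> int list list" where
  "hgens [] l = l"
| "hgens (i # is) l = hgen i (hgens is l)"

primrec hact :: "nat list list \<Rightarrow> int list list \<Rightarrow> int list list" where
  "hact [] l = replicate 24 []"
| "hact (a # ws) l = hadd (hgens a l) (hact ws l)"

definition hsum :: "nat list list \<Rightarrow> int list list" where
  "hsum ws = map (\<lambda>p. if p \<in> set (map enc_word ws) then [1] else []) perms4"

definition represents :: "int list list \<Rightarrow> hecke \<Rightarrow> bool" where
  "represents l h \<longleftrightarrow> h \<in> HW \<and> map Poly l = coefs h"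

lemma representsD: "represents l h \<Longrightarrow> h \<in> HW" "represents l h \<Longrightarrow> length l = 24"
  "represents l h \<Longrightarrow> k < 24 \<Longrightarrow> lookup h (word (words4 ! k)) = Poly (l ! k)"
proof -
  assume r: "represents l h"
  then have *: "h \<in> HW" "map Poly l = map (\<lambda>is. lookup h (word is)) words4"
    by (auto simp: represents_def coefs_def)
  then show "h \<in> HW" by simp
  show l: "length l = 24"
    using arg_cong[OF *(2), of length] length_lists by simp
  show "lookup h (word (words4 ! k)) = Poly (l ! k)" if "k < 24"
    using arg_cong[OF *(2), of "\<lambda>l. l ! k"] that l length_lists by simp
qed

lemma representsI:
  assumes "h \<in> HW" "length l = 24"
    "\<And>k. k < 24 \<Longrightarrow> lookup h (word (words4 ! k)) = Poly (l ! k)"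
  shows "represents l h"
  unfolding represents_def coefs_def using assms length_lists
  by (auto intro!: nth_equalityI)

lemma represents_add:
  assumes "represents l a" "represents l' b" shows "represents (hadd l l') (a + b)"
  using representsD[OF assms(1)] representsD[OF assms(2)]
  by (intro representsI) (simp_all add: hadd_def lookup_add Poly_padd)

lemma represents_0: "represents (replicate 24 []) 0"
  by (rule representsI) (simp_all)

lemma represents_gen:
  assumes "i \<in> gens" "represents l h" shows "represents (hgen i l) (gen_left i h)"
proof (rule representsI)
  note h = representsD[OF assms(2)]
  have len: "length (ltab i) = 24"
    by (simp add: ltab_def)
  then show "length (hgen i l) = 24"
    using h by (simp add: hgen_def)
  show "gen_left i h \<in> HW" using h assms by simp
  fix k :: nat assume k: "k < 24"
  have W: "word (words4 ! k) \<in> W"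
    using k length_lists by (intro word_W words4_gens) simp
  note t = ltab_nth[OF assms(1) k]
  show "lookup (gen_left i h) (word (words4 ! k)) = Poly (hgen i l ! k)"
    unfolding lookup_gen_left[OF h(1) W assms(1)] t(3)[symmetric]
    unfolding t(2) h(3)[OF t(1)] h(3)[OF k]
    using h(2) len k
    by (simp add: hgen_def Poly_padd Poly_uminus Poly_shift algebra_simps del: padd.simps Poly.simps)
qed

lemma represents_foldr_gen:
  assumes "set a \<subseteq> gens" "represents l h" shows "represents (hgens a l) (foldr gen_left a h)"
  using assms by (induction a) (auto intro: represents_gen)

lemma represents_hact:
  assumes "set ws \<subseteq> set words4" "represents l h"
  shows "represents (hact ws l) (hecke_mult (\<Sum>a\<leftarrow>ws. T (word a)) h)"
  using assms(1)
proof (induction ws)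
  case Nil
  show ?case using represents_0 by simp
next
  case (Cons a ws)
  then have a: "set a \<subseteq> gens" "length a = len (word a)"
    using words4_gens words4_reduced by auto
  have "hecke_mult (T (word a)) h = foldr gen_left a h"
    by (rule hecke_mult_T_word[OF a representsD(1)[OF assms(2)]])
  moreover have "represents (hgens a l) (foldr gen_left a h)"
    by (rule represents_foldr_gen[OF a(1) assms(2)])
  ultimately show ?case
    using Cons represents_add by simp
qed

lemma lookup_sum_list:
  "lookup (\<Sum>a\<leftarrow>ws. F a) x = (\<Sum>a\<leftarrow>ws. lookup (F a) x)"
  by (induction ws) (auto simp: lookup_add)

lemma represents_hsum:
  assumes "set ws \<subseteq> set words4" "distinct ws"
  shows "represents (hsum ws) (\<Sum>a\<leftarrow>ws. T (word a))"
proof (rule representsI)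
  show "(\<Sum>a\<leftarrow>ws. T (word a)) \<in> HW"
    using assms(1) by (induction ws) (auto intro!: HW_simps word_W words4_gens)
  show "length (hsum ws) = 24" using length_lists by (simp add: hsum_def)
  fix k :: nat assume k: "k < 24"
  have inj: "enc_word a = enc_word (words4 ! k) \<longleftrightarrow> word a = word (words4 ! k)"
    "word a = word (words4 ! k) \<longleftrightarrow> a = words4 ! k" if "a \<in> set ws" for a
  proof -
    have "a \<in> set words4" "words4 ! k \<in> set words4"
      using that assms(1) k length_lists by auto
    then show "word a = word (words4 ! k) \<longleftrightarrow> a = words4 ! k"
      using inj_words4 by (auto dest: inj_onD)
    then show "enc_word a = enc_word (words4 ! k) \<longleftrightarrow> word a = word (words4 ! k)"
      using \<open>a \<in> set words4\<close> \<open>words4 ! k \<in> set words4\<close> words4_gens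
      by (metis enc_inj enc_word word_W)
  qed
  have "perms4 ! k = enc_word (words4 ! k)"
    using k length_lists by (simp flip: perms4_words4)
  moreover have "enc_word (words4 ! k) \<in> set (map enc_word ws) \<longleftrightarrow>
      (\<exists>a\<in>set ws. enc_word a = enc_word (words4 ! k))"
    unfolding set_map image_iff by (intro bex_cong refl eq_commute)
  then have "enc_word (words4 ! k) \<in> set (map enc_word ws) \<longleftrightarrow> words4 ! k \<in> set ws"
    by (simp add: inj cong: bex_cong)
  ultimately have "hsum ws ! k = (if words4 ! k \<in> set ws then [1] else [])"
    using k length_lists by (simp add: hsum_def)
  moreover have "lookup (\<Sum>a\<leftarrow>ws. T (word a)) (word (words4 ! k))
      = (\<Sum>a\<leftarrow>ws. if a = words4 ! k then 1 else 0)"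
    unfolding lookup_sum_list
    by (intro arg_cong[of _ _ sum_list] map_cong) (auto simp: lookup_single when_def inj(2))
  ultimately show "lookup (\<Sum>a\<leftarrow>ws. T (word a)) (word (words4 ! k)) = Poly (hsum ws ! k)"
    using assms(2) by (auto simp: sum_list_distinct_conv_sum_set sum.delta one_pCons)
qed

section \<open>The vertices of the Hasse quiver\<close>

text \<open>Names for the eight subsets of S on which equality and inclusion can be decided by
  evaluation; \<open>bits\<close> lists the elements and \<open>vs\<close> leads back to
  sets.\<close>

datatype vertex = V0 | V1 | V2 | V3 | V12 | V13 | V23 | V123

fun bits :: "vertex \<Rightarrow> nat list" where
  "bits V0 = []" | "bits V1 = [1]" | "bits V2 = [2]" | "bits V3 = [3]"
| "bits V12 = [1, 2]" | "bits V13 = [1, 3]" | "bits V23 = [2, 3]" | "bits V123 = [1, 2, 3]"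

definition vertices :: "vertex list" where
  "vertices = [V0, V1, V2, V3, V12, V13, V23, V123]"

definition vs :: "vertex \<Rightarrow> nat set" where
  "vs v = set (bits v)"

definition covers :: "vertex \<Rightarrow> vertex \<Rightarrow> bool" where
  "covers v w \<longleftrightarrow> list_all (\<lambda>i. i \<in> set (bits w)) (bits v) \<and> length (bits w) = Suc (length (bits v))"

lemma in_vertices [simp]: "v \<in> set vertices"
  by (cases v) (simp_all add: vertices_def)

lemma bits_subseqs: "bits v \<in> set (subseqs [1, 2, 3])"
  by (cases v) simp_all

lemma bits_gens: "set (bits v) \<subseteq> gens" "vs v \<subseteq> gens"
  by (cases v; simp add: vs_def gens_set)+

lemma distinct_bits: "distinct (bits v)"
  by (cases v) simp_all

lemma Lambda_vs: "\<Lambda> = vs ` set vertices"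
proof -
  have "set ` set (subseqs [1, 2, 3 :: nat]) = vs ` set vertices"
    by (simp add: vertices_def vs_def) auto
  then show ?thesis
    using subseqs_powset[of "[1, 2, 3 :: nat]"] by simp
qed

lemma vs_Lambda [simp]: "vs v \<in> \<Lambda>"
  unfolding Lambda_vs by simp

lemma Lambda_E: "I \<in> \<Lambda> \<Longrightarrow> (\<And>v. I = vs v \<Longrightarrow> P) \<Longrightarrow> P"
  unfolding Lambda_vs by blast

lemma bits_eq: "\<forall>v\<in>set vertices. \<forall>w\<in>set vertices. (list_all (\<lambda>i. i \<in> set (bits w)) (bits v) \<and>
    list_all (\<lambda>i. i \<in> set (bits v)) (bits w)) = (v = w)"
  by code_simp

lemma vs_eq_iff [simp]: "vs v = vs w \<longleftrightarrow> v = w"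
  using bits_eq[rule_format, of v w] by (auto simp: vs_def list_all_iff)

lemma card_vs: "card (vs v) = length (bits v)"
  using distinct_bits by (simp add: vs_def distinct_card)

lemma hasse_cover_iff: "vs v \<lessdot> vs w \<longleftrightarrow> covers v w"
proof -
  have "finite (vs w)" by (simp add: vs_def)
  then have "card (vs v) < card (vs w)" if "vs v \<subset> vs w"
    using that by (rule psubset_card_mono)
  moreover have "vs v \<subset> vs w" if "vs v \<subseteq> vs w" "card (vs w) = Suc (card (vs v))"
    using that by (intro psubsetI) auto
  \<comment> \<open>Strict inclusion makes the larger cardinality positive, so the truncated
    subtraction in the definition of \<open>\<lessdot>\<close> is a genuine one.\<close>
  ultimately have "vs v \<subset> vs w \<and> card (vs v) = card (vs w) - 1 \<longleftrightarrow>
      vs v \<subseteq> vs w \<and> card (vs w) = Suc (card (vs v))"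
    by (metis diff_Suc_1 Suc_diff_1 less_nat_zero_code not_gr_zero psubset_imp_subset)
  moreover have "vs v \<subseteq> vs w \<longleftrightarrow> list_all (\<lambda>i. i \<in> set (bits w)) (bits v)"
    by (auto simp: vs_def list_all_iff)
  ultimately show ?thesis
    using vs_Lambda[of w] unfolding hasse_cover_def covers_def card_vs by blast
qed

lemma hasse_cover_E:
  assumes "I \<lessdot> J" obtains v w where "I = vs v" "J = vs w" "covers v w"
proof -
  have "J \<in> \<Lambda>" "I \<in> \<Lambda>"
    using assms by (auto simp: hasse_cover_def)
  then show ?thesis
    using that assms hasse_cover_iff by (elim Lambda_E) simp
qed

section \<open>The modules of the direct sum\<close>

text \<open>Coefficient lists are not normalised and may end in zeros; therefore equality of
  polynomials is tested on differences.\<close>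

definition heq :: "int list list \<Rightarrow> int list list \<Rightarrow> bool" where
  "heq l l' \<longleftrightarrow> list_all2 (\<lambda>x y. list_all (\<lambda>a. a = 0) (padd x (map uminus y))) l l'"

lemma Poly_all_0: "list_all (\<lambda>a. a = 0) x \<Longrightarrow> Poly x = 0"
  by (induction x) auto

lemma represents_heq:
  assumes "represents l a" "represents l' b" "heq l l'" shows "a = b"
proof -
  have "Poly x = Poly y" if "list_all (\<lambda>a. a = 0) (padd x (map uminus y))" for x y :: "int list"
    using Poly_all_0[OF that] by (simp add: Poly_padd Poly_uminus)
  with assms(3) have "map Poly l = map Poly l'"
    unfolding heq_def by (induction rule: list_all2_induct) auto
  with assms(1,2) show ?thesis
    by (auto simp: represents_def intro: coefs_eqI)
qed

definition hx :: "vertex \<Rightarrow> int list list" where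
  "hx v = hsum (pwords (bits v))"

definition covering_pairs :: "(vertex \<times> vertex) list" where
  "covering_pairs = concat (map (\<lambda>w. map (\<lambda>v. (w, v)) (filter (\<lambda>v. covers v w) vertices)) vertices)"

text \<open>The coset representatives for the twelve covers, larger subset first, evaluated once so
  that later computations only look them up.\<close>

definition dtable :: "((vertex \<times> vertex) \<times> nat list list) list" where
  "dtable =
   [((V1, V0), [[], [1]]), ((V2, V0), [[], [2]]), ((V3, V0), [[], [3]]),
    ((V12, V1), [[], [2], [1, 2]]), ((V12, V2), [[], [1], [2, 1]]),
    ((V13, V1), [[], [3]]), ((V13, V3), [[], [1]]),
    ((V23, V2), [[], [3], [2, 3]]), ((V23, V3), [[], [2], [3, 2]]),
    ((V123, V12), [[], [3], [2, 3], [1, 2, 3]]),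
    ((V123, V13), [[], [2], [3, 2], [1, 2], [1, 3, 2], [2, 1, 3, 2]]),
    ((V123, V23), [[], [1], [2, 1], [3, 2, 1]])]"

lemma dtable: "map (\<lambda>(w, v). ((w, v), dwords (bits w) (bits v))) covering_pairs = dtable"
  by code_simp

lemma covering_pairs_iff: "(w, v) \<in> set covering_pairs \<longleftrightarrow> covers v w"
  by (auto simp: covering_pairs_def)

definition dws :: "vertex \<Rightarrow> vertex \<Rightarrow> nat list list" where
  "dws w v = the (map_of dtable (w, v))"

lemma dws: "covers v w \<Longrightarrow> dws w v = dwords (bits w) (bits v)"
proof -
  assume "covers v w"
  then have "(w, v) \<in> set covering_pairs"
    by (simp add: covering_pairs_iff)
  moreover have "map_of (map (\<lambda>(w, v). ((w, v), dwords (bits w) (bits v))) l) (w, v)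
      = Some (dwords (bits w) (bits v))" if "(w, v) \<in> set l" for l
    using that by (induction l) auto
  ultimately show ?thesis
    by (simp add: dws_def flip: dtable)
qed

definition hd_act :: "vertex \<Rightarrow> vertex \<Rightarrow> int list list \<Rightarrow> int list list" where
  "hd_act w v l = hact (dws w v) l"

lemma pwords_words4: "set (pwords J) \<subseteq> set words4" "distinct (pwords J)"
  "set (dwords J I) \<subseteq> set words4" "distinct (dwords J I)"
  using distinct_words4 by (auto simp: dwords_def pwords_def)

lemma represents_hx: "represents (hx v) (xelt (vs v))"
  unfolding hx_def vs_def xelt_pwords[OF bits_subseqs]
  by (rule represents_hsum[OF pwords_words4(1,2)])

lemma represents_hd_act:
  assumes "covers v w" "represents l h"
  shows "represents (hd_act w v l) (hecke_mult (helt (vs w) (vs v)) h)"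
  unfolding hd_act_def vs_def helt_dwords[OF bits_subseqs bits_subseqs] dws[OF assms(1)]
  by (rule represents_hact[OF pwords_words4(3) assms(2)])

lemma sum_list_T_HW: "set ws \<subseteq> set words4 \<Longrightarrow> (\<Sum>a\<leftarrow>ws. T (word a)) \<in> HW"
  by (induction ws) (auto intro!: HW_simps word_W words4_gens)

lemma helt_HW [simp]: "helt (vs w) (vs v) \<in> HW"
  unfolding vs_def helt_dwords[OF bits_subseqs bits_subseqs]
  by (rule sum_list_T_HW[OF pwords_words4(3)])

lemma xelt_HW [simp]: "xelt (vs v) \<in> HW"
  using represents_hx representsD(1) by blast

lemma parabolic_act:
  assumes "I \<subseteq> gens" "i \<in> I"
  shows "lact i w \<in> parabolic I \<longleftrightarrow> w \<in> parabolic I" "ract i w \<in> parabolic I \<longleftrightarrow> w \<in> parabolic I"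
proof -
  have *: "lact i w \<in> parabolic I \<and> ract i w \<in> parabolic I" if w: "w \<in> parabolic I" for w
  proof -
    obtain "is" where is1: "set is \<subseteq> I" and is2: "w = word is"
      using parabolic_subset_word[OF assms(1) w] by (elim exE conjE)
    have "word (i # is) \<in> parabolic I" "word (is @ [i]) \<in> parabolic I"
      using is1 assms(2) by (intro word_in_parabolic; simp)+
    then show ?thesis
      unfolding is2 word_snoc by (simp add: word_simps)
  qed
  show "lact i w \<in> parabolic I \<longleftrightarrow> w \<in> parabolic I"
    using *[of w] *[of "lact i w"] by auto
  show "ract i w \<in> parabolic I \<longleftrightarrow> w \<in> parabolic I"
    using *[of w] *[of "ract i w"] by auto
qed

lemma parabolic_W:
  assumes "I \<subseteq> gens" shows "parabolic I \<subseteq> W"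
proof
  fix w assume w: "w \<in> parabolic I"
  obtain "is" where is1: "set is \<subseteq> I" and is2: "w = word is"
    using parabolic_subset_word[OF assms w] by (elim exE conjE)
  show "w \<in> W"
    unfolding is2 using is1 assms by (intro word_W) simp
qed

lemma lookup_xelt:
  assumes "I \<subseteq> gens"
  shows "lookup (xelt I) w = (if w \<in> parabolic I then 1 else 0)"
proof -
  have "finite (parabolic I)"
    by (rule finite_subset[OF parabolic_W[OF assms] finite_W])
  then show ?thesis
    by (simp add: xelt_def lookup_sum lookup_single when_def sum.delta)
qed

lemma xelt_invariant: "xelt (vs v) \<in> left_invariant (vs v)" "xelt (vs v) \<in> right_invariant (vs v)"
  by (rule left_invariantI[OF xelt_HW bits_gens(2)],
      simp add: lookup_xelt[OF bits_gens(2)] parabolic_act[OF bits_gens(2)])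
    (rule right_invariantI[OF xelt_HW bits_gens(2)],
      simp add: lookup_xelt[OF bits_gens(2)] parabolic_act[OF bits_gens(2)])

section \<open>The right ideals x_I H and the maps between them\<close>

lemma xmod_iff: "m \<in> xmod I \<longleftrightarrow> (\<exists>h\<in>HW. m = hecke_mult (xelt I) h)"
  by (auto simp: xmod_def)

lemma xmodI: "h \<in> HW \<Longrightarrow> hecke_mult (xelt I) h \<in> xmod I"
  by (auto simp: xmod_iff)

lemma xmod_closed:
  "0 \<in> xmod (vs v)"
  "a \<in> xmod (vs v) \<Longrightarrow> b \<in> xmod (vs v) \<Longrightarrow> a + b \<in> xmod (vs v)"
  "a \<in> xmod (vs v) \<Longrightarrow> scale c a \<in> xmod (vs v)"
  "a \<in> xmod (vs v) \<Longrightarrow> h \<in> HW \<Longrightarrow> hecke_mult a h \<in> xmod (vs v)"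
  "a \<in> xmod (vs v) \<Longrightarrow> a \<in> HW"
  "xelt (vs v) \<in> xmod (vs v)"
proof -
  show "0 \<in> xmod (vs v)"
    using xmodI[of 0 "vs v"] by (simp add: hecke_mult_right)
  show "a + b \<in> xmod (vs v)" if ab: "a \<in> xmod (vs v)" "b \<in> xmod (vs v)"
  proof -
    obtain h g where "h \<in> HW" "a = hecke_mult (xelt (vs v)) h" "g \<in> HW" "b = hecke_mult (xelt (vs v)) g"
      using ab by (auto simp: xmod_iff)
    then show ?thesis
      using xmodI[of "h + g" "vs v"] by (simp add: hecke_mult_right)
  qed
  show "scale c a \<in> xmod (vs v)" if a: "a \<in> xmod (vs v)"
  proof -
    obtain h where "h \<in> HW" "a = hecke_mult (xelt (vs v)) h"
      using a by (auto simp: xmod_iff)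
    then show ?thesis
      using xmodI[of "scale c h" "vs v"] by (simp add: hecke_mult_right)
  qed
  show "hecke_mult a h \<in> xmod (vs v)" if a: "a \<in> xmod (vs v)" "h \<in> HW"
  proof -
    obtain g where "g \<in> HW" "a = hecke_mult (xelt (vs v)) g"
      using a by (auto simp: xmod_iff)
    then show ?thesis
      using xmodI[of "hecke_mult g h" "vs v"] a(2) by (simp add: hecke_mult_right hecke_mult_assoc)
  qed
  show "a \<in> HW" if a: "a \<in> xmod (vs v)"
    using a by (auto simp: xmod_iff hecke_mult_right)
  show "xelt (vs v) \<in> xmod (vs v)"
    using xmodI[of "T wid" "vs v"] by (simp add: hecke_mult_id_right)
qed

text \<open>T_i x_I = q x_I for i in I, and associativity carries this over to x_I h.\<close>

lemma xmod_left_invariant: "a \<in> xmod (vs v) \<Longrightarrow> a \<in> left_invariant (vs v)"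
proof -
  assume a: "a \<in> xmod (vs v)"
  then obtain h where h: "h \<in> HW" "a = hecke_mult (xelt (vs v)) h"
    by (auto simp: xmod_iff)
  have "gen_left i a = scale q a" if "i \<in> vs v" for i
  proof -
    have i: "i \<in> gens" using that bits_gens by blast
    have "gen_left i a = hecke_mult (T (sg i)) (hecke_mult (xelt (vs v)) h)"
      unfolding h(2) by (rule hecke_mult_simple(1)[symmetric]) (use i h in \<open>simp_all add: hecke_mult_right\<close>)
    also have "\<dots> = hecke_mult (hecke_mult (T (sg i)) (xelt (vs v))) h"
      by (rule hecke_mult_assoc[symmetric]) (use i h in \<open>simp_all add: simple_W\<close>)
    also have "hecke_mult (T (sg i)) (xelt (vs v)) = scale q (xelt (vs v))"
      using i that xelt_invariant(1)[of v] by (simp add: hecke_mult_simple left_invariant_def)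
    finally show ?thesis using h by simp
  qed
  then show ?thesis
    using xmod_closed(5)[OF a] by (simp add: left_invariant_def)
qed

text \<open>
  With y the sum of the T_w over the inverses of the terms of h_JI, x_J = x_I y, so x_J H is contained
  in x_I H.
\<close>

definition inverses :: "nat list list \<Rightarrow> nat list list" where
  "inverses ws = filter (\<lambda>b. enc_word b \<in> set (map enc_word (map rev ws))) words4"

text \<open>Both identities are about well-definedness: the first keeps the values of
  \<open>d_map\<close> inside x_J H, the second those of \<open>u_map\<close> inside x_I H.\<close>

definition covers_ok :: "vertex \<Rightarrow> vertex \<Rightarrow> bool" where
  "covers_ok w v \<longleftrightarrow> heq (hd_act w v (hx v)) (hx w) \<and>
    heq (hact (pwords (bits v)) (hsum (inverses (dws w v)))) (hx w)"

lemma covers_ok: "list_all (\<lambda>(w, v). covers_ok w v) covering_pairs"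
  by code_simp

lemma helt_xelt:
  assumes "covers v w" shows "hecke_mult (helt (vs w) (vs v)) (xelt (vs v)) = xelt (vs w)"
proof -
  have "covers_ok w v"
    using covers_ok assms covering_pairs_iff unfolding list_all_iff by auto
  then show ?thesis
    unfolding covers_ok_def
    using represents_heq[OF represents_hd_act[OF assms represents_hx] represents_hx] by blast
qed

lemma xmod_mono:
  assumes "covers v w" shows "xmod (vs w) \<subseteq> xmod (vs v)"
proof -
  define ys where "ys = inverses (dws w v)"
  have "covers_ok w v"
    using covers_ok assms covering_pairs_iff unfolding list_all_iff by auto
  then have ys: "heq (hact (pwords (bits v)) (hsum ys)) (hx w)" "set ys \<subseteq> set words4" "distinct ys"
    using distinct_words4 by (simp_all add: covers_ok_def ys_def inverses_def)
  let ?y = "\<Sum>a\<leftarrow>ys. T (word a)"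
  have y: "?y \<in> HW" by (rule sum_list_T_HW[OF ys(2)])
  have "represents (hact (pwords (bits v)) (hsum ys)) (hecke_mult (xelt (vs v)) ?y)"
    unfolding vs_def xelt_pwords[OF bits_subseqs]
    by (rule represents_hact[OF pwords_words4(1) represents_hsum[OF ys(2,3)]])
  then have x: "xelt (vs w) = hecke_mult (xelt (vs v)) ?y"
    using represents_heq[OF _ represents_hx ys(1)] by simp
  show ?thesis
  proof
    fix m assume "m \<in> xmod (vs w)"
    then obtain h where h: "h \<in> HW" "m = hecke_mult (xelt (vs w)) h"
      by (auto simp: xmod_iff)
    then have "m = hecke_mult (xelt (vs v)) (hecke_mult ?y h)"
      unfolding x using y by (simp add: hecke_mult_assoc)
    moreover have "hecke_mult ?y h \<in> HW"
      using y h by (simp add: hecke_mult_right)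
    ultimately show "m \<in> xmod (vs v)"
      by (simp add: xmodI)
  qed
qed

lemma xmod_helt:
  assumes "covers v w" "m \<in> xmod (vs v)" shows "hecke_mult (helt (vs w) (vs v)) m \<in> xmod (vs w)"
proof -
  obtain h where h: "h \<in> HW" "m = hecke_mult (xelt (vs v)) h"
    using assms by (auto simp: xmod_iff)
  then have "hecke_mult (helt (vs w) (vs v)) m = hecke_mult (xelt (vs w)) h"
    using hecke_mult_assoc[of "helt (vs w) (vs v)" "xelt (vs v)" h] helt_xelt[OF assms(1)] by simp
  then show ?thesis using h by (simp add: xmodI)
qed

section \<open>The endomorphism algebra is a ring\<close>

lemma Lambda_range: "\<Lambda> = range vs"
proof -
  have "set vertices = UNIV" using in_vertices by blast
  then show ?thesis using Lambda_vs by simp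
qed

lemma Xsum_iff: "m \<in> Xsum \<longleftrightarrow> (\<forall>v. m (vs v) \<in> xmod (vs v)) \<and> (\<forall>I. I \<notin> range vs \<longrightarrow> m I = 0)"
  unfolding Xsum_def Lambda_range by simp

lemma Xsum_closed [simp]:
  "(\<lambda>I. 0) \<in> Xsum"
  "m \<in> Xsum \<Longrightarrow> n \<in> Xsum \<Longrightarrow> (\<lambda>I. m I + n I) \<in> Xsum"
  "m \<in> Xsum \<Longrightarrow> (\<lambda>I. scale c (m I)) \<in> Xsum"
  "m \<in> Xsum \<Longrightarrow> (\<lambda>I. - m I) \<in> Xsum"
  "m \<in> Xsum \<Longrightarrow> h \<in> HW \<Longrightarrow> (\<lambda>I. hecke_mult (m I) h) \<in> Xsum"
  using xmod_closed(3)[where c = "- 1"]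
  unfolding Xsum_iff by (auto simp: xmod_closed)

lemma Xsum_HW: "m \<in> Xsum \<Longrightarrow> m I \<in> HW"
  unfolding Xsum_iff by (cases "I \<in> range vs") (auto intro: xmod_closed(5))

lemma Xsum_xmod: "m \<in> Xsum \<Longrightarrow> m (vs v) \<in> xmod (vs v)"
  unfolding Xsum_iff by simp

lemma Eq_simps:
  "mult Eq f g = compose Xsum f g"
  "\<one>\<^bsub>Eq\<^esub> = (\<lambda>m\<in>Xsum. m)"
  "\<zero>\<^bsub>Eq\<^esub> = (\<lambda>m\<in>Xsum. \<lambda>I. 0)"
  "add Eq f g = (\<lambda>m\<in>Xsum. \<lambda>I. f m I + g m I)"
  "smult Eq c f = (\<lambda>m\<in>Xsum. \<lambda>I. scale c (f m I))"
  by (simp_all add: Eq_def)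

lemma Eq_carrier_iff:
  "f \<in> carrier Eq \<longleftrightarrow> f \<in> Xsum \<rightarrow>\<^sub>E Xsum \<and>
    (\<forall>m\<in>Xsum. \<forall>n\<in>Xsum. f (\<lambda>I. m I + n I) = (\<lambda>I. f m I + f n I)) \<and>
    (\<forall>m\<in>Xsum. \<forall>h\<in>HW. f (\<lambda>I. hecke_mult (m I) h) = (\<lambda>I. hecke_mult (f m I) h))"
  by (simp add: Eq_def)

lemma EqD:
  assumes "f \<in> carrier Eq"
  shows "m \<in> Xsum \<Longrightarrow> f m \<in> Xsum"
    "m \<in> Xsum \<Longrightarrow> n \<in> Xsum \<Longrightarrow> f (\<lambda>I. m I + n I) = (\<lambda>I. f m I + f n I)"
    "m \<in> Xsum \<Longrightarrow> h \<in> HW \<Longrightarrow> f (\<lambda>I. hecke_mult (m I) h) = (\<lambda>I. hecke_mult (f m I) h)"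
    "f \<in> extensional Xsum"
  using assms unfolding Eq_carrier_iff by (auto simp: PiE_iff)

lemma EqI:
  assumes "f \<in> extensional Xsum" "\<And>m. m \<in> Xsum \<Longrightarrow> f m \<in> Xsum"
    "\<And>m n. m \<in> Xsum \<Longrightarrow> n \<in> Xsum \<Longrightarrow> f (\<lambda>I. m I + n I) = (\<lambda>I. f m I + f n I)"
    "\<And>m h. m \<in> Xsum \<Longrightarrow> h \<in> HW \<Longrightarrow> f (\<lambda>I. hecke_mult (m I) h) = (\<lambda>I. hecke_mult (f m I) h)"
  shows "f \<in> carrier Eq"
  using assms unfolding Eq_carrier_iff by (auto simp: PiE_iff)

lemma Eq_eqI:
  assumes "f \<in> carrier Eq" "g \<in> carrier Eq" "\<And>m. m \<in> Xsum \<Longrightarrow> f m = g m"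
  shows "f = g"
  using assms EqD(4) by (intro extensionalityI[of f Xsum g]) auto

text \<open>Endomorphisms are only required to be additive and compatible with the right action of
  H; a scalar c acts as right multiplication by c times the identity.\<close>

lemma Eq_scale:
  assumes "f \<in> carrier Eq" "m \<in> Xsum"
  shows "f (\<lambda>I. scale c (m I)) = (\<lambda>I. scale c (f m I))"
proof -
  have "hecke_mult (n I) (scale c (T wid)) = scale c (n I)" if "n \<in> Xsum" for n I
    using Xsum_HW[OF that, of I] by (simp add: hecke_mult_right hecke_mult_id_right del: scale_single)
  then show ?thesis
    using EqD(3)[OF assms, of "scale c (T wid)"] EqD(1)[OF assms] assms(2) by simp
qed

lemma Eq_closed [simp]:
  "\<zero>\<^bsub>Eq\<^esub> \<in> carrier Eq" "\<one>\<^bsub>Eq\<^esub> \<in> carrier Eq"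
  "f \<in> carrier Eq \<Longrightarrow> g \<in> carrier Eq \<Longrightarrow> f \<oplus>\<^bsub>Eq\<^esub> g \<in> carrier Eq"
  "f \<in> carrier Eq \<Longrightarrow> g \<in> carrier Eq \<Longrightarrow> f \<otimes>\<^bsub>Eq\<^esub> g \<in> carrier Eq"
  "f \<in> carrier Eq \<Longrightarrow> c \<odot>\<^bsub>Eq\<^esub> f \<in> carrier Eq"
proof -
  show "\<zero>\<^bsub>Eq\<^esub> \<in> carrier Eq" "\<one>\<^bsub>Eq\<^esub> \<in> carrier Eq"
    unfolding Eq_simps by (rule EqI; simp)+
  assume f: "f \<in> carrier Eq"
  show "c \<odot>\<^bsub>Eq\<^esub> f \<in> carrier Eq"
    unfolding Eq_simps
    by (rule EqI) (simp_all add: EqD[OF f] scale.scale_right_distrib)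
  assume g: "g \<in> carrier Eq"
  show "f \<oplus>\<^bsub>Eq\<^esub> g \<in> carrier Eq"
    unfolding Eq_simps
    by (rule EqI) (simp_all add: EqD[OF f] EqD[OF g] algebra_simps)
  show "f \<otimes>\<^bsub>Eq\<^esub> g \<in> carrier Eq"
    unfolding Eq_simps
    by (rule EqI) (simp_all add: EqD[OF f] EqD[OF g] compose_def)
qed

lemma Eq_apply [simp]:
  "m \<in> Xsum \<Longrightarrow> (f \<otimes>\<^bsub>Eq\<^esub> g) m = f (g m)"
  "m \<in> Xsum \<Longrightarrow> (f \<oplus>\<^bsub>Eq\<^esub> g) m = (\<lambda>I. f m I + g m I)"
  "m \<in> Xsum \<Longrightarrow> (c \<odot>\<^bsub>Eq\<^esub> f) m = (\<lambda>I. scale c (f m I))"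
  "m \<in> Xsum \<Longrightarrow> \<zero>\<^bsub>Eq\<^esub> m = (\<lambda>I. 0)"
  "m \<in> Xsum \<Longrightarrow> \<one>\<^bsub>Eq\<^esub> m = m"
  by (simp_all add: Eq_simps compose_def)

lemma ring_Eq: "ring Eq"
proof (rule ringI)
  show "abelian_group Eq"
  proof (rule abelian_groupI)
    fix f assume f: "f \<in> carrier Eq"
    have "(- 1) \<odot>\<^bsub>Eq\<^esub> f \<oplus>\<^bsub>Eq\<^esub> f = \<zero>\<^bsub>Eq\<^esub>"
      using f by (intro Eq_eqI) simp_all
    then show "\<exists>g\<in>carrier Eq. g \<oplus>\<^bsub>Eq\<^esub> f = \<zero>\<^bsub>Eq\<^esub>"
      using f by (intro bexI[of _ "(- 1) \<odot>\<^bsub>Eq\<^esub> f"]) simp_all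
  qed (auto intro!: Eq_eqI simp: algebra_simps)
  show "monoid Eq"
    by (rule monoidI) (auto intro!: Eq_eqI simp: EqD)
qed (auto intro!: Eq_eqI simp: EqD)

section \<open>The canonical homomorphism\<close>

primrec amap :: "arrow \<Rightarrow> (nat set \<Rightarrow> hecke) \<Rightarrow> nat set \<Rightarrow> hecke" where
  "amap (Upsilon I J) m = (\<lambda>L. if L = I then m J else 0)"
| "amap (Delta J I) m = (\<lambda>L. if L = J then hecke_mult (helt J I) (m I) else 0)"

text \<open>The initial projection to the starting vertex turns trivial paths into idempotents and
  kills whatever a preceding path delivers at another vertex.\<close>

definition pmap :: "(nat set, arrow) path \<Rightarrow> (nat set \<Rightarrow> hecke) \<Rightarrow> nat set \<Rightarrow> hecke" where
  "pmap p m = foldl (\<lambda>m a. amap a m) (\<lambda>L. if L = fst p then m L else 0) (snd p)"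

text \<open>
  Unlike the elements of \<^const>\<open>Eq\<close>, these maps are not restricted to \<^const>\<open>Xsum\<close>,
  so that additivity in the first argument needs no side condition.
\<close>

definition Phi :: "hasse_elt \<Rightarrow> (nat set \<Rightarrow> hecke) \<Rightarrow> nat set \<Rightarrow> hecke" where
  "Phi x m = (\<lambda>L. lin (\<lambda>p. pmap p m L) x)"

lemma hasse_quiver_simps [simp]:
  "verts hasse_quiver = range vs" "tail hasse_quiver = arrow_start" "head hasse_quiver = arrow_end"
  "arcs hasse_quiver = {Upsilon I J | I J. I \<lessdot> J} \<union> {Delta J I | I J. I \<lessdot> J}"
  by (simp_all add: hasse_quiver_def flip: Lambda_range)

lemma hasse_cover_vs: "I \<lessdot> J \<Longrightarrow> I \<in> range vs \<and> J \<in> range vs"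
  by (auto elim!: hasse_cover_E)

lemma wf_hasse_quiver: "wf_digraph hasse_quiver"
  by unfold_locales (auto dest: hasse_cover_vs)

lemma finite_range_vs: "finite (range vs)"
  unfolding Lambda_range[symmetric] by simp

lemma ring_Qq: "ring Qq"
  unfolding Qq_def by (rule wf_digraph.ring_path_algebra[OF wf_hasse_quiver]) (simp add: finite_range_vs)

abbreviation Qcar :: "hasse_elt set" where
  "Qcar \<equiv> {x. keys x \<subseteq> paths hasse_quiver}"

lemma Qq_simps [simp]:
  "carrier Qq = Qcar" "\<zero>\<^bsub>Qq\<^esub> = 0" "add Qq = (+)" "smult Qq = scale"
  "\<one>\<^bsub>Qq\<^esub> = (\<Sum>v\<in>range vs. single (v, []) 1)"
  "mult Qq = bilin (path_mult hasse_quiver)"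
  by (auto simp: Qq_def fun_eq_iff path_algebra_mult)

lemma amap_linear:
  "amap a (\<lambda>L. 0) = (\<lambda>L. 0)" if "a \<in> arcs hasse_quiver" for a
  using that by (auto simp: fun_eq_iff hecke_mult_right elim!: hasse_cover_E)

lemma amap_add: "a \<in> arcs hasse_quiver \<Longrightarrow> amap a (\<lambda>L. m L + n L) = (\<lambda>L. amap a m L + amap a n L)"
  by (auto simp: fun_eq_iff hecke_mult_right elim!: hasse_cover_E)

lemma amap_scale: "a \<in> arcs hasse_quiver \<Longrightarrow> amap a (\<lambda>L. scale c (m L)) = (\<lambda>L. scale c (amap a m L))"
  by (auto simp: fun_eq_iff hecke_mult_right elim!: hasse_cover_E)

lemma amap_mult:
  "a \<in> arcs hasse_quiver \<Longrightarrow> (\<And>L. m L \<in> HW) \<Longrightarrow> h \<in> HW \<Longrightarrow>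
    amap a (\<lambda>L. hecke_mult (m L) h) = (\<lambda>L. hecke_mult (amap a m L) h)"
  by (auto simp: fun_eq_iff hecke_mult_assoc elim!: hasse_cover_E)

lemma amap_Xsum: "a \<in> arcs hasse_quiver \<Longrightarrow> m \<in> Xsum \<Longrightarrow> amap a m \<in> Xsum"
  using xmod_helt xmod_mono
  by (auto simp: Xsum_iff hasse_cover_iff xmod_closed subset_iff elim!: hasse_cover_E)

lemma proj_Xsum: "m \<in> Xsum \<Longrightarrow> (\<lambda>L. if L = I then m L else 0) \<in> Xsum"
  by (auto simp: Xsum_iff xmod_closed)

lemma pmap_Nil: "pmap (u, []) m = (\<lambda>L. if L = u then m L else 0)"
  by (simp add: pmap_def)

lemma pmap_snoc: "pmap (u, p @ [a]) m = amap a (pmap (u, p) m)"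
  by (simp add: pmap_def)

lemma paths_snoc: "(u, p @ [a]) \<in> paths hasse_quiver \<longleftrightarrow> (u, p) \<in> paths hasse_quiver \<and>
    a \<in> arcs hasse_quiver \<and> arrow_start a = pre_digraph.awlast hasse_quiver u p"
  unfolding paths_append awlast_append
  by (auto simp: pre_digraph.cas.simps pre_digraph.awalk_verts.simps)

lemma path_induct [consumes 1, case_names Nil snoc]:
  assumes "(u, p) \<in> paths hasse_quiver"
    and "u \<in> range vs \<Longrightarrow> P []"
    and "\<And>p a. \<lbrakk>(u, p) \<in> paths hasse_quiver; P p; a \<in> arcs hasse_quiver;
      arrow_start a = pre_digraph.awlast hasse_quiver u p\<rbrakk> \<Longrightarrow> P (p @ [a])"
  shows "P p"
  using assms(1)
proof (induction p rule: rev_induct)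
  case Nil
  then show ?case using assms(2) by (auto simp: paths_def pre_digraph.awalk_def)
next
  case (snoc a p)
  then show ?case using assms(3) unfolding paths_snoc by blast
qed

lemma pmap_linear:
  assumes "(u, p) \<in> paths hasse_quiver"
  shows "pmap (u, p) (\<lambda>L. 0) = (\<lambda>L. 0)"
    "pmap (u, p) (\<lambda>L. m L + n L) = (\<lambda>L. pmap (u, p) m L + pmap (u, p) n L)"
    "pmap (u, p) (\<lambda>L. scale c (m L)) = (\<lambda>L. scale c (pmap (u, p) m L))"
    "m \<in> Xsum \<Longrightarrow> h \<in> HW \<Longrightarrow> pmap (u, p) (\<lambda>L. hecke_mult (m L) h) = (\<lambda>L. hecke_mult (pmap (u, p) m L) h)"
    "m \<in> Xsum \<Longrightarrow> pmap (u, p) m \<in> Xsum"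
    "L \<noteq> pre_digraph.awlast hasse_quiver u p \<Longrightarrow> pmap (u, p) m L = 0"
proof -
  have X: "pmap (u, p) m \<in> Xsum" if "m \<in> Xsum" for m
    using assms
    by (induction rule: path_induct) (simp_all add: pmap_Nil pmap_snoc that proj_Xsum amap_Xsum)
  then show "m \<in> Xsum \<Longrightarrow> pmap (u, p) m \<in> Xsum" .
  show "pmap (u, p) (\<lambda>L. 0) = (\<lambda>L. 0)"
    using assms by (induction rule: path_induct) (simp_all add: pmap_Nil pmap_snoc amap_linear)
  show "pmap (u, p) (\<lambda>L. m L + n L) = (\<lambda>L. pmap (u, p) m L + pmap (u, p) n L)"
    using assms by (induction rule: path_induct) (auto simp: pmap_Nil pmap_snoc amap_add)
  show "pmap (u, p) (\<lambda>L. scale c (m L)) = (\<lambda>L. scale c (pmap (u, p) m L))"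
    using assms by (induction rule: path_induct) (auto simp: pmap_Nil pmap_snoc amap_scale)
  show "pmap (u, p) (\<lambda>L. hecke_mult (m L) h) = (\<lambda>L. hecke_mult (pmap (u, p) m L) h)"
    if mh: "m \<in> Xsum" "h \<in> HW"
    using assms
  proof (induction rule: path_induct)
    case (snoc p a)
    have "pmap (u, p) m \<in> Xsum"
      using snoc(1) by (induction rule: path_induct)
        (simp_all add: pmap_Nil pmap_snoc mh proj_Xsum amap_Xsum)
    with snoc mh show ?case by (simp only: pmap_snoc amap_mult Xsum_HW)
  qed (auto simp: pmap_Nil)
  show "pmap (u, p) m L = 0" if "L \<noteq> pre_digraph.awlast hasse_quiver u p"
  proof (cases p rule: rev_cases)
    case (snoc p' a)
    with that show ?thesis
      by (cases a) (auto simp: pmap_snoc awlast_conv)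
  qed (use that in \<open>simp add: pmap_Nil awlast_conv\<close>)
qed

lemma pmap_append:
  assumes "\<And>L. L \<noteq> pre_digraph.awlast hasse_quiver u p \<Longrightarrow> pmap (u, p) m L = 0"
  shows "pmap (u, p @ p') m = pmap (pre_digraph.awlast hasse_quiver u p, p') (pmap (u, p) m)"
proof (induction p' rule: rev_induct)
  case Nil
  show ?case using assms by (auto simp: pmap_Nil)
next
  case (snoc a p')
  then show ?case by (simp add: pmap_snoc flip: append_assoc)
qed

lemma Phi_simps [simp]:
  "Phi 0 m = (\<lambda>L. 0)" "Phi (x + y) m = (\<lambda>L. Phi x m L + Phi y m L)"
  "Phi (scale c x) m = (\<lambda>L. scale c (Phi x m L))"
  "Phi (- x) m = (\<lambda>L. - Phi x m L)"
  "Phi (x - y) m = (\<lambda>L. Phi x m L - Phi y m L)"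
  "Phi (single p c) m = (\<lambda>L. scale c (pmap p m L))"
  by (simp_all add: Phi_def)

lemma Phi_linear:
  assumes "x \<in> Qcar"
  shows "Phi x (\<lambda>L. 0) = (\<lambda>L. 0)"
    "Phi x (\<lambda>L. m L + n L) = (\<lambda>L. Phi x m L + Phi x n L)"
    "Phi x (\<lambda>L. scale c (m L)) = (\<lambda>L. scale c (Phi x m L))"
    "m \<in> Xsum \<Longrightarrow> h \<in> HW \<Longrightarrow> Phi x (\<lambda>L. hecke_mult (m L) h) = (\<lambda>L. hecke_mult (Phi x m L) h)"
    "m \<in> Xsum \<Longrightarrow> Phi x m \<in> Xsum"
proof -
  have x: "keys x \<subseteq> paths hasse_quiver" using assms by simp
  then show "Phi x (\<lambda>L. 0) = (\<lambda>L. 0)"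
    by (induction rule: poly_mapping_carrier_induct) (auto simp: pmap_linear del: ext simp del: scale_single)
  show "Phi x (\<lambda>L. m L + n L) = (\<lambda>L. Phi x m L + Phi x n L)"
    using x by (induction rule: poly_mapping_carrier_induct)
      (auto simp: pmap_linear scale.scale_right_distrib algebra_simps simp del: scale_single)
  show "Phi x (\<lambda>L. scale c (m L)) = (\<lambda>L. scale c (Phi x m L))"
    using x by (induction rule: poly_mapping_carrier_induct)
      (auto simp: pmap_linear scale.scale_right_distrib mult.commute simp del: scale_single)
  show "Phi x (\<lambda>L. hecke_mult (m L) h) = (\<lambda>L. hecke_mult (Phi x m L) h)" if "m \<in> Xsum" "h \<in> HW"
    using x by (induction rule: poly_mapping_carrier_induct)
      (auto simp: pmap_linear that simp del: scale_single)
  show "Phi x m \<in> Xsum" if "m \<in> Xsum"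
    using x by (induction rule: poly_mapping_carrier_induct)
      (auto simp: pmap_linear that simp del: scale_single)
qed

lemma Phi_mult:
  assumes "x \<in> Qcar" "y \<in> Qcar" shows "Phi (x \<star> y) m = Phi x (Phi y m)"
proof -
  have base: "Phi (path_mult hasse_quiver \<alpha> \<beta>) m = pmap \<alpha> (pmap \<beta> m)"
    if \<alpha>: "\<alpha> \<in> paths hasse_quiver" and \<beta>: "\<beta> \<in> paths hasse_quiver" for \<alpha> \<beta>
  proof -
    obtain u p v p' where eq: "\<beta> = (u, p)" "\<alpha> = (v, p')" by (cases \<alpha>; cases \<beta>) auto
    note zero = pmap_linear(6)[OF \<beta>[unfolded eq]]
    show ?thesis
    proof (cases "v = pre_digraph.awlast hasse_quiver u p")
      case True
      then show ?thesis
        using pmap_append[of u p m p'] zero unfolding eq by (simp add: path_mult_def)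
    next
      case False
      \<comment> \<open>The paths do not meet, so their product is 0. The composite vanishes too:
        \<open>pmap \<alpha>\<close> sees only the component at \<open>v\<close>, and the image of
        \<open>pmap \<beta>\<close> lives at another vertex.\<close>
      have "pmap (v, p') n = (\<lambda>L. 0)" if "n v = 0" for n
      proof -
        have "(\<lambda>L. if L = v then n L else 0) = (\<lambda>L. 0)"
          using that by auto
        then have "pmap (v, p') n = pmap (v, p') (\<lambda>L. 0)"
          by (simp add: pmap_def)
        then show ?thesis using pmap_linear(1)[OF \<alpha>[unfolded eq]] by simp
      qed
      then show ?thesis using False zero[OF False] unfolding eq by (simp add: path_mult_def)
    qed
  qed
  have single: "Phi (single \<alpha> 1 \<star> y) m = pmap \<alpha> (Phi y m)" if \<alpha>: "\<alpha> \<in> paths hasse_quiver" for \<alpha>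
  proof -
    have y: "keys y \<subseteq> paths hasse_quiver" using assms by simp
    then show ?thesis
    proof (induction rule: poly_mapping_carrier_induct)
      case (step \<beta> c g)
      then show ?case
        using base[OF \<alpha> step(1)] \<alpha> pmap_linear(2,3)[of "fst \<alpha>" "snd \<alpha>"]
        by (simp del: scale_single)
    qed (use \<alpha> pmap_linear(1)[of "fst \<alpha>" "snd \<alpha>"] in simp)
  qed
  have "keys x \<subseteq> paths hasse_quiver" using assms by simp
  then show ?thesis
    by (induction rule: poly_mapping_carrier_induct) (use single in \<open>simp_all del: scale_single\<close>)
qed

definition phi0 :: "hasse_elt \<Rightarrow> (nat set \<Rightarrow> hecke) \<Rightarrow> nat set \<Rightarrow> hecke" where
  "phi0 x = (\<lambda>m\<in>Xsum. Phi x m)"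

lemma phi0_carrier: "x \<in> Qcar \<Longrightarrow> phi0 x \<in> carrier Eq"
  unfolding phi0_def by (rule EqI) (simp_all add: Phi_linear del: mem_Collect_eq)

lemma e_Q: "e (vs v) \<in> Qcar"
  by (auto simp: e_def paths_iff pre_digraph.awalk_def pre_digraph.cas.simps awlast_conv)

lemma ud_Q: assumes "I \<lessdot> J" shows "\<upsilon> I J \<in> Qcar" "\<delta> J I \<in> Qcar"
  using assms hasse_cover_vs[OF assms]
  by (auto simp: \<upsilon>_def \<delta>_def paths_def pre_digraph.awalk_def pre_digraph.cas.simps)

lemma Phi_generators:
  "Phi (e K) m = (\<lambda>L. if L = K then m K else 0)"
  "Phi (\<upsilon> I J) m = (\<lambda>L. if L = I then m J else 0)"
  "Phi (\<delta> J I) m = (\<lambda>L. if L = J then hecke_mult (helt J I) (m I) else 0)"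
  by (auto simp: e_def \<upsilon>_def \<delta>_def pmap_def)

lemma Phi_one: "m \<in> Xsum \<Longrightarrow> Phi \<one>\<^bsub>Qq\<^esub> m = m"
proof -
  assume m: "m \<in> Xsum"
  have "Phi (\<Sum>v\<in>A. single (v, []) 1) m = (\<lambda>L. if L \<in> A then m L else 0)" if "finite A" for A
    using that by (induction rule: finite_induct) (auto simp: pmap_Nil)
  from this[OF finite_range_vs] m show ?thesis
    by (auto simp: Xsum_iff)
qed

lemma phi0_generators:
  "phi0 (e K) = id_map K" "phi0 (\<upsilon> I J) = u_map I J" "phi0 (\<delta> J I) = d_map J I"
  unfolding phi0_def id_map_def u_map_def d_map_def Phi_generators Hecke_simps by (rule refl)+

lemma phi0_canonical: "phi0 \<in> canonical_homs"
proof -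
  have "phi0 \<in> ring_hom Qq Eq"
  proof (rule ring_hom_memI)
    show "phi0 \<one>\<^bsub>Qq\<^esub> = \<one>\<^bsub>Eq\<^esub>"
      unfolding phi0_def Eq_simps by (rule restrict_ext) (rule Phi_one)
  next
    fix x y assume xy: "x \<in> carrier Qq" "y \<in> carrier Qq"
    show "phi0 (x \<star> y) = phi0 x \<otimes>\<^bsub>Eq\<^esub> phi0 y"
    proof (rule Eq_eqI)
      show "phi0 (x \<star> y) \<in> carrier Eq"
        using xy ring.ring_simprules(5)[OF ring_Qq xy] by (simp add: phi0_carrier)
      show "phi0 x \<otimes>\<^bsub>Eq\<^esub> phi0 y \<in> carrier Eq"
        using xy by (simp add: phi0_carrier)
      fix m assume m: "m \<in> Xsum"
      have "Phi y m \<in> Xsum" using xy m by (simp add: Phi_linear)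
      moreover have "Phi (x \<star> y) m = Phi x (Phi y m)"
        using xy by (intro Phi_mult) simp_all
      ultimately show "phi0 (x \<star> y) m = (phi0 x \<otimes>\<^bsub>Eq\<^esub> phi0 y) m"
        using m by (simp add: phi0_def)
    qed
    show "phi0 (x \<oplus>\<^bsub>Qq\<^esub> y) = phi0 x \<oplus>\<^bsub>Eq\<^esub> phi0 y"
      by (simp add: phi0_def Eq_simps cong: restrict_cong)
  qed (simp add: phi0_carrier)
  moreover have "phi0 (c \<cdot> x) = c \<odot>\<^bsub>Eq\<^esub> phi0 x" for c x
    by (simp add: phi0_def Eq_simps cong: restrict_cong)
  ultimately show ?thesis
    by (auto simp: canonical_homs_def algebra_hom_def phi0_generators)
qed

text \<open>Trivial paths and arrows generate the path algebra. Equality is asserted on the carrier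
  only, since off the carrier a member of \<open>canonical_homs\<close> may take any values.\<close>

lemma canonical_unique:
  assumes "\<phi> \<in> canonical_homs" "x \<in> Qcar"
  shows "\<phi> x = phi0 x"
proof -
  have hom: "\<psi> \<in> ring_hom Qq Eq" "\<And>c x. x \<in> Qcar \<Longrightarrow> \<psi> (scale c x) = c \<odot>\<^bsub>Eq\<^esub> \<psi> x"
    "\<And>v. \<psi> (e (vs v)) = id_map (vs v)"
    "\<And>I J. I \<lessdot> J \<Longrightarrow> \<psi> (\<upsilon> I J) = u_map I J \<and> \<psi> (\<delta> J I) = d_map J I"
    if "\<psi> \<in> canonical_homs" for \<psi>
    using that vs_Lambda by (auto simp: canonical_homs_def algebra_hom_def)
  note h = hom[OF assms(1)] and h0 = hom[OF phi0_canonical]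
  have path: "\<phi> (single (u, p) 1) = phi0 (single (u, p) 1)"
    if "(u, p) \<in> paths hasse_quiver" for u p
    using that
  proof (induction rule: path_induct)
    case Nil
    then obtain v where "u = vs v" by blast
    then show ?case using h(3)[of v] h0(3)[of v] by (simp add: e_def)
  next
    case (snoc p a)
    let ?s = "single (u, p) 1 :: hasse_elt"
    let ?a = "single (arrow_start a, [a]) 1 :: hasse_elt"
    have "?a \<in> Qcar \<and> \<phi> ?a = phi0 ?a"
    proof -
      obtain I J where IJ: "I \<lessdot> J" "a = Upsilon I J \<or> a = Delta J I"
        using snoc(2) by auto
      then have "?a = \<upsilon> I J \<or> ?a = \<delta> J I"
        by (auto simp: \<upsilon>_def \<delta>_def)
      then show ?thesis
      proof (elim disjE)
        assume eq: "?a = \<upsilon> I J"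
        show ?thesis unfolding eq
          using ud_Q[OF IJ(1)] h(4)[OF IJ(1)] h0(4)[OF IJ(1)] by (simp del: mem_Collect_eq)
      next
        assume eq: "?a = \<delta> J I"
        show ?thesis unfolding eq
          using ud_Q[OF IJ(1)] h(4)[OF IJ(1)] h0(4)[OF IJ(1)] by (simp del: mem_Collect_eq)
      qed
    qed
    note a = conjunct1[OF this] conjunct2[OF this]
    have s: "?s \<in> Qcar" using snoc(1) by simp
    have "single (u, p @ [a]) 1 = ?a \<star> ?s"
      using snoc(3) by (simp add: path_mult_def)
    then show ?case
      using ring_hom_mult[OF h(1), of ?a ?s] ring_hom_mult[OF h0(1), of ?a ?s] a s snoc(4)
      by (simp only: Qq_simps(1))
  qed
  have x: "keys x \<subseteq> paths hasse_quiver" using assms(2) by simp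
  then show ?thesis
  proof (induction rule: poly_mapping_carrier_induct)
    case zero
    have "\<phi> 0 = 0 \<odot>\<^bsub>Eq\<^esub> \<phi> 0" "phi0 0 = 0 \<odot>\<^bsub>Eq\<^esub> phi0 0"
      using h(2)[of 0 0] h0(2)[of 0 0] by simp_all
    then show ?case by (simp add: Eq_simps cong: restrict_cong)
  next
    case (step p c g)
    let ?s = "single p 1 :: hasse_elt"
    have s: "?s \<in> Qcar" "scale c ?s \<in> Qcar" "g \<in> Qcar"
      using step by auto
    have "\<phi> ?s = phi0 ?s" using path step(1) by (cases p) auto
    then show ?case
      using ring_hom_add[OF h(1), of "scale c ?s" g] ring_hom_add[OF h0(1), of "scale c ?s" g]
        h(2)[OF s(1)] h0(2)[OF s(1)] s step(3)
      by (simp only: Qq_simps)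
  qed
qed

section \<open>Words\<close>

text \<open>Between two vertices there is at most one arrow in each direction, so its end and start
  determine it, and with it whether it is an inclusion or a multiplication. Non-adjacent pairs get
  the value 0.\<close>

definition ar :: "vertex \<Rightarrow> vertex \<Rightarrow> hasse_elt" where
  "ar v w = (if covers v w then \<upsilon> (vs v) (vs w) else if covers w v then \<delta> (vs v) (vs w) else 0)"

text \<open>As in products, a word lists the vertices of a path from its end to its start.\<close>

fun wd :: "vertex list \<Rightarrow> hasse_elt" where
  "wd [] = 0"
| "wd [v] = e (vs v)"
| "wd (v # w # ws) = ar v w \<star> wd (w # ws)"

lemma covers_asym: "covers v w \<Longrightarrow> \<not> covers w v"
  by (auto simp: covers_def)

lemma Qassoc: "(x \<star> y) \<star> z = x \<star> (y \<star> z)"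
  unfolding Qq_simps by (rule bilin_assoc) (rule path_mult_assoc)

lemma Q_closed:
  "0 \<in> Qcar" "x \<in> Qcar \<Longrightarrow> y \<in> Qcar \<Longrightarrow> x + y \<in> Qcar" "x \<in> Qcar \<Longrightarrow> y \<in> Qcar \<Longrightarrow> x - y \<in> Qcar"
  "x \<in> Qcar \<Longrightarrow> scale c x \<in> Qcar" "x \<in> Qcar \<Longrightarrow> y \<in> Qcar \<Longrightarrow> x \<star> y \<in> Qcar" "x \<in> Qcar \<Longrightarrow> - x \<in> Qcar"
  using keys_add[of x y] keys_diff[of x y] keys_scale_subset[of c x]
    ring.ring_simprules(5)[OF ring_Qq, of x y]
  by auto

lemma ar_Q: "ar v w \<in> Qcar"
  unfolding ar_def using ud_Q Q_closed(1) by (simp add: hasse_cover_iff del: mem_Collect_eq)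

lemma wd_Q: "wd ws \<in> Qcar"
  by (induction ws rule: wd.induct) (simp_all add: e_Q Q_closed ar_Q del: mem_Collect_eq Qq_simps)

lemma e_ar: "e (vs v) \<star> ar v w = ar v w"
  by (auto simp: ar_def e_def \<upsilon>_def \<delta>_def path_mult_def awlast_conv)

lemma e_wd: "e (vs v) \<star> wd (v # ws) = wd (v # ws)"
proof (cases ws)
  case Nil
  then show ?thesis by (simp add: e_def path_mult_def awlast_conv)
next
  case (Cons w ws')
  show ?thesis unfolding Cons wd.simps Qassoc[symmetric] e_ar ..
qed

text \<open>Words are multiplied by gluing at a shared vertex, which therefore occurs in both
  factors but once in the result.\<close>

lemma wd_append: "wd (xs @ v # ys) = wd (xs @ [v]) \<star> wd (v # ys)"
proof (induction xs)
  case Nil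
  show ?case by (simp only: append_Nil wd.simps(2) e_wd)
next
  case (Cons x xs)
  then show ?case
    by (cases xs) (simp_all add: Qassoc del: Qq_simps)
qed

lemma wd_join:
  assumes "xs \<noteq> []" "ys \<noteq> []" "last xs = hd ys"
  shows "wd xs \<star> wd ys = wd (xs @ tl ys)"
proof -
  obtain xs' v where xs: "xs = xs' @ [v]"
    using assms(1) by (cases xs rule: rev_cases) auto
  obtain ys' where ys: "ys = v # ys'"
    using assms(2,3) xs by (cases ys) auto
  have "xs @ tl ys = xs' @ v # ys'" unfolding xs ys by simp
  then show ?thesis unfolding xs ys using wd_append[of xs' v ys'] by (simp only: list.sel append_assoc append.simps)
qed

fun valid :: "vertex list \<Rightarrow> bool" where
  "valid [] = False"
| "valid [v] = True"
| "valid (v # w # ws) = ((covers v w \<or> covers w v) \<and> valid (w # ws))"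

lemma path_wd:
  assumes "(u, p) \<in> paths hasse_quiver"
  shows "\<exists>ws. valid ws \<and> single (u, p) 1 = wd ws \<and>
    vs (hd ws) = pre_digraph.awlast hasse_quiver u p"
  using assms
proof (induction rule: path_induct)
  case Nil
  then obtain v where "u = vs v" by blast
  then show ?case by (intro exI[of _ "[v]"]) (simp add: e_def awlast_conv)
next
  case (snoc p a)
  then obtain ws where ws: "valid ws" "single (u, p) 1 = wd ws"
    "vs (hd ws) = pre_digraph.awlast hasse_quiver u p" by auto
  then obtain w ws' where w: "ws = w # ws'" by (cases ws) auto
  obtain I J where IJ: "I \<lessdot> J" "a = Upsilon I J \<or> a = Delta J I"
    using snoc(2) by auto
  obtain x y where xy: "I = vs x" "J = vs y" "covers x y"
    using IJ(1) by (rule hasse_cover_E)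
  have start: "arrow_start a = vs w"
    using snoc(3) ws(3) w by simp
  have "\<exists>v. vs v = arrow_end a \<and> ar v w = single (arrow_start a, [a]) 1 \<and>
      (covers v w \<or> covers w v)"
    using IJ(2)
  proof
    assume a: "a = Upsilon I J"
    then have "w = y" using start xy(2) by simp
    then show ?thesis using a xy by (intro exI[of _ x]) (simp add: ar_def \<upsilon>_def)
  next
    assume a: "a = Delta J I"
    then have "w = x" using start xy(1) by simp
    then show ?thesis using a xy covers_asym[OF xy(3)]
      by (intro exI[of _ y]) (simp add: ar_def \<delta>_def)
  qed
  then obtain v where v: "vs v = arrow_end a" "ar v w = single (arrow_start a, [a]) 1"
    "covers v w \<or> covers w v" by auto
  have "single (u, p @ [a]) 1 = ar v w \<star> wd ws"
    unfolding v(2) ws(2)[symmetric] using snoc(3) by (simp add: path_mult_def)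
  then show ?case
    using ws(1) v w by (intro exI[of _ "v # ws"]) (simp add: awlast_conv)
qed

section \<open>Combinations of words and their values on the generators x_I\<close>

type_synonym comb = "(vertex list \<times> int list) list"

definition sem :: "comb \<Rightarrow> hasse_elt" where
  "sem p = (\<Sum>(w, c)\<leftarrow>p. scale (Poly c) (wd w))"

lemma sem_simps [simp]: "sem [] = 0" "sem ((w, c) # p) = scale (Poly c) (wd w) + sem p"
  "sem (p @ p') = sem p + sem p'"
  by (simp_all add: sem_def)

lemma sem_Q: "sem p \<in> Qcar"
proof (induction p)
  case Nil
  show ?case unfolding sem_simps by (rule Q_closed)
next
  case (Cons a p)
  obtain w c where "a = (w, c)" by (cases a)
  then show ?case unfolding sem_simps \<open>a = (w, c)\<close> by (intro Q_closed wd_Q Cons.IH)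
qed

definition slot :: "vertex \<Rightarrow> hecke \<Rightarrow> nat set \<Rightarrow> hecke" where
  "slot v h = (\<lambda>L. if L = vs v then h else 0)"

text \<open>The image of x_I under a word whose last entry is I. A step down to a smaller subset is
  an inclusion and leaves the element as it is; a step up multiplies it by the corresponding
  h.\<close>

fun evw :: "vertex list \<Rightarrow> hecke" where
  "evw [] = 0"
| "evw [v] = xelt (vs v)"
| "evw (v # w # ws) = (if covers v w then evw (w # ws)
     else if covers w v then hecke_mult (helt (vs v) (vs w)) (evw (w # ws)) else 0)"

lemma Phi_ar: "Phi (ar v w) (slot u h) = (if u \<noteq> w then (\<lambda>L. 0) else if covers v w then slot v h
     else if covers w v then slot v (hecke_mult (helt (vs v) (vs w)) h) else (\<lambda>L. 0))"
  by (auto simp: ar_def Phi_generators slot_def fun_eq_iff hecke_mult_right)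

lemma slot_0: "slot v 0 = (\<lambda>L. 0)"
  by (auto simp: slot_def)

lemma Phi_wd: "ws \<noteq> [] \<Longrightarrow> Phi (wd ws) (slot u (xelt (vs u))) =
    (if u = last ws then slot (hd ws) (evw ws) else (\<lambda>L. 0))"
proof (induction ws rule: wd.induct)
  case (2 v)
  show ?case by (auto simp: Phi_generators slot_def)
next
  case (3 v w ws)
  have "Phi (wd (v # w # ws)) (slot u (xelt (vs u))) = Phi (ar v w) (Phi (wd (w # ws)) (slot u (xelt (vs u))))"
    unfolding wd.simps by (rule Phi_mult[OF ar_Q wd_Q])
  also have "\<dots> = (if u = last (w # ws) then Phi (ar v w) (slot w (evw (w # ws))) else Phi (ar v w) (\<lambda>L. 0))"
    using 3 by simp
  also have "Phi (ar v w) (\<lambda>L. 0) = (\<lambda>L. 0)"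
    by (rule Phi_linear(1)[OF ar_Q])
  finally show ?case by (simp add: Phi_ar slot_0)
qed simp

section \<open>Rewriting modulo an ideal\<close>

definition eqv :: "hasse_elt set \<Rightarrow> hasse_elt \<Rightarrow> hasse_elt \<Rightarrow> bool" where
  "eqv I x y \<longleftrightarrow> x \<in> Qcar \<and> y \<in> Qcar \<and> x - y \<in> I"

lemma ideal_simps:
  assumes "ideal I Qq"
  shows "0 \<in> I" "a \<in> I \<Longrightarrow> b \<in> I \<Longrightarrow> a + b \<in> I" "a \<in> I \<Longrightarrow> scale c a \<in> I" "a \<in> I \<Longrightarrow> a \<in> Qcar"
    "a \<in> I \<Longrightarrow> x \<in> Qcar \<Longrightarrow> x \<star> a \<in> I" "a \<in> I \<Longrightarrow> x \<in> Qcar \<Longrightarrow> a \<star> x \<in> I"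
proof -
  interpret ideal I Qq by fact
  show "0 \<in> I"
    using additive_subgroup.zero_closed[OF ideal.axioms(1)[OF assms]] by (simp only: Qq_simps)
  show "a \<in> I \<Longrightarrow> b \<in> I \<Longrightarrow> a + b \<in> I"
    using additive_subgroup.a_closed[OF ideal.axioms(1)[OF assms]] by (simp only: Qq_simps)
  show Q: "a \<in> I \<Longrightarrow> a \<in> Qcar" using a_Hcarr by (simp only: Qq_simps)
  show l: "a \<in> I \<Longrightarrow> x \<in> Qcar \<Longrightarrow> x \<star> a \<in> I" for x using I_l_closed by (simp only: Qq_simps)
  show "a \<in> I \<Longrightarrow> x \<in> Qcar \<Longrightarrow> a \<star> x \<in> I" using I_r_closed by (simp only: Qq_simps)
  \<comment> \<open>Closure under scalars is not part of being an ideal of a ring; it holds here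
    because c acts as multiplication by c times the unit.\<close>
  assume a: "a \<in> I"
  have "\<one>\<^bsub>Qq\<^esub> \<in> Qcar" using one_closed by (simp only: Qq_simps)
  then have "scale c \<one>\<^bsub>Qq\<^esub> \<in> Qcar" by (rule Q_closed)
  moreover have "scale c \<one>\<^bsub>Qq\<^esub> \<star> a = scale c (\<one>\<^bsub>Qq\<^esub> \<star> a)"
    by (simp only: Qq_simps bilin_simps)
  moreover have "\<one>\<^bsub>Qq\<^esub> \<star> a = a"
    using l_one[of a] Q[OF a] by (simp only: Qq_simps)
  ultimately show "scale c a \<in> I" using l[OF a] by metis
qed

lemma eqvD: "eqv I x y \<Longrightarrow> x \<in> Qcar" "eqv I x y \<Longrightarrow> y \<in> Qcar"
  unfolding eqv_def by blast+

context
  fixes I :: "hasse_elt set"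
  assumes I: "ideal I Qq"
begin

lemma eqv_refl: "x \<in> Qcar \<Longrightarrow> eqv I x x"
  unfolding eqv_def using ideal_simps(1)[OF I] by simp

lemma eqv_sym: "eqv I x y \<Longrightarrow> eqv I y x"
  unfolding eqv_def using ideal_simps(3)[OF I, of "x - y" "- 1"] by simp

lemma eqv_add: "eqv I x y \<Longrightarrow> eqv I x' y' \<Longrightarrow> eqv I (x + x') (y + y')"
  unfolding eqv_def using ideal_simps(2)[OF I, of "x - y" "x' - y'"]
  by (auto simp: algebra_simps Q_closed simp del: mem_Collect_eq)

lemma eqv_trans: "eqv I x y \<Longrightarrow> eqv I y z \<Longrightarrow> eqv I x z"
  unfolding eqv_def using ideal_simps(2)[OF I, of "x - y" "y - z"] by simp

lemma eqv_scale: "eqv I x y \<Longrightarrow> eqv I (scale c x) (scale c y)"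
  unfolding eqv_def using ideal_simps(3)[OF I, of "x - y" c]
  by (auto simp: scale.scale_right_diff_distrib Q_closed simp del: mem_Collect_eq)

lemma eqv_mult_left: assumes "eqv I x y" "z \<in> Qcar" shows "eqv I (z \<star> x) (z \<star> y)"
proof -
  have "z \<star> (x - y) \<in> I"
    using assms ideal_simps(5)[OF I] unfolding eqv_def by blast
  then have "z \<star> x - z \<star> y \<in> I" by (simp only: Qq_simps bilin_simps)
  then show ?thesis
    unfolding eqv_def using Q_closed(5)[OF assms(2) eqvD(1)[OF assms(1)]]
      Q_closed(5)[OF assms(2) eqvD(2)[OF assms(1)]] by blast
qed

lemma eqv_mult_right: assumes "eqv I x y" "z \<in> Qcar" shows "eqv I (x \<star> z) (y \<star> z)"
proof -
  have "(x - y) \<star> z \<in> I"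
    using assms ideal_simps(6)[OF I] unfolding eqv_def by blast
  then have "x \<star> z - y \<star> z \<in> I" by (simp only: Qq_simps bilin_simps)
  then show ?thesis
    unfolding eqv_def using Q_closed(5)[OF eqvD(1)[OF assms(1)] assms(2)]
      Q_closed(5)[OF eqvD(2)[OF assms(1)] assms(2)] by blast
qed

end

type_synonym rule = "vertex list \<times> comb"

fun strip :: "'a list \<Rightarrow> 'a list \<Rightarrow> 'a list option" where
  "strip [] ys = Some ys"
| "strip (x # xs) [] = None"
| "strip (x # xs) (y # ys) = (if x = y then strip xs ys else None)"

fun extend_comb :: "vertex list \<Rightarrow> comb \<Rightarrow> comb" where
  "extend_comb z [] = []"
| "extend_comb z ((u, c) # p) = (u @ z, c) # extend_comb z p"

fun prefix_comb :: "vertex list \<Rightarrow> comb \<Rightarrow> comb" where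
  "prefix_comb z [] = []"
| "prefix_comb z ((u, c) # p) = (z @ u, c) # prefix_comb z p"

fun top_rewrite :: "rule list \<Rightarrow> vertex list \<Rightarrow> comb option" where
  "top_rewrite [] w = None"
| "top_rewrite ((l, r) # rs) w = (case strip l w of Some z \<Rightarrow> Some (extend_comb z r) | None \<Rightarrow> top_rewrite rs w)"

fun rewrite :: "rule list \<Rightarrow> vertex list \<Rightarrow> comb option" where
  "rewrite rs [] = None"
| "rewrite rs (v # w) = (case top_rewrite rs (v # w) of Some p \<Rightarrow> Some p
     | None \<Rightarrow> (case rewrite rs w of Some p \<Rightarrow> Some (prefix_comb [v] p) | None \<Rightarrow> None))"

fun pmul :: "int list \<Rightarrow> int list \<Rightarrow> int list" where
  "pmul [] y = []"
| "pmul (a # x) y = padd (map ((*) a) y) (0 # pmul x y)"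

fun scale_comb :: "int list \<Rightarrow> comb \<Rightarrow> comb" where
  "scale_comb a [] = []"
| "scale_comb a ((u, c) # p) = (u, pmul a c) # scale_comb a p"

fun add_term :: "vertex list \<Rightarrow> int list \<Rightarrow> comb \<Rightarrow> comb" where
  "add_term w c [] = [(w, c)]"
| "add_term w c ((u, d) # p) = (if w = u then (u, padd c d) # p else (u, d) # add_term w c p)"

fun nf :: "nat \<Rightarrow> rule list \<Rightarrow> comb \<Rightarrow> comb \<Rightarrow> comb" where
  "nf 0 rs p acc = p @ acc"
| "nf (Suc n) rs [] acc = acc"
| "nf (Suc n) rs ((w, c) # p) acc = (case rewrite rs w of None \<Rightarrow> nf n rs p (add_term w c acc)
     | Some s \<Rightarrow> nf n rs (scale_comb c s @ p) acc)"

fun zero_comb :: "comb \<Rightarrow> bool" where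
  "zero_comb [] = True"
| "zero_comb ((w, c) # p) = (list_all (\<lambda>a. a = 0) c \<and> zero_comb p)"

text \<open>
  The numbers 400 are only fuel: \<^term>\<open>nf\<close> is sound for any number of steps. The overlap \<open>ov\<close> is
  reduced once at its beginning and once at position \<open>n\<close>; the difference of the results is plus or
  minus the new rule.
\<close>

definition step_ok :: "rule list \<Rightarrow> vertex list \<Rightarrow> nat \<Rightarrow> rule \<Rightarrow> bool" where
  "step_ok rs ov n lr =
    (case top_rewrite rs ov of None \<Rightarrow> False | Some p \<Rightarrow>
      (case top_rewrite rs (drop n ov) of None \<Rightarrow> False | Some p' \<Rightarrow>
        zero_comb (nf 400 [] (nf 400 rs (p @ scale_comb [- 1] (prefix_comb (take n ov) p')) []
            @ (fst lr, [- 1]) # snd lr) []) \<or>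
        zero_comb (nf 400 [] (nf 400 rs (p @ scale_comb [- 1] (prefix_comb (take n ov) p')) []
            @ (fst lr, [1]) # scale_comb [- 1] (snd lr)) [])))"

section \<open>Soundness of rewriting modulo an ideal\<close>

lemma strip_Some: "strip l w = Some z \<Longrightarrow> w = l @ z"
  by (induction l w rule: strip.induct) (auto split: if_splits)

lemma Poly_map_mult: "Poly (map ((*) a) y) = Polynomial.smult a (Poly (y :: int list))"
  by (induction y) auto

lemma Poly_pmul: "Poly (pmul x y) = Poly x * Poly y"
  by (induction x) (simp_all add: Poly_padd Poly_map_mult mult_pCons_left del: padd.simps)

lemma sem_scale_comb: "sem (scale_comb a p) = scale (Poly a) (sem p)"
  by (induction a p rule: scale_comb.induct)
    (simp_all add: Poly_pmul scale.scale_right_distrib)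

lemma sem_add_term: "sem (add_term w c p) = scale (Poly c) (wd w) + sem p"
  by (induction w c p rule: add_term.induct)
    (simp_all add: Poly_padd scale.scale_left_distrib add.assoc add.left_commute)

lemma sem_zero_comb: "zero_comb p \<Longrightarrow> sem p = 0"
  by (induction p rule: zero_comb.induct) (simp_all add: Poly_all_0)

text \<open>All words of a replacement must join the same two vertices as the word replaced: only
  then can they be put in its place inside a longer word by multiplying from both sides.\<close>

definition good :: "vertex list \<Rightarrow> comb \<Rightarrow> bool" where
  "good w p \<longleftrightarrow> (\<forall>(u, c)\<in>set p. u \<noteq> [] \<and> hd u = hd w \<and> last u = last w)"

definition ok_rule :: "hasse_elt set \<Rightarrow> rule \<Rightarrow> bool" where
  "ok_rule I lr \<longleftrightarrow> fst lr \<noteq> [] \<and> good (fst lr) (snd lr) \<and> eqv I (wd (fst lr)) (sem (snd lr))"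

lemma wd_extend: "u \<noteq> [] \<Longrightarrow> wd (u @ z) = wd u \<star> wd (last u # z)"
  using wd_join[of u "last u # z"] by simp

lemma wd_Cons: "u \<noteq> [] \<Longrightarrow> wd (v # u) = ar v (hd u) \<star> wd u"
  by (cases u) auto

lemma sem_extend: "good w p \<Longrightarrow> sem (extend_comb z p) = sem p \<star> wd (last w # z)"
proof (induction z p rule: extend_comb.induct)
  case (2 z u c p)
  then have "u \<noteq> []" "last u = last w" "good w p" by (auto simp: good_def)
  then show ?case using 2 by (simp add: wd_extend)
qed simp

lemma sem_prefix1: "good w p \<Longrightarrow> sem (prefix_comb [v] p) = ar v (hd w) \<star> sem p"
proof (induction "[v]" p rule: prefix_comb.induct)
  case (2 u c p)
  then have "u \<noteq> []" "hd u = hd w" "good w p" by (auto simp: good_def)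
  then show ?case using 2 by (simp add: wd_Cons)
qed simp

lemma good_extend: "good w p \<Longrightarrow> w \<noteq> [] \<Longrightarrow> good (w @ z) (extend_comb z p)"
  by (induction z p rule: extend_comb.induct) (auto simp: good_def last_append)

lemma good_prefix: "good w p \<Longrightarrow> w \<noteq> [] \<Longrightarrow> good (z @ w) (prefix_comb z p)"
  by (induction z p rule: prefix_comb.induct) (auto simp: good_def hd_append)

lemma prefix_comb_Cons: "prefix_comb (v # z) p = prefix_comb [v] (prefix_comb z p)"
  by (induction z p rule: prefix_comb.induct) auto

lemma prefix_comb_Nil: "prefix_comb [] p = p"
  by (induction "[] :: vertex list" p rule: prefix_comb.induct) auto

context
  fixes I :: "hasse_elt set" and rs :: "rule list"
  assumes I: "ideal I Qq" and rs: "\<forall>x\<in>set rs. ok_rule I x"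
begin

lemma top_rewrite_sound:
  assumes "top_rewrite rs w = Some p" shows "w \<noteq> [] \<and> good w p \<and> eqv I (wd w) (sem p)"
  using rs assms
proof (induction rs w rule: top_rewrite.induct)
  case (2 l r rs w)
  show ?case
  proof (cases "strip l w")
    case None
    then show ?thesis using 2 by simp
  next
    case (Some z)
    then have w: "w = l @ z" "p = extend_comb z r" using 2 strip_Some by auto
    have l: "l \<noteq> []" "good l r" "eqv I (wd l) (sem r)" using 2 by (auto simp: ok_rule_def)
    have "eqv I (wd l \<star> wd (last l # z)) (sem r \<star> wd (last l # z))"
      by (rule eqv_mult_right[OF I l(3) wd_Q])
    then show ?thesis
      unfolding w using l good_extend by (simp add: wd_extend sem_extend del: Qq_simps)
  qed
qed simp

lemma eqv_prefix:
  assumes "w \<noteq> []" "good w p" "eqv I (wd w) (sem p)"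
  shows "eqv I (wd (z @ w)) (sem (prefix_comb z p))"
proof (induction z)
  case Nil
  then show ?case using assms by (simp add: prefix_comb_Nil)
next
  case (Cons v z)
  have "eqv I (ar v (hd (z @ w)) \<star> wd (z @ w)) (ar v (hd (z @ w)) \<star> sem (prefix_comb z p))"
    by (rule eqv_mult_left[OF I Cons ar_Q])
  then show ?case
    unfolding prefix_comb_Cons[of v z] sem_prefix1[OF good_prefix[OF assms(2,1)]]
    using assms(1) by (simp add: wd_Cons del: Qq_simps)
qed

lemma rewrite_sound:
  "rewrite rs w = Some p \<Longrightarrow> w \<noteq> [] \<and> good w p \<and> eqv I (wd w) (sem p)"
proof (induction w arbitrary: p)
  case (Cons v w)
  show ?case
  proof (cases "top_rewrite rs (v # w)")
    case None
    then obtain s where s: "rewrite rs w = Some s" "p = prefix_comb [v] s"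
      using Cons.prems by (auto split: option.splits)
    then have "w \<noteq> []" "good w s" "eqv I (wd w) (sem s)" using Cons.IH by auto
    then show ?thesis
      using eqv_prefix[of w s "[v]"] good_prefix[of w s "[v]"] s by simp
  next
    case (Some s)
    then show ?thesis using Cons.prems top_rewrite_sound by simp
  qed
qed simp

lemma nf_sound: "eqv I (sem p + sem acc) (sem (nf n rs p acc))"
proof (induction n arbitrary: p acc)
  case 0
  show ?case using eqv_refl[OF I Q_closed(2)[OF sem_Q sem_Q]] by simp
next
  case (Suc n)
  show ?case
  proof (cases p)
    case Nil
    then show ?thesis using eqv_refl[OF I sem_Q] by simp
  next
    case (Cons x p')
    obtain w c where x: "x = (w, c)" by (cases x)
    show ?thesis
    proof (cases "rewrite rs w")
      case None
      then show ?thesis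
        using Suc[of p' "add_term w c acc"] Cons x by (simp add: sem_add_term algebra_simps)
    next
      case (Some s)
      have "eqv I (scale (Poly c) (wd w)) (scale (Poly c) (sem s))"
        using rewrite_sound[OF Some] by (intro eqv_scale[OF I]) simp
      moreover have "eqv I (sem p' + sem acc) (sem p' + sem acc)"
        by (rule eqv_refl[OF I Q_closed(2)[OF sem_Q sem_Q]])
      ultimately have "eqv I (scale (Poly c) (wd w) + (sem p' + sem acc))
          (scale (Poly c) (sem s) + (sem p' + sem acc))"
        by (rule eqv_add[OF I])
      then show ?thesis
        using eqv_trans[OF I _ Suc[of "scale_comb c s @ p'" acc]] Some Cons x
        by (simp add: sem_scale_comb add.assoc)
    qed
  qed
qed

end

section \<open>A complete rewriting system for the relations\<close>

text \<open>The coefficients are those of the quotients of Poincare polynomials, constant term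
  first. For instance \<open>[1, 1, 2, 1, 1]\<close> is (1 + q^2)(1 + q + q^2), the quotient for S
  over {1,3}.\<close>

definition quasi_rules :: "rule list" where
  "quasi_rules =
   [([V1, V0, V1], [([V1], [1, 1])]),
    ([V2, V0, V2], [([V2], [1, 1])]),
    ([V3, V0, V3], [([V3], [1, 1])]),
    ([V12, V1, V12], [([V12], [1, 1, 1])]),
    ([V13, V1, V13], [([V13], [1, 1])]),
    ([V12, V2, V12], [([V12], [1, 1, 1])]),
    ([V23, V2, V23], [([V23], [1, 1, 1])]),
    ([V13, V3, V13], [([V13], [1, 1])]),
    ([V23, V3, V23], [([V23], [1, 1, 1])]),
    ([V123, V12, V123], [([V123], [1, 1, 1, 1])]),
    ([V123, V13, V123], [([V123], [1, 1, 2, 1, 1])]),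
    ([V123, V23, V123], [([V123], [1, 1, 1, 1])])]"

text \<open>Each square is oriented towards the middle vertex of smaller weight, in the order 2, 1,
  3 for singletons and 12, 13, 23 for pairs.\<close>

definition sandwich_rules :: "rule list" where
  "sandwich_rules =
   [([V0, V2, V12], [([V0, V1, V12], [1])]),
    ([V12, V2, V0], [([V12, V1, V0], [1])]),
    ([V0, V1, V13], [([V0, V3, V13], [1])]),
    ([V13, V1, V0], [([V13, V3, V0], [1])]),
    ([V0, V2, V23], [([V0, V3, V23], [1])]),
    ([V23, V2, V0], [([V23, V3, V0], [1])]),
    ([V1, V12, V123], [([V1, V13, V123], [1])]),
    ([V123, V12, V1], [([V123, V13, V1], [1])]),
    ([V2, V12, V123], [([V2, V23, V123], [1])]),
    ([V123, V12, V2], [([V123, V23, V2], [1])]),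
    ([V3, V13, V123], [([V3, V23, V123], [1])]),
    ([V123, V13, V3], [([V123, V23, V3], [1])])]"

text \<open>The left-hand sides of (T1) to (T4) are replaced by the right-hand sides;
  \<open>[0, 1]\<close> is q and \<open>[0, 1, 1]\<close> is q(q + 1). In (T2) both sides have three
  vertices, and the weights decide for \<open>V13\<close> over \<open>V0\<close>.\<close>

definition torsion_rules :: "rule list" where
  "torsion_rules =
   [([V1, V0, V2, V0, V1], [([V1, V12, V1], [1]), ([V1], [0, 1])]),
    ([V2, V0, V1, V0, V2], [([V2, V12, V2], [1]), ([V2], [0, 1])]),
    ([V2, V0, V3, V0, V2], [([V2, V23, V2], [1]), ([V2], [0, 1])]),
    ([V3, V0, V2, V0, V3], [([V3, V23, V3], [1]), ([V3], [0, 1])]),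
    ([V1, V0, V3], [([V1, V13, V3], [1])]),
    ([V12, V1, V13, V1, V12], [([V12, V123, V12], [1]), ([V12], [0, 1, 1])]),
    ([V12, V2, V23, V3, V13], [([V12, V123, V13], [1]), ([V12, V1, V13], [0, 1])]),
    ([V13, V3, V23, V2, V12], [([V13, V123, V12], [1]), ([V13, V1, V12], [0, 1])]),
    ([V3, V0, V1], [([V3, V13, V1], [1])]),
    ([V23, V3, V13, V3, V23], [([V23, V123, V23], [1]), ([V23], [0, 1, 1])]),
    ([V23, V2, V12, V1, V13], [([V23, V123, V13], [1]), ([V23, V3, V13], [0, 1])]),
    ([V13, V1, V12, V2, V23], [([V13, V123, V23], [1]), ([V13, V3, V23], [0, 1])])]"

text \<open>
  The steps of the completion: an overlap of two left-hand sides, the position of the second one, and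
  the rule that resolves the ambiguity.
\<close>

definition overlaps :: "(vertex list \<times> nat \<times> rule) list" where
  "overlaps =
   [([V13, V3, V13, V123], 1, [V13, V3, V23, V123], [([V13, V123], [1, 1])]),
    ([V123, V13, V3, V13], 1, [V123, V23, V3, V13], [([V123, V13], [1, 1])]),
    ([V12, V1, V12, V123], 1, [V12, V1, V13, V123], [([V12, V123], [1, 1, 1])]),
    ([V123, V12, V1, V12], 1, [V123, V13, V1, V12], [([V123, V12], [1, 1, 1])]),
    ([V12, V2, V12, V123], 1, [V12, V2, V23, V123], [([V12, V123], [1, 1, 1])]),
    ([V123, V12, V2, V12], 1, [V123, V23, V2, V12], [([V123, V12], [1, 1, 1])]),
    ([V2, V0, V2, V23], 1, [V2, V0, V3, V23], [([V2, V23], [1, 1])]),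
    ([V23, V2, V0, V2], 1, [V23, V3, V0, V2], [([V23, V2], [1, 1])]),
    ([V2, V0, V2, V12], 1, [V2, V0, V1, V12], [([V2, V12], [1, 1])]),
    ([V12, V2, V0, V2], 1, [V12, V1, V0, V2], [([V12, V2], [1, 1])]),
    ([V12, V2, V0, V3, V23], 1, [V12, V1, V13, V3, V23], [([V12, V2, V23], [1, 1])]),
    ([V23, V3, V0, V2, V12], 2, [V23, V3, V13, V1, V12], [([V23, V2, V12], [1, 1])]),
    ([V1, V0, V2, V0, V1, V13], 3, [V1, V0, V2, V0, V3, V13], [([V1, V12, V1, V13], [1]), ([V1, V13], [0, 1])]),
    ([V2, V0, V1, V0, V2, V23], 3, [V2, V0, V3, V13, V3, V23], [([V2, V12, V2, V23], [1]), ([V2, V23], [0, 1])]),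
    ([V13, V1, V0, V2, V0, V1], 1, [V13, V3, V0, V2, V0, V1], [([V13, V1, V12, V1], [1]), ([V13, V1], [0, 1])]),
    ([V23, V2, V0, V1, V0, V2], 1, [V23, V3, V13, V3, V0, V2], [([V23, V2, V12, V2], [1]), ([V23, V2], [0, 1])]),
    ([V2, V0, V3, V0, V2, V12], 3, [V2, V0, V3, V13, V1, V12], [([V2, V23, V2, V12], [1]), ([V2, V12], [0, 1])]),
    ([V12, V2, V0, V3, V0, V2], 1, [V12, V1, V13, V3, V0, V2], [([V12, V2, V23, V2], [1]), ([V12, V2], [0, 1])]),
    ([V23, V2, V0, V3, V13, V3, V23], 1, [V23, V2, V12, V2, V23], [([V23, V123, V23], [1, 1]), ([V23], [0, 0, 1])]),
    ([V13, V1, V0, V2, V0, V3, V13], 1, [V13, V1, V12, V1, V13], [([V13, V3, V23, V3, V13], [1])]),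
    ([V12, V1, V13, V3, V0, V2, V12], 4, [V12, V2, V23, V2, V12], [([V12, V123, V12], [1, 1]), ([V12], [0, 0, 1])])]"

definition base_rules :: "rule list" where
  "base_rules = quasi_rules @ sandwich_rules @ torsion_rules"

fun add_overlaps :: "rule list \<Rightarrow> (vertex list \<times> nat \<times> rule) list \<Rightarrow> rule list" where
  "add_overlaps rs [] = rs"
| "add_overlaps rs ((ov, n, lr) # ds) = add_overlaps (lr # rs) ds"

definition rules :: "rule list" where
  "rules = add_overlaps base_rules overlaps"

text \<open>Any weights whose total is decreased by every rule would do.\<close>

primrec weight1 :: "vertex \<Rightarrow> nat" where
  "weight1 V0 = 14" | "weight1 V1 = 16" | "weight1 V2 = 17" | "weight1 V3 = 13"
| "weight1 V12 = 15" | "weight1 V13 = 12" | "weight1 V23 = 11" | "weight1 V123 = 10"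

definition weight :: "vertex list \<Rightarrow> nat" where
  "weight w = sum_list (map weight1 w)"

definition reduces_to :: "vertex list \<Rightarrow> vertex list \<Rightarrow> bool" where
  "reduces_to w u \<longleftrightarrow> valid u \<and> hd u = hd w \<and> last u = last w \<and> weight u < weight w"

fun all_reduce :: "vertex list \<Rightarrow> comb \<Rightarrow> bool" where
  "all_reduce w [] = True"
| "all_reduce w ((u, c) # p) = (reduces_to w u \<and> all_reduce w p)"

fun decreasing :: "rule list \<Rightarrow> bool" where
  "decreasing [] = True"
| "decreasing ((l, r) # rs) = (valid l \<and> all_reduce l r \<and> decreasing rs)"

lemma decreasing_rules: "decreasing rules"
  by code_simp

fun overlaps_ok :: "rule list \<Rightarrow> (vertex list \<times> nat \<times> rule) list \<Rightarrow> bool" where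
  "overlaps_ok rs [] = True"
| "overlaps_ok rs ((ov, n, lr) # ds) = (step_ok rs ov n lr \<and> overlaps_ok (lr # rs) ds)"

lemma overlaps_ok: "overlaps_ok base_rules overlaps"
  by code_simp

lemma all_reduce_iff: "all_reduce w p \<longleftrightarrow> (\<forall>(u, c)\<in>set p. reduces_to w u)"
  by (induction w p rule: all_reduce.induct) auto

lemma decreasing_iff: "decreasing rs \<longleftrightarrow> (\<forall>(l, r)\<in>set rs. valid l \<and> all_reduce l r)"
  by (induction rs rule: decreasing.induct) auto

lemma scale_const [simp]:
  fixes x :: "'b \<Rightarrow>\<^sub>0 int poly"
  shows "scale [:- 1:] x = - x" "scale [:1:] x = x"
proof -
  have a: "[:- 1:] = (- 1 :: int poly)" and b: "[:1:] = (1 :: int poly)"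
    by (simp_all add: one_pCons)
  show "scale [:- 1:] x = - x" unfolding a by simp
  show "scale [:1:] x = x" unfolding b by simp
qed

lemma valid_ne: "valid w \<Longrightarrow> w \<noteq> []"
  by auto

lemma all_reduce_good: "all_reduce w p \<Longrightarrow> good w p"
  by (auto simp: all_reduce_iff good_def reduces_to_def dest: valid_ne)

lemma set_add_overlaps: "set (add_overlaps rs ds) = set rs \<union> (\<lambda>(ov, n, lr). lr) ` set ds"
  by (induction rs ds rule: add_overlaps.induct) auto

context
  fixes I :: "hasse_elt set"
  assumes I: "ideal I Qq"
begin

lemma eqv_0: "eqv I x 0 \<longleftrightarrow> x \<in> I"
  unfolding eqv_def using ideal_simps(4)[OF I] Q_closed(1) by auto

lemma step_ok_sound:
  assumes rs: "\<forall>x\<in>set rs. ok_rule I x" and ok: "step_ok rs ov n lr" and lr: "fst lr \<noteq> []" "good (fst lr) (snd lr)"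
  shows "ok_rule I lr"
proof -
  obtain p p' where p: "top_rewrite rs ov = Some p" "top_rewrite rs (drop n ov) = Some p'"
    using ok unfolding step_ok_def by (auto split: option.splits)
  define d where "d = nf 400 rs (p @ scale_comb [- 1] (prefix_comb (take n ov) p')) []"
  have z: "zero_comb (nf 400 [] (d @ (fst lr, [- 1]) # snd lr) []) \<or>
      zero_comb (nf 400 [] (d @ (fst lr, [1]) # scale_comb [- 1] (snd lr)) [])"
    using ok p unfolding step_ok_def d_def by simp
  have p1: "eqv I (wd ov) (sem p)"
    using top_rewrite_sound[OF I rs p(1)] by simp
  have p2: "eqv I (wd ov) (sem (prefix_comb (take n ov) p'))"
    using top_rewrite_sound[OF I rs p(2)] eqv_prefix[OF I rs, of "drop n ov" p' "take n ov"] by simp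
  have "eqv I (sem p) (sem (prefix_comb (take n ov) p'))"
    by (rule eqv_trans[OF I eqv_sym[OF I p1] p2])
  then have "sem p - sem (prefix_comb (take n ov) p') \<in> I"
    unfolding eqv_def by simp
  then have "sem (p @ scale_comb [- 1] (prefix_comb (take n ov) p')) \<in> I"
    by (simp add: sem_scale_comb)
  then have "eqv I (sem (p @ scale_comb [- 1] (prefix_comb (take n ov) p'))) 0"
    unfolding eqv_0 .
  then have "eqv I (sem d) 0"
    using eqv_trans[OF I eqv_sym[OF I nf_sound[OF I rs, of "p @ scale_comb [- 1] (prefix_comb (take n ov) p')" "[]" 400]]]
    unfolding d_def by simp
  then have d: "sem d \<in> I" unfolding eqv_0 .
  \<comment> \<open>Without rules \<open>nf\<close> merely collects equal words, so this is a test
    that the combination is formally zero.\<close>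
  have zero: "sem x \<in> I" if "zero_comb (nf 400 [] x [])" for x
  proof -
    have "eqv I (sem x) (sem (nf 400 [] x []))"
      using nf_sound[OF I, of "[]" x "[]" 400] by simp
    then show ?thesis
      unfolding sem_zero_comb[OF that] eqv_0 .
  qed
  have diff: "a - b \<in> I" if "a \<in> I" "b \<in> I" for a b
    using ideal_simps(2)[OF I that(1) ideal_simps(3)[OF I that(2), of "- 1"]] by simp
  have "wd (fst lr) - sem (snd lr) \<in> I"
    using z
  proof
    assume "zero_comb (nf 400 [] (d @ (fst lr, [- 1]) # snd lr) [])"
    from diff[OF d zero[OF this]] show ?thesis by (simp)
  next
    assume "zero_comb (nf 400 [] (d @ (fst lr, [1]) # scale_comb [- 1] (snd lr)) [])"
    from diff[OF zero[OF this] d] show ?thesis by (simp add: sem_scale_comb)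
  qed
  then show ?thesis
    unfolding ok_rule_def eqv_def using lr wd_Q sem_Q by blast
qed

text \<open>A new rule may be justified by the ones added before it, so the list of rules grows
  along the induction.\<close>

lemma overlaps_ok_sound:
  assumes "\<forall>x\<in>set rs. ok_rule I x" "overlaps_ok rs ds" "decreasing (add_overlaps rs ds)"
  shows "\<forall>x\<in>set (add_overlaps rs ds). ok_rule I x"
  using assms
proof (induction rs ds rule: overlaps_ok.induct)
  case (2 rs ov n lr ds)
  have "lr \<in> set (add_overlaps (lr # rs) ds)" by (simp add: set_add_overlaps)
  moreover have dec: "decreasing (add_overlaps (lr # rs) ds)" using 2(4) by simp
  ultimately have lr: "valid (fst lr)" "all_reduce (fst lr) (snd lr)"
    unfolding decreasing_iff by auto
  have ok: "step_ok rs ov n lr" "overlaps_ok (lr # rs) ds" using 2(3) by simp_all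
  have "ok_rule I lr"
    by (rule step_ok_sound[OF 2(2) ok(1) valid_ne[OF lr(1)] all_reduce_good[OF lr(2)]])
  with 2(2) have "\<forall>x\<in>set (lr # rs). ok_rule I x" by simp
  from 2(1)[OF this ok(2) dec] show ?case by simp
qed simp

lemma rules_sound:
  assumes "\<forall>x\<in>set base_rules. ok_rule I x"
  shows "\<forall>x\<in>set rules. ok_rule I x"
  unfolding rules_def
  by (rule overlaps_ok_sound[OF assms overlaps_ok decreasing_rules[unfolded rules_def]])

end

section \<open>Reduction of every element to irreducible words\<close>

lemma valid_append: "valid (a @ v # z) \<longleftrightarrow> valid (a @ [v]) \<and> valid (v # z)"
proof (induction a)
  case (Cons x a)
  then show ?case by (cases a) auto
qed simp

lemma valid_extend: "u \<noteq> [] \<Longrightarrow> valid (u @ z) \<longleftrightarrow> valid u \<and> valid (last u # z)"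
  using valid_append[of "butlast u" "last u" z] append_butlast_last_id[of u]
  by (metis append.assoc append_Cons append_Nil)

text \<open>Weights are additive, and a factor with the same end vertices fits into the same
  surroundings, so a decrease inside a word is a decrease of the whole word.\<close>

lemma reduces_to_context:
  assumes "valid (x @ w @ z)" "w \<noteq> []" "reduces_to w u"
  shows "reduces_to (x @ w @ z) (x @ u @ z)"
proof -
  have u: "u \<noteq> []" "valid u" "hd u = hd w" "last u = last w" "weight u < weight w"
    using assms(3) valid_ne by (auto simp: reduces_to_def)
  have "valid (w @ z)" "x = [] \<or> valid (x @ [hd w])"
    using assms(1,2) valid_append[of x "hd w" "tl w @ z"] by (cases w; auto)+
  then have "valid (u @ z)"
    using assms(2) u by (simp add: valid_extend)
  moreover obtain h t where ht: "u = h # t" using u(1) by (cases u) auto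
  ultimately have "valid (h # t @ z)" by simp
  then have "valid (x @ h # t @ z)"
    using \<open>x = [] \<or> valid (x @ [hd w])\<close> u(3) ht valid_append[of x h "t @ z"] by auto
  then have "valid (x @ u @ z)" using ht by simp
  then show ?thesis
    using u assms(2) by (auto simp: reduces_to_def weight_def hd_append last_append)
qed

lemma all_reduce_top_rewrite:
  assumes "decreasing rs" "valid w" "top_rewrite rs w = Some p" shows "all_reduce w p"
  using assms
proof (induction rs w rule: top_rewrite.induct)
  case (2 l r rs w)
  show ?case
  proof (cases "strip l w")
    case None
    then show ?thesis using 2 by simp
  next
    case (Some z)
    then have w: "w = l @ z" "p = extend_comb z r" using 2 strip_Some by auto
    have "valid l" "all_reduce l r" using 2 by auto
    moreover have "all_reduce (l @ z) (extend_comb z r)" if "all_reduce l r"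
      using that reduces_to_context[of "[]" l z] \<open>valid w\<close> w(1) valid_ne[OF \<open>valid l\<close>]
      by (induction z r rule: extend_comb.induct) auto
    ultimately show ?thesis unfolding w by simp
  qed
qed simp

lemma all_reduce_rewrite:
  assumes "decreasing rs" shows "valid w \<Longrightarrow> rewrite rs w = Some p \<Longrightarrow> all_reduce w p"
proof (induction w arbitrary: p)
  case (Cons v w)
  show ?case
  proof (cases "top_rewrite rs (v # w)")
    case None
    then obtain s where s: "rewrite rs w = Some s" "p = prefix_comb [v] s"
      using Cons.prems by (auto split: option.splits)
    then have w: "w \<noteq> []" by auto
    then have "valid w" using Cons.prems(1) by (cases w) auto
    then have "all_reduce w s" using Cons.IH s(1) by simp
    then have "all_reduce (v # w) (prefix_comb [v] s)"
      using reduces_to_context[of "[v]" w "[]"] Cons.prems(1) w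
      by (induction "[v]" s rule: prefix_comb.induct) auto
    then show ?thesis using s by simp
  next
    case (Some s)
    then show ?thesis using Cons.prems all_reduce_top_rewrite[OF assms] by simp
  qed
qed simp

definition normal :: "vertex list \<Rightarrow> bool" where
  "normal w \<longleftrightarrow> valid w \<and> rewrite rules w = None"

text \<open>The combination is an element of the free module on words instead of a list, so that
  each word has one coefficient; this is the form in which independence is applied.\<close>

definition has_nf :: "hasse_elt set \<Rightarrow> hasse_elt \<Rightarrow> bool" where
  "has_nf I x \<longleftrightarrow>
    (\<exists>y :: vertex list \<Rightarrow>\<^sub>0 int poly. keys y \<subseteq> {u. normal u} \<and> eqv I x (lin wd y))"

context
  fixes I :: "hasse_elt set"
  assumes I: "ideal I Qq"
begin

lemma has_nf_0: "has_nf I 0"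
  unfolding has_nf_def using eqv_refl[OF I Q_closed(1)] by (intro exI[of _ 0]) simp

lemma has_nf_scale_add:
  assumes "has_nf I x" "has_nf I z" shows "has_nf I (scale c x + z)"
proof -
  obtain y where y: "keys y \<subseteq> {u. normal u}" "eqv I x (lin wd y)"
    using assms(1) unfolding has_nf_def by (elim exE conjE)
  obtain y' where y': "keys y' \<subseteq> {u. normal u}" "eqv I z (lin wd y')"
    using assms(2) unfolding has_nf_def by (elim exE conjE)
  have e: "eqv I (scale c x + z) (lin wd (scale c y + y'))"
    using eqv_add[OF I eqv_scale[OF I y(2)] y'(2)] by (simp only: lin_add lin_scale)
  have k: "keys (scale c y + y') \<subseteq> {u. normal u}"
    using y(1) y'(1) keys_add[of "scale c y" y'] keys_scale_subset[of c y] by blast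
  show ?thesis
    unfolding has_nf_def by (rule exI[of _ "scale c y + y'"]) (rule conjI[OF k e])
qed

lemma has_nf_eqv: "eqv I x z \<Longrightarrow> has_nf I z \<Longrightarrow> has_nf I x"
  unfolding has_nf_def using eqv_trans[OF I] by blast

text \<open>One rewriting step leaves only words of smaller weight, and the elements having a normal
  form are closed under linear combinations.\<close>

lemma has_nf_wd:
  assumes base: "\<forall>x\<in>set base_rules. ok_rule I x"
  shows "valid w \<Longrightarrow> has_nf I (wd w)"
proof (induction "weight w" arbitrary: w rule: less_induct)
  case less
  show ?case
  proof (cases "rewrite rules w")
    case None
    then show ?thesis
      using less.prems eqv_refl[OF I wd_Q] unfolding has_nf_def
      by (intro exI[of _ "single w 1"]) (simp add: normal_def)
  next
    case (Some p)
    have "all_reduce w p" by (rule all_reduce_rewrite[OF decreasing_rules less.prems Some])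
    then have n: "has_nf I (sem p)"
    proof (induction p)
      case Nil
      then show ?case using has_nf_0 by simp
    next
      case (Cons x p)
      obtain u c where x: "x = (u, c)" by (cases x)
      then have u: "valid u" "weight u < weight w" using Cons.prems by (auto simp: reduces_to_def)
      show ?case
        unfolding x sem_simps using Cons x by (intro has_nf_scale_add less.hyps[OF u(2,1)]) simp
    qed
    have e: "eqv I (wd w) (sem p)"
      using rewrite_sound[OF I rules_sound[OF I base] Some] by simp
    show ?thesis by (rule has_nf_eqv[OF e n])
  qed
qed

lemma has_nf_all:
  assumes base: "\<forall>x\<in>set base_rules. ok_rule I x" and x: "x \<in> Qcar"
  shows "has_nf I x"
proof -
  have "keys x \<subseteq> paths hasse_quiver" using x by simp
  then show ?thesis
  proof (induction rule: poly_mapping_carrier_induct)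
    case zero
    show ?case by (rule has_nf_0)
  next
    case (step p c g)
    obtain ws where ws: "valid ws" "single p 1 = wd ws"
      using path_wd[of "fst p" "snd p"] step(1) by auto
    show ?case
      unfolding ws(2) by (rule has_nf_scale_add[OF has_nf_wd[OF base ws(1)] step(3)])
  qed
qed

end

section \<open>The relations as words\<close>

fun lenpoly :: "nat list list \<Rightarrow> int list" where
  "lenpoly [] = []"
| "lenpoly (a # ws) = padd (replicate (length a) 0 @ [1]) (lenpoly ws)"

lemma Poly_lenpoly: "Poly (lenpoly ws) = (\<Sum>a\<leftarrow>ws. q ^ length a)"
proof (induction ws)
  case (Cons a ws)
  have "Poly (replicate n 0 @ [1]) = q ^ n" for n
    by (induction n) (simp_all add: monom_altdef one_pCons mult_pCons_left)
  with Cons show ?case by (simp add: Poly_padd del: padd.simps)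
qed simp

lemma poincare_lenpoly: "poincare (vs v) = Poly (lenpoly (pwords (bits v)))"
proof -
  have inj: "inj_on word (set (pwords (bits v)))"
    using inj_words4 by (rule inj_on_subset) (rule pwords_words4)
  have "poincare (vs v) = (\<Sum>a\<in>set (pwords (bits v)). q ^ len (word a))"
    unfolding poincare_def vs_def parabolic_pwords[OF bits_subseqs] sum.reindex[OF inj] by simp
  also have "\<dots> = (\<Sum>a\<in>set (pwords (bits v)). q ^ length a)"
    using words4_reduced pwords_words4(1) by (intro sum.cong refl) (metis subsetD)
  finally show ?thesis
    unfolding Poly_lenpoly using pwords_words4(2) by (simp add: sum_list_distinct_conv_sum_set)
qed

definition quasi_rule :: "vertex \<times> vertex \<Rightarrow> rule" where
  "quasi_rule wv = (case wv of (w, v) \<Rightarrow> ([w, v, w], [([w], lenpoly (dws w v))]))"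

text \<open>The Poincare polynomial of W_J is that of W_I times the length polynomial of the minimal
  coset representatives; checked on lists, this makes the division in the quasi-idempotent relation
  exact. Constant term 1 keeps the divisor nonzero. The last conjunct says that the listed rules are
  no others.\<close>

lemma quasi_rules: "list_all (\<lambda>wv. quasi_rule wv \<in> set quasi_rules \<and>
    (case wv of (w, v) \<Rightarrow> pmul (lenpoly (dws w v)) (lenpoly (pwords (bits v))) = lenpoly (pwords (bits w)) \<and>
      lenpoly (pwords (bits v)) \<noteq> [] \<and> hd (lenpoly (pwords (bits v))) = 1)) covering_pairs \<and>
    list_all (\<lambda>r. r \<in> set (map quasi_rule covering_pairs)) quasi_rules"
  by code_simp

fun is_sandwich :: "rule \<Rightarrow> bool" where
  "is_sandwich ([a, b, c], [([a', b', c'], d)]) \<longleftrightarrow> d = [1] \<and> a = a' \<and> c = c' \<and>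
    (covers a b \<and> covers b c \<and> covers a b' \<and> covers b' c \<or>
     covers c b \<and> covers b a \<and> covers c b' \<and> covers b' a)"
| "is_sandwich _ \<longleftrightarrow> False"

lemma sandwich_rules: "list_all is_sandwich sandwich_rules"
  by code_simp

lemma quasi_ratio:
  assumes "covers v w" shows "poincare (vs w) div poincare (vs v) = Poly (lenpoly (dws w v))"
proof -
  have "(w, v) \<in> set covering_pairs" using assms by (simp add: covering_pairs_iff)
  then have *: "pmul (lenpoly (dws w v)) (lenpoly (pwords (bits v))) = lenpoly (pwords (bits w))"
      "lenpoly (pwords (bits v)) \<noteq> []" "hd (lenpoly (pwords (bits v))) = 1"
    using quasi_rules unfolding list_all_iff by auto
  have "poincare (vs w) = Poly (lenpoly (dws w v)) * poincare (vs v)"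
    unfolding poincare_lenpoly *(1)[symmetric] Poly_pmul ..
  moreover have "poincare (vs v) \<noteq> 0"
    unfolding poincare_lenpoly using *(2,3) by (cases "lenpoly (pwords (bits v))") auto
  ultimately show ?thesis by simp
qed

lemma ar_e: "ar v w \<star> e (vs w) = ar v w"
  by (auto simp: ar_def e_def \<upsilon>_def \<delta>_def path_mult_def awlast_conv)

lemma wd_arrows: "covers v w \<Longrightarrow> \<upsilon> (vs v) (vs w) = wd [v, w]" "covers v w \<Longrightarrow> \<delta> (vs w) (vs v) = wd [w, v]"
  unfolding wd.simps ar_e by (simp_all add: ar_def covers_asym)

lemma wd_three: "wd [a, b] \<star> wd [b, c] = wd [a, b, c]"
  using wd_join[of "[a, b]" "[b, c]"] by simp

lemma relations_quasi:
  assumes "covers v w"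
  shows "(\<delta> (vs w) (vs v) \<star> \<upsilon> (vs v) (vs w), (poincare (vs w) div poincare (vs v)) \<cdot> e (vs w))
    = (wd (fst (quasi_rule (w, v))), sem (snd (quasi_rule (w, v))))"
  unfolding quasi_ratio[OF assms] wd_arrows[OF assms] wd_three
  by (simp add: quasi_rule_def del: wd.simps(3))

definition word_pair :: "rule \<Rightarrow> hasse_elt \<times> hasse_elt" where
  "word_pair x = (wd (fst x), sem (snd x))"

lemma vs_sets: "{} = vs V0" "{1} = vs V1" "{2} = vs V2" "{3} = vs V3"
  "{1, 2} = vs V12" "{2, 1} = vs V12" "{1, 3} = vs V13" "{2, 3} = vs V23" "{3, 2} = vs V23"
  "{1, 2, 3} = vs V123"
  by (auto simp: vs_def)

lemma q_eq: "monom 1 (Suc 0) = [:0, 1 :: int:]"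
  by (simp add: monom_altdef)

lemma covers_pairs [simp]:
  "covers V0 V1" "covers V0 V2" "covers V0 V3" "covers V1 V12" "covers V1 V13" "covers V2 V12"
  "covers V2 V23" "covers V3 V13" "covers V3 V23" "covers V12 V123" "covers V13 V123" "covers V23 V123"
  by (simp_all add: covers_def)

text \<open>Set notation is translated into words for symbolic vertices, so that the four instances
  only have to identify concrete sets, among them {2, 1} with {1, 2}.\<close>

lemma T1_word:
  assumes "covers V0 s" "covers V0 t" "covers s st" "vs st = {i, j}" "vs s = {i}" "vs t = {j}"
  shows "(\<delta> {i} {} \<star> \<chi> j \<star> \<upsilon> {} {i}, \<upsilon> {i} {i, j} \<star> \<delta> {i, j} {i} \<boxplus> q \<cdot> e {i})
    = word_pair ([s, V0, t, V0, s], [([s, st, s], [1]), ([s], [0, 1])])"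
proof -
  have "\<delta> {i} {} = wd [s, V0]" "\<upsilon> {} {i} = wd [V0, s]" "\<upsilon> {} {j} = wd [V0, t]" "\<delta> {j} {} = wd [t, V0]"
    "\<upsilon> {i} {i, j} = wd [s, st]" "\<delta> {i, j} {i} = wd [st, s]" "e {i} = wd [s]"
    using assms wd_arrows[of V0 s] wd_arrows[of V0 t] wd_arrows[of s st] vs_sets(1) by (simp_all del: wd.simps(3))
  then show ?thesis
    unfolding \<chi>_def word_pair_def
    by (simp add: wd_join q_eq del: wd.simps Qq_simps(6))
qed

lemma T2_word:
  assumes "covers V0 s" "covers V0 t" "covers s V13" "covers t V13" "vs s = {i}" "vs t = {j}"
  shows "(\<delta> {i} {} \<star> \<upsilon> {} {j}, \<upsilon> {i} {1, 3} \<star> \<delta> {1, 3} {j})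
    = word_pair ([s, V0, t], [([s, V13, t], [1])])"
proof -
  have "\<delta> {i} {} = wd [s, V0]" "\<upsilon> {} {j} = wd [V0, t]" "\<upsilon> {i} {1, 3} = wd [s, V13]" "\<delta> {1, 3} {j} = wd [V13, t]"
    using assms wd_arrows[of V0 s] wd_arrows[of V0 t] wd_arrows[of s V13] wd_arrows[of t V13]
      vs_sets(1) vs_sets(7) by (simp_all del: wd.simps(3))
  then show ?thesis
    unfolding word_pair_def by (simp add: wd_join del: wd.simps Qq_simps)
qed

lemma T3_word:
  assumes "covers s V13" "covers s st" "covers st V123" "vs s = {i}" "vs st = {i, 2}"
  shows "(\<delta> {i, 2} {i} \<star> \<upsilon> {i} {1, 3} \<star> \<delta> {1, 3} {i} \<star> \<upsilon> {i} {i, 2},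
      \<upsilon> {i, 2} S \<star> \<delta> S {i, 2} \<boxplus> (q * (q + 1)) \<cdot> e {i, 2})
    = word_pair ([st, s, V13, s, st], [([st, V123, st], [1]), ([st], [0, 1, 1])])"
proof -
  have "\<delta> {i, 2} {i} = wd [st, s]" "\<upsilon> {i} {1, 3} = wd [s, V13]" "\<delta> {1, 3} {i} = wd [V13, s]" "\<upsilon> {i} {i, 2} = wd [s, st]"
    "\<upsilon> {i, 2} S = wd [st, V123]" "\<delta> S {i, 2} = wd [V123, st]" "e {i, 2} = wd [st]"
    using assms wd_arrows[of s V13] wd_arrows[of s st] wd_arrows[of st V123]
      vs_sets(7) vs_sets(10) by (simp_all del: wd.simps(3))
  then show ?thesis
    unfolding word_pair_def
    by (simp add: wd_join q_eq one_pCons del: wd.simps Qq_simps(6))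
qed

lemma T4_word:
  assumes "covers s V13" "covers t V13" "covers s s2" "covers V2 s2" "covers V2 t2" "covers t t2" "covers s2 V123"
    "vs s = {i}" "vs t = {j}" "vs s2 = {i, 2}" "vs t2 = {2, j}"
  shows "(\<delta> {i, 2} {2} \<star> \<upsilon> {2} {2, j} \<star> \<delta> {2, j} {j} \<star> \<upsilon> {j} {1, 3},
      \<upsilon> {i, 2} S \<star> \<delta> S {1, 3} \<boxplus> q \<cdot> (\<delta> {i, 2} {i} \<star> \<upsilon> {i} {1, 3}))
    = word_pair ([s2, V2, t2, t, V13], [([s2, V123, V13], [1]), ([s2, s, V13], [0, 1])])" (is ?left)
    and "(\<delta> {1, 3} {j} \<star> \<upsilon> {j} {2, j} \<star> \<delta> {2, j} {2} \<star> \<upsilon> {2} {i, 2},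
      \<upsilon> {1, 3} S \<star> \<delta> S {i, 2} \<boxplus> q \<cdot> (\<delta> {1, 3} {i} \<star> \<upsilon> {i} {i, 2}))
    = word_pair ([V13, t, t2, V2, s2], [([V13, V123, s2], [1]), ([V13, s, s2], [0, 1])])" (is ?right)
proof -
  have a: "\<delta> {i, 2} {2} = wd [s2, V2]" "\<upsilon> {2} {2, j} = wd [V2, t2]" "\<delta> {2, j} {j} = wd [t2, t]" "\<upsilon> {j} {1, 3} = wd [t, V13]"
    "\<upsilon> {i, 2} S = wd [s2, V123]" "\<delta> S {1, 3} = wd [V123, V13]" "\<delta> {i, 2} {i} = wd [s2, s]" "\<upsilon> {i} {1, 3} = wd [s, V13]"
    "\<upsilon> {2} {i, 2} = wd [V2, s2]" "\<delta> {2, j} {2} = wd [t2, V2]" "\<upsilon> {j} {2, j} = wd [t, t2]" "\<delta> {1, 3} {j} = wd [V13, t]"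
    "\<delta> S {i, 2} = wd [V123, s2]" "\<upsilon> {1, 3} S = wd [V13, V123]" "\<upsilon> {i} {i, 2} = wd [s, s2]" "\<delta> {1, 3} {i} = wd [V13, s]"
    using assms wd_arrows[of V2 s2] wd_arrows[of V2 t2] wd_arrows[of t t2] wd_arrows[of t V13] wd_arrows[of s2 V123]
      wd_arrows[of V13 V123] wd_arrows[of s s2] wd_arrows[of s V13]
      vs_sets(3) vs_sets(7) vs_sets(10) by (simp_all del: wd.simps(3))
  show ?left
    unfolding word_pair_def a
    by (simp add: wd_join q_eq del: wd.simps Qq_simps(6))
  show ?right
    unfolding word_pair_def a
    by (simp add: wd_join q_eq del: wd.simps Qq_simps(6))
qed

definition up_chain :: "vertex \<Rightarrow> vertex \<Rightarrow> vertex \<Rightarrow> bool" where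
  "up_chain a b c \<longleftrightarrow> covers a b \<and> covers b c"

lemma hasse_square_E:
  assumes "I \<lessdot> J" "J \<lessdot> K" "I \<lessdot> J'" "J' \<lessdot> K"
  obtains a b b' c where "I = vs a" "J = vs b" "J' = vs b'" "K = vs c"
    "covers a b" "covers b c" "covers a b'" "covers b' c"
proof -
  obtain a b where ab: "I = vs a" "J = vs b" "covers a b" using assms(1) by (rule hasse_cover_E)
  obtain b' c where bc: "J' = vs b'" "K = vs c" "covers b' c" using assms(4) by (rule hasse_cover_E)
  have "covers b c" "covers a b'" using assms(2,3) ab bc by (simp_all add: hasse_cover_iff)
  then show ?thesis using that ab bc by blast
qed

lemma torsion_wordI:
  "lr = word_pair x \<Longrightarrow> x \<in> set torsion_rules \<Longrightarrow> \<exists>x\<in>set torsion_rules. lr = word_pair x"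
  by (rule bexI)

text \<open>Serves the inclusion of the ideal in the kernel. Sandwich relations are kept as squares
  with arbitrary middle vertices, since \<open>relations\<close> contains them in both directions
  and also with equal sides, while the rules list one orientation.\<close>

lemma relations_cases:
  assumes "(l, r) \<in> relations"
  shows "(\<exists>x\<in>set (quasi_rules @ torsion_rules). (l, r) = word_pair x) \<or>
    (\<exists>a b b' c. (up_chain a b c \<and> up_chain a b' c \<or> up_chain c b a \<and> up_chain c b' a) \<and>
      l = wd [a, b, c] \<and> r = wd [a, b', c])"
  using assms
proof cases
  case (quasi_idempotent I J)
  then obtain v w where vw: "I = vs v" "J = vs w" "covers v w" by (elim hasse_cover_E)
  then have "(w, v) \<in> set covering_pairs" by (simp add: covering_pairs_iff)
  then have "quasi_rule (w, v) \<in> set quasi_rules"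
    using quasi_rules unfolding list_all_iff by auto
  moreover have "(l, r) = word_pair (quasi_rule (w, v))"
    using quasi_idempotent vw relations_quasi[OF vw(3)] by (simp add: word_pair_def)
  ultimately show ?thesis by auto
next
  case (sandwich_\<upsilon> I J K J')
  obtain a b b' c where abc: "I = vs a" "J = vs b" "J' = vs b'" "K = vs c"
    and cv: "covers a b" "covers b c" "covers a b'" "covers b' c"
    using sandwich_\<upsilon>(3-6) by (rule hasse_square_E)
  have "l = wd [a, b, c]" "r = wd [a, b', c]"
    unfolding sandwich_\<upsilon>(1,2) abc cv[THEN wd_arrows(1)] wd_three by (rule refl)+
  then show ?thesis using cv unfolding up_chain_def by blast
next
  case (sandwich_\<delta> I J K J')
  obtain a b b' c where abc: "I = vs a" "J = vs b" "J' = vs b'" "K = vs c"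
    and cv: "covers a b" "covers b c" "covers a b'" "covers b' c"
    using sandwich_\<delta>(3-6) by (rule hasse_square_E)
  have "l = wd [c, b, a]" "r = wd [c, b', a]"
    unfolding sandwich_\<delta>(1,2) abc cv[THEN wd_arrows(2)] wd_three by (rule refl)+
  then show ?thesis using cv unfolding up_chain_def by blast
next
  case (T1 s t)
  then consider "s = 1" "t = 2" | "s = 2" "t = 1" | "s = 2" "t = 3" | "s = 3" "t = 2" by auto
  then have "\<exists>x\<in>set torsion_rules. (l, r) = word_pair x"
  proof cases
    case 1
    show ?thesis unfolding T1(1,2) 1
      by (rule torsion_wordI[OF T1_word[of V1 V2 V12 1 2]]) (auto simp: vs_def torsion_rules_def)
  next
    case 2
    show ?thesis unfolding T1(1,2) 2
      by (rule torsion_wordI[OF T1_word[of V2 V1 V12 2 1]]) (auto simp: vs_def torsion_rules_def)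
  next
    case 3
    show ?thesis unfolding T1(1,2) 3
      by (rule torsion_wordI[OF T1_word[of V2 V3 V23 2 3]]) (auto simp: vs_def torsion_rules_def)
  next
    case 4
    show ?thesis unfolding T1(1,2) 4
      by (rule torsion_wordI[OF T1_word[of V3 V2 V23 3 2]]) (auto simp: vs_def torsion_rules_def)
  qed
  then show ?thesis by auto
next
  case (T2 s t)
  then consider "s = 1" "t = 3" | "s = 3" "t = 1" by auto
  then have "\<exists>x\<in>set torsion_rules. (l, r) = word_pair x"
  proof cases
    case 1
    show ?thesis unfolding T2(1,2) 1
      by (rule torsion_wordI[OF T2_word[of V1 V3 1 3]]) (auto simp: vs_def torsion_rules_def)
  next
    case 2
    show ?thesis unfolding T2(1,2) 2
      by (rule torsion_wordI[OF T2_word[of V3 V1 3 1]]) (auto simp: vs_def torsion_rules_def)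
  qed
  then show ?thesis by auto
next
  case (T3 s)
  then consider "s = 1" | "s = 3" by auto
  then have "\<exists>x\<in>set torsion_rules. (l, r) = word_pair x"
  proof cases
    case 1
    show ?thesis unfolding T3(1,2) 1
      by (rule torsion_wordI[OF T3_word[of V1 V12 1]]) (auto simp: vs_def torsion_rules_def)
  next
    case 2
    show ?thesis unfolding T3(1,2) 2
      by (rule torsion_wordI[OF T3_word[of V3 V23 3]]) (auto simp: vs_def torsion_rules_def)
  qed
  then show ?thesis by auto
next
  case (T4_left s t)
  then consider "s = 1" "t = 3" | "s = 3" "t = 1" by auto
  then have "\<exists>x\<in>set torsion_rules. (l, r) = word_pair x"
  proof cases
    case 1
    show ?thesis unfolding T4_left(1,2) 1
      by (rule torsion_wordI[OF T4_word(1)[of V1 V3 V12 V23 1 3]]) (auto simp: vs_def torsion_rules_def)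
  next
    case 2
    show ?thesis unfolding T4_left(1,2) 2
      by (rule torsion_wordI[OF T4_word(1)[of V3 V1 V23 V12 3 1]]) (auto simp: vs_def torsion_rules_def)
  qed
  then show ?thesis by auto
next
  case (T4_right s t)
  then consider "s = 1" "t = 3" | "s = 3" "t = 1" by auto
  then have "\<exists>x\<in>set torsion_rules. (l, r) = word_pair x"
  proof cases
    case 1
    show ?thesis unfolding T4_right(1,2) 1
      by (rule torsion_wordI[OF T4_word(2)[of V1 V3 V12 V23 1 3]]) (auto simp: vs_def torsion_rules_def)
  next
    case 2
    show ?thesis unfolding T4_right(1,2) 2
      by (rule torsion_wordI[OF T4_word(2)[of V3 V1 V23 V12 3 1]]) (auto simp: vs_def torsion_rules_def)
  qed
  then show ?thesis by auto
qed

text \<open>The opposite direction: the rules follow from the relations, so rewriting never leaves a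
  congruence class modulo the ideal they generate.\<close>

lemma base_relations:
  assumes "x \<in> set base_rules"
  shows "word_pair x \<in> relations \<or> prod.swap (word_pair x) \<in> relations"
proof -
  consider "x \<in> set quasi_rules" | "x \<in> set sandwich_rules" | "x \<in> set torsion_rules"
    using assms by (auto simp: base_rules_def)
  then show ?thesis
  proof cases
    case 1
    then obtain v w where vw: "(w, v) \<in> set covering_pairs" "x = quasi_rule (w, v)"
      using quasi_rules unfolding list_all_iff by auto
    then have "covers v w" by (simp add: covering_pairs_iff)
    then have "(\<delta> (vs w) (vs v) \<star> \<upsilon> (vs v) (vs w), (poincare (vs w) div poincare (vs v)) \<cdot> e (vs w)) \<in> relations"
      by (intro relations.quasi_idempotent) (simp add: hasse_cover_iff)
    then show ?thesis
      unfolding relations_quasi[OF \<open>covers v w\<close>] vw(2) word_pair_def by simp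
  next
    case 2
    then have "is_sandwich x"
      using sandwich_rules unfolding list_all_iff by blast
    then obtain a b c b' where x: "x = ([a, b, c], [([a, b', c], [1])])"
      and chain: "up_chain a b c \<and> up_chain a b' c \<or> up_chain c b a \<and> up_chain c b' a"
      unfolding up_chain_def by (elim is_sandwich.elims(2)) blast
    have wp: "word_pair x = (wd [a, b, c], wd [a, b', c])"
      unfolding x word_pair_def by (simp del: wd.simps)
    from chain show ?thesis
    proof
      assume "up_chain a b c \<and> up_chain a b' c"
      then have cv: "covers a b" "covers b c" "covers a b'" "covers b' c" by (auto simp: up_chain_def)
      have "(\<upsilon> (vs a) (vs b) \<star> \<upsilon> (vs b) (vs c), \<upsilon> (vs a) (vs b') \<star> \<upsilon> (vs b') (vs c)) \<in> relations"
        using cv by (intro relations.sandwich_\<upsilon>) (simp_all add: hasse_cover_iff)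
      then show ?thesis unfolding wp wd_arrows(1)[OF cv(1)] wd_arrows(1)[OF cv(2)]
          wd_arrows(1)[OF cv(3)] wd_arrows(1)[OF cv(4)] wd_three ..
    next
      assume "up_chain c b a \<and> up_chain c b' a"
      then have cv: "covers c b" "covers b a" "covers c b'" "covers b' a" by (auto simp: up_chain_def)
      have "(\<delta> (vs a) (vs b) \<star> \<delta> (vs b) (vs c), \<delta> (vs a) (vs b') \<star> \<delta> (vs b') (vs c)) \<in> relations"
        using cv by (intro relations.sandwich_\<delta>) (simp_all add: hasse_cover_iff)
      then show ?thesis unfolding wp wd_arrows(2)[OF cv(1)] wd_arrows(2)[OF cv(2)]
          wd_arrows(2)[OF cv(3)] wd_arrows(2)[OF cv(4)] wd_three ..
    qed
  next
    case 3
    have t1: "word_pair ([V1, V0, V2, V0, V1], [([V1, V12, V1], [1]), ([V1], [0, 1])]) \<in> relations"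
      by (subst T1_word[of V1 V2 V12 1 2, symmetric]) ((rule relations.T1, simp) | (auto simp: vs_def)[1])+
    have t2: "word_pair ([V2, V0, V1, V0, V2], [([V2, V12, V2], [1]), ([V2], [0, 1])]) \<in> relations"
      by (subst T1_word[of V2 V1 V12 2 1, symmetric]) ((rule relations.T1, simp) | (auto simp: vs_def)[1])+
    have t3: "word_pair ([V2, V0, V3, V0, V2], [([V2, V23, V2], [1]), ([V2], [0, 1])]) \<in> relations"
      by (subst T1_word[of V2 V3 V23 2 3, symmetric]) ((rule relations.T1, simp) | (auto simp: vs_def)[1])+
    have t4: "word_pair ([V3, V0, V2, V0, V3], [([V3, V23, V3], [1]), ([V3], [0, 1])]) \<in> relations"
      by (subst T1_word[of V3 V2 V23 3 2, symmetric]) ((rule relations.T1, simp) | (auto simp: vs_def)[1])+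
    have t5: "word_pair ([V1, V0, V3], [([V1, V13, V3], [1])]) \<in> relations"
      by (subst T2_word[of V1 V3 1 3, symmetric]) ((rule relations.T2, simp) | (auto simp: vs_def)[1])+
    have t6: "word_pair ([V3, V0, V1], [([V3, V13, V1], [1])]) \<in> relations"
      by (subst T2_word[of V3 V1 3 1, symmetric]) ((rule relations.T2, simp) | (auto simp: vs_def)[1])+
    have t7: "word_pair ([V12, V1, V13, V1, V12], [([V12, V123, V12], [1]), ([V12], [0, 1, 1])]) \<in> relations"
      by (subst T3_word[of V1 V12 1, symmetric]) ((rule relations.T3, simp) | (auto simp: vs_def)[1])+
    have t8: "word_pair ([V23, V3, V13, V3, V23], [([V23, V123, V23], [1]), ([V23], [0, 1, 1])]) \<in> relations"
      by (subst T3_word[of V3 V23 3, symmetric]) ((rule relations.T3, simp) | (auto simp: vs_def)[1])+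
    have t9: "word_pair ([V12, V2, V23, V3, V13], [([V12, V123, V13], [1]), ([V12, V1, V13], [0, 1])]) \<in> relations"
      by (subst T4_word(1)[of V1 V3 V12 V23 1 3, symmetric]) ((rule relations.T4_left, simp) | (auto simp: vs_def)[1])+
    have t10: "word_pair ([V13, V3, V23, V2, V12], [([V13, V123, V12], [1]), ([V13, V1, V12], [0, 1])]) \<in> relations"
      by (subst T4_word(2)[of V1 V3 V12 V23 1 3, symmetric]) ((rule relations.T4_right, simp) | (auto simp: vs_def)[1])+
    have t11: "word_pair ([V23, V2, V12, V1, V13], [([V23, V123, V13], [1]), ([V23, V3, V13], [0, 1])]) \<in> relations"
      by (subst T4_word(1)[of V3 V1 V23 V12 3 1, symmetric]) ((rule relations.T4_left, simp) | (auto simp: vs_def)[1])+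
    have t12: "word_pair ([V13, V1, V12, V2, V23], [([V13, V123, V23], [1]), ([V13, V3, V23], [0, 1])]) \<in> relations"
      by (subst T4_word(2)[of V3 V1 V23 V12 3 1, symmetric]) ((rule relations.T4_right, simp) | (auto simp: vs_def)[1])+
    show ?thesis
      using 3 t1 t2 t3 t4 t5 t6 t7 t8 t9 t10 t11 t12 unfolding torsion_rules_def list.set by (elim insertE emptyE) (simp_all only: simp_thms)
  qed
qed

section \<open>Evaluation of words\<close>

lemma slot_Xsum: "h \<in> xmod (vs v) \<Longrightarrow> slot v h \<in> Xsum"
  unfolding Xsum_iff slot_def by (auto simp: xmod_closed)

lemma slot_xelt [simp]: "slot v (xelt (vs v)) \<in> Xsum"
  by (rule slot_Xsum[OF xmod_closed(6)])

lemma slot_hecke_mult: "slot v (hecke_mult a h) = (\<lambda>L. hecke_mult (slot v a L) h)"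
  by (auto simp: slot_def)

lemma Xsum_slots: "m \<in> Xsum \<Longrightarrow> m = (\<lambda>L. \<Sum>v\<leftarrow>vertices. slot v (m (vs v)) L)"
proof
  fix L assume m: "m \<in> Xsum"
  show "m L = (\<Sum>v\<leftarrow>vertices. slot v (m (vs v)) L)"
  proof (cases "L \<in> range vs")
    case True
    then obtain w where "L = vs w" by blast
    then show ?thesis by (cases w) (simp_all add: vertices_def slot_def)
  next
    case False
    then have "L \<noteq> vs v" for v by blast
    then show ?thesis using m False by (simp add: vertices_def slot_def Xsum_iff)
  qed
qed

text \<open>Every family is a finite sum of families concentrated at one vertex, and each of these
  is the generator there times an element of H. So an endomorphism is determined by its values on
  the eight generators.\<close>

lemma Eq_slots_eqI:
  assumes f: "f \<in> carrier Eq" and g: "g \<in> carrier Eq"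
    and eq: "\<And>v. f (slot v (xelt (vs v))) = g (slot v (xelt (vs v)))"
  shows "f = g"
proof (rule Eq_eqI[OF f g])
  fix m assume m: "m \<in> Xsum"
  have slot: "f (slot v (m (vs v))) = g (slot v (m (vs v))) \<and> slot v (m (vs v)) \<in> Xsum" for v
  proof -
    obtain h where h: "h \<in> HW" "m (vs v) = hecke_mult (xelt (vs v)) h"
      using Xsum_xmod[OF m, of v] unfolding xmod_iff by blast
    show ?thesis
      using h(1) EqD(3)[OF f slot_xelt h(1)] EqD(3)[OF g slot_xelt h(1)] eq
      unfolding h(2) slot_hecke_mult by simp
  qed
  have zero: "k (\<lambda>L. 0) = (\<lambda>L. 0)" if "k \<in> carrier Eq" for k
    using EqD(3)[OF that, of "\<lambda>L. 0" 0] EqD(1)[OF that, of "\<lambda>L. 0"] Xsum_HW hecke_mult_right(1)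
    by (simp add: Xsum_HW hecke_mult_right)
  have list: "f (\<lambda>L. \<Sum>v\<leftarrow>l. slot v (m (vs v)) L) = g (\<lambda>L. \<Sum>v\<leftarrow>l. slot v (m (vs v)) L) \<and>
      (\<lambda>L. \<Sum>v\<leftarrow>l. slot v (m (vs v)) L) \<in> Xsum" for l
  proof (induction l)
    case (Cons v l)
    then show ?case
      using slot[of v] EqD(2)[OF f, of "slot v (m (vs v))"] EqD(2)[OF g, of "slot v (m (vs v))"] by simp
  qed (simp add: zero f g)
  show "f m = g m"
    by (rule trans[OF arg_cong[OF Xsum_slots[OF m], of f]
          trans[OF conjunct1[OF list[of vertices]] arg_cong[OF Xsum_slots[OF m, symmetric], of g]]])
qed

lemma evw_xmod: "valid w \<Longrightarrow> evw w \<in> xmod (vs (hd w))"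
  by (induction w rule: valid.induct) (use xmod_mono xmod_helt xmod_closed(6) in auto)

text \<open>x_I itself is invariant from the right, inclusions keep the element, and left
  multiplication by h commutes with right multiplication by T_i.\<close>

lemma evw_right: "valid w \<Longrightarrow> evw w \<in> right_invariant (vs (last w))"
proof (induction w rule: valid.induct)
  case (2 v)
  then show ?case by (simp add: xelt_invariant)
next
  case (3 v w ws)
  then have IH: "evw (w # ws) \<in> right_invariant (vs (last (w # ws)))" by simp
  then have h: "evw (w # ws) \<in> HW" by (simp add: right_invariant_def)
  have "hecke_mult (helt (vs v) (vs w)) (evw (w # ws)) \<in> right_invariant (vs (last (w # ws)))"
    unfolding right_invariant_def mem_Collect_eq
  proof (intro conjI ballI)
    show "hecke_mult (helt (vs v) (vs w)) (evw (w # ws)) \<in> HW"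
      by (rule hecke_mult_right(4)[OF helt_HW h])
    fix i assume i: "i \<in> vs (last (w # ws))"
    then have "i \<in> gens" using bits_gens(2) by blast
    from hecke_mult_right(5)[OF helt_HW h this]
    show "gen_right i (hecke_mult (helt (vs v) (vs w)) (evw (w # ws))) =
        scale q (hecke_mult (helt (vs v) (vs w)) (evw (w # ws)))"
      using IH i by (simp add: right_invariant_def hecke_mult_right(3))
  qed
  then show ?case using IH 3(2) by auto
qed simp

definition hstep :: "vertex \<Rightarrow> vertex \<Rightarrow> int list list \<Rightarrow> int list list" where
  "hstep v w l = (if covers v w then l else hd_act v w l)"

fun hev :: "vertex list \<Rightarrow> int list list" where
  "hev [] = replicate 24 []"
| "hev [v] = hx v"
| "hev (v # w # ws) = hstep v w (hev (w # ws))"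

lemma represents_hev: "valid w \<Longrightarrow> represents (hev w) (evw w)"
  by (induction w rule: valid.induct) (auto simp: represents_hx hstep_def represents_hd_act)

fun hsem :: "comb \<Rightarrow> int list list" where
  "hsem [] = replicate 24 []"
| "hsem ((w, c) # p) = hadd (map (pmul c) (hev w)) (hsem p)"

definition esem :: "comb \<Rightarrow> hecke" where
  "esem p = (\<Sum>(w, c)\<leftarrow>p. scale (Poly c) (evw w))"

lemma represents_scale: "represents l h \<Longrightarrow> represents (map (pmul c) l) (scale (Poly c) h)"
proof -
  assume l: "represents l h"
  note r = representsD[OF l]
  show ?thesis by (rule representsI) (use r in \<open>simp_all add: Poly_pmul\<close>)
qed

lemma represents_hsem: "(\<forall>(u, c)\<in>set p. valid u) \<Longrightarrow> represents (hsem p) (esem p)"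
proof (induction p rule: hsem.induct)
  case 1
  show ?case using represents_0 by (simp add: esem_def)
next
  case (2 w c p)
  then have "represents (hadd (map (pmul c) (hev w)) (hsem p)) (scale (Poly c) (evw w) + esem p)"
    by (intro represents_add represents_scale represents_hev) auto
  then show ?case by (simp add: esem_def)
qed

fun rules_eval :: "rule list \<Rightarrow> bool" where
  "rules_eval [] = True"
| "rules_eval ((l, r) # rs) = (heq (hev l) (hsem r) \<and> rules_eval rs)"

text \<open>Computation is reserved for quasi-idempotent and torsion rules. For a sandwich the
  values agree by \<open>helt_xelt\<close>: two inclusions fix x_K, and two multiplications turn x_I
  into x_K, whatever lies between.\<close>

lemma rules_eval: "rules_eval (quasi_rules @ torsion_rules)"
  by code_simp

lemma rules_eval_iff: "rules_eval rs \<longleftrightarrow> (\<forall>(l, r)\<in>set rs. heq (hev l) (hsem r))"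
  by (induction rs rule: rules_eval.induct) auto

lemma Phi_sem: "good w p \<Longrightarrow> Phi (sem p) (slot u (xelt (vs u))) =
    (if u = last w then slot (hd w) (esem p) else (\<lambda>L. 0))"
proof (induction p)
  case Nil
  show ?case by (auto simp: esem_def slot_def)
next
  case (Cons x p)
  obtain v c where x: "x = (v, c)" by (cases x)
  then have v: "v \<noteq> []" "hd v = hd w" "last v = last w" "good w p"
    using Cons.prems by (auto simp: good_def)
  show ?case
    using Cons.IH[OF v(4)] Phi_wd[OF v(1), of u] v(2,3) unfolding x
    by (auto simp: esem_def slot_def)
qed

lemma relations_Phi:
  assumes "(l, r) \<in> relations"
  shows "l \<in> Qcar \<and> r \<in> Qcar \<and> Phi l (slot u (xelt (vs u))) = Phi r (slot u (xelt (vs u)))"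
proof -
  from relations_cases[OF assms]
  show ?thesis
  proof (elim disjE bexE exE conjE)
    fix x assume x: "x \<in> set (quasi_rules @ torsion_rules)" "(l, r) = word_pair x"
    obtain w p where wp: "x = (w, p)" by (cases x)
    have lr: "l = wd w" "r = sem p" using x(2) unfolding word_pair_def wp by simp_all
    have "x \<in> set rules"
      using x(1) by (auto simp: rules_def set_add_overlaps base_rules_def)
    then have w: "valid w" "all_reduce w p"
      using decreasing_rules unfolding decreasing_iff wp by auto
    have "heq (hev w) (hsem p)"
      using rules_eval x(1) unfolding rules_eval_iff wp by auto
    moreover have "\<forall>(u, c)\<in>set p. valid u"
      using w(2) by (auto simp: all_reduce_iff reduces_to_def)
    ultimately have "evw w = esem p"
      using represents_heq[OF represents_hev[OF w(1)] represents_hsem] by blast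
    then show ?thesis
      unfolding lr using Phi_wd[OF valid_ne[OF w(1)], of u] Phi_sem[OF all_reduce_good[OF w(2)], of u]
        wd_Q sem_Q by (simp del: mem_Collect_eq)
  next
    fix a b b' c assume c: "up_chain a b c" "up_chain a b' c" and lr: "l = wd [a, b, c]" "r = wd [a, b', c]"
    then have "evw [a, b, c] = evw [a, b', c]"
      by (simp add: up_chain_def)
    then show ?thesis
      unfolding lr using Phi_wd[of "[a, b, c]" u] Phi_wd[of "[a, b', c]" u] wd_Q
      by (simp del: mem_Collect_eq wd.simps evw.simps)
  next
    fix a b b' c assume c: "up_chain c b a" "up_chain c b' a" and lr: "l = wd [a, b, c]" "r = wd [a, b', c]"
    then have "evw [a, b, c] = evw [a, b', c]"
      using covers_asym by (simp add: up_chain_def helt_xelt)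
    then show ?thesis
      unfolding lr using Phi_wd[of "[a, b, c]" u] Phi_wd[of "[a, b', c]" u] wd_Q
      by (simp del: mem_Collect_eq wd.simps evw.simps)
  qed
qed

section \<open>The normal words form a basis\<close>

text \<open>Indices of the minimal representatives of the (W_J, W_I) double cosets.\<close>

definition reps :: "vertex \<Rightarrow> vertex \<Rightarrow> nat list" where
  "reps J I = filter (\<lambda>k. list_all (\<lambda>i. fst (ltab i ! k)) (bits J) \<and>
     list_all (\<lambda>i. inversions (perms4 ! k) < inversions (swap_at i (perms4 ! k))) (bits I)) [0..<24]"

text \<open>
  For \<open>ks\<close> in decreasing order, the index of the last nonzero coefficient, provided that this
  coefficient is 1.
\<close>

fun lead :: "nat list \<Rightarrow> int list list \<Rightarrow> nat option" where
  "lead [] l = None"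
| "lead (k # ks) l = (if list_all (\<lambda>a. a = 0) (l ! k) then lead ks l
     else if list_all (\<lambda>a. a = 0) (padd (l ! k) [- 1]) then Some k else None)"

fun leads :: "nat list \<Rightarrow> vertex \<Rightarrow> (vertex list \<times> int list list) list \<Rightarrow> nat option list" where
  "leads ks J [] = []"
| "leads ks J ((w, l) # p) = (if hd w = J then lead ks l # leads ks J p else leads ks J p)"

text \<open>The word being extended is already irreducible, so only a rule matching at the new head
  can apply. Its value is stored along with it, and one \<open>hstep\<close> gives the value of the
  longer word.\<close>

fun ext_vs :: "rule list \<Rightarrow> vertex list \<Rightarrow> int list list \<Rightarrow> vertex list \<Rightarrow> (vertex list \<times> int list list) list" where
  "ext_vs rs w l [] = []"
| "ext_vs rs w l (v # vs') = (if covers v (hd w) \<or> covers (hd w) v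
     then (case top_rewrite rs (v # w) of None \<Rightarrow> (v # w, hstep v (hd w) l) # ext_vs rs w l vs'
       | Some p \<Rightarrow> ext_vs rs w l vs')
     else ext_vs rs w l vs')"

fun ext :: "rule list \<Rightarrow> (vertex list \<times> int list list) list \<Rightarrow> (vertex list \<times> int list list) list" where
  "ext rs [] = []"
| "ext rs ((w, l) # p) = ext_vs rs w l vertices @ ext rs p"

text \<open>Enumerates the irreducible words by length; the first argument is only fuel.\<close>

fun levels :: "nat \<Rightarrow> rule list \<Rightarrow> (vertex list \<times> int list list) list \<Rightarrow> (vertex list \<times> int list list) list option" where
  "levels 0 rs p = None"
| "levels (Suc n) rs p = (case p of [] \<Rightarrow> Some []
     | x # p' \<Rightarrow> (case levels n rs (ext rs p) of None \<Rightarrow> None | Some es \<Rightarrow> Some (p @ es)))"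

text \<open>Leading indices exist, are pairwise distinct and exhaust the double coset
  representatives: up to a permutation of the words, the square matrix of coefficients is
  unitriangular.\<close>

definition tri_ok :: "nat list \<Rightarrow> nat option list \<Rightarrow> bool" where
  "tri_ok ks ls \<longleftrightarrow> list_all (\<lambda>x. x \<noteq> None) ls \<and> distinct ls \<and> list_all (\<lambda>k. Some k \<in> set ls) ks"

fun tri_all :: "vertex \<Rightarrow> (vertex list \<times> int list list) list \<Rightarrow> vertex list \<Rightarrow> bool" where
  "tri_all I es [] = True"
| "tri_all I es (J # Js) = (tri_ok (reps J I) (leads (rev (reps J I)) J es) \<and> tri_all I es Js)"

text \<open>Running out of fuel yields \<open>None\<close> and makes the check fail. That 12 is
  enough means that no irreducible word has more than 11 vertices.\<close>

definition check :: "vertex \<Rightarrow> bool" where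
  "check I = (case levels 12 rules [([I], hx I)] of None \<Rightarrow> False | Some es \<Rightarrow> tri_all I es vertices)"

lemma check_V0: "check V0"
  by code_simp

lemma check_V1: "check V1"
  by code_simp

lemma check_V2: "check V2"
  by code_simp

lemma check_V3: "check V3"
  by code_simp

lemma check_V12: "check V12"
  by code_simp

lemma check_V13: "check V13"
  by code_simp

lemma check_V23: "check V23"
  by code_simp

lemma check_V123: "check V123"
  by code_simp

lemma check: "check I"
  by (cases I) (simp_all only: check_V0 check_V1 check_V2 check_V3 check_V12 check_V13 check_V23 check_V123)

section \<open>Leading coefficients, independence and spanning\<close>

definition dominates :: "nat list \<Rightarrow> hecke \<Rightarrow> nat \<Rightarrow> bool" where
  "dominates ks h k \<longleftrightarrow> k \<in> set ks \<and> lookup h (word (words4 ! k)) = 1 \<and>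
    (\<forall>j\<in>set ks. k < j \<longrightarrow> lookup h (word (words4 ! j)) = 0)"

lemma lead_dominates:
  assumes "lead ks l = Some k" "represents l h" "sorted_wrt (>) ks" "\<forall>j\<in>set ks. j < 24"
  shows "dominates ks h k"
  using assms(1,3,4)
proof (induction ks)
  case (Cons a ks)
  note look = representsD(3)[OF assms(2)]
  show ?case
  proof (cases "list_all (\<lambda>a. a = 0) (l ! a)")
    case True
    then have "dominates ks h k" using Cons by simp
    moreover have "lookup h (word (words4 ! a)) = 0"
      using look[of a] Poly_all_0[OF True] Cons.prems(3) by simp
    ultimately show ?thesis by (auto simp: dominates_def)
  next
    case False
    then have z: "list_all (\<lambda>a. a = 0) (padd (l ! a) [- 1])" and k: "k = a"
      using Cons.prems(1) by (auto split: if_splits)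
    have "[:- 1:] = (- 1 :: int poly)" by (simp add: one_pCons)
    then have "Poly (l ! a) + - 1 = 0"
      using Poly_all_0[OF z] unfolding Poly_padd by simp
    then have "Poly (l ! a) = 1" by (simp only: add_eq_0_iff2 minus_minus)
    then have "lookup h (word (words4 ! a)) = 1"
      using look[of a] Cons.prems(3) by simp
    then show ?thesis using Cons.prems(2) unfolding k by (auto simp: dominates_def)
  qed
qed simp

lemma reps_less: "k \<in> set (reps J I) \<Longrightarrow> k < 24"
  by (simp add: reps_def)

lemma sorted_reps: "sorted_wrt (>) (rev (reps J I))"
  unfolding sorted_wrt_rev reps_def by (rule sorted_wrt_filter) simp

lemma leads_conv:
  "leads ks J es = map (\<lambda>(w, l). lead ks l) (filter (\<lambda>(w, l). hd w = J) es)"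
  by (induction ks J es rule: leads.induct) auto

lemma set_ext_vs:
  "set (ext_vs rs w l us) = {(v # w, hstep v (hd w) l) | v. v \<in> set us \<and>
    (covers v (hd w) \<or> covers (hd w) v) \<and> top_rewrite rs (v # w) = None}"
  by (induction us) (auto split: option.splits)

lemma set_ext:
  "set (ext rs p) = (\<Union>(w, l)\<in>set p. {(v # w, hstep v (hd w) l) | v.
    (covers v (hd w) \<or> covers (hd w) v) \<and> top_rewrite rs (v # w) = None})"
  by (induction rs p rule: ext.induct) (auto simp: set_ext_vs)

lemma levels_closed:
  "levels n rs p = Some es \<Longrightarrow> set p \<subseteq> set es \<and> set (ext rs es) \<subseteq> set es"
proof (induction n arbitrary: p es)
  case (Suc n)
  show ?case
  proof (cases p)
    case Nil
    then show ?thesis using Suc.prems by simp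
  next
    case (Cons x p')
    then obtain es' where es: "levels n rs (ext rs p) = Some es'" "es = p @ es'"
      using Suc.prems by (auto split: option.splits)
    have "set (ext rs p) \<subseteq> set es'" "set (ext rs es') \<subseteq> set es'"
      using Suc.IH[OF es(1)] by auto
    moreover have "set (ext rs (p @ es')) = set (ext rs p) \<union> set (ext rs es')"
      by (simp only: set_ext set_append UN_Un)
    ultimately show ?thesis unfolding es(2) set_append by blast
  qed
qed simp

lemma levels_invariant:
  assumes "levels n rs p = Some es" "\<forall>(w, l)\<in>set p. valid w \<and> last w = I \<and> l = hev w"
  shows "\<forall>(w, l)\<in>set es. valid w \<and> last w = I \<and> l = hev w"
  using assms
proof (induction n arbitrary: p es)
  case (Suc n)
  show ?case
  proof (cases p)
    case Nil
    then show ?thesis using Suc.prems by simp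
  next
    case (Cons x p')
    then obtain es' where es: "levels n rs (ext rs p) = Some es'" "es = p @ es'"
      using Suc.prems by (auto split: option.splits)
    have "valid (v # w) \<and> last (v # w) = I \<and> hstep v (hd w) l = hev (v # w)"
      if "(w, l) \<in> set p" "covers v (hd w) \<or> covers (hd w) v" for v w l
    proof -
      have w: "valid w" "last w = I" "l = hev w" using Suc.prems(2) that(1) by auto
      obtain a t where "w = a # t" using w(1) by (cases w) auto
      then show ?thesis using w that(2) by auto
    qed
    then have "\<forall>(w, l)\<in>set (ext rs p). valid w \<and> last w = I \<and> l = hev w"
      unfolding set_ext by blast
    then show ?thesis
      using Suc.IH[OF es(1)] Suc.prems(2) unfolding es(2) by auto
  qed
qed simp

text \<open>The enumeration is closed under irreducible extension to the left, and the tail of an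
  irreducible word is irreducible; induction on the word therefore finds every irreducible word in
  the list.\<close>

lemma basis:
  "\<exists>es. (\<forall>w. normal w \<longrightarrow> last w = I \<longrightarrow> (w, hev w) \<in> set es) \<and>
    (\<forall>w l. (w, l) \<in> set es \<longrightarrow> valid w \<and> last w = I \<and> l = hev w) \<and>
    (\<forall>J. tri_ok (reps J I) (leads (rev (reps J I)) J es))"
proof -
  obtain es where es: "levels 12 rules [([I], hx I)] = Some es" "tri_all I es vertices"
    using check[of I] unfolding check_def by (auto split: option.splits)
  have tri: "tri_ok (reps J I) (leads (rev (reps J I)) J es)" for J
  proof -
    have "\<forall>J\<in>set Js. tri_ok (reps J I) (leads (rev (reps J I)) J es)" if "tri_all I es Js" for Js
      using that by (induction Js) auto
    then show ?thesis using es(2) in_vertices by blast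
  qed
  have inv: "\<forall>(w, l)\<in>set es. valid w \<and> last w = I \<and> l = hev w"
    by (rule levels_invariant[OF es(1)]) simp
  have closed: "([I], hx I) \<in> set es" "set (ext rules es) \<subseteq> set es"
    using levels_closed[OF es(1)] by auto
  have nf: "(w, hev w) \<in> set es" if "normal w" "last w = I" for w
    using that
  proof (induction w)
    case Nil
    then show ?case by (simp add: normal_def)
  next
    case (Cons v w)
    have top: "top_rewrite rules (v # w) = None" "rewrite rules w = None"
      using Cons.prems(1) unfolding normal_def by (auto split: option.splits)
    show ?case
    proof (cases w)
      case Nil
      then show ?thesis using closed(1) Cons.prems(2) by simp
    next
      case (Cons a t)
      then have "valid w" "covers v a \<or> covers a v"
        using Cons.prems(1) unfolding normal_def by auto
      then have "(w, hev w) \<in> set es"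
        using Cons.IH Cons.prems(2) top(2) Cons by (simp add: normal_def)
      then have "(v # w, hstep v (hd w) (hev w)) \<in> set (ext rules es)"
        unfolding set_ext using top(1) \<open>covers v a \<or> covers a v\<close> Cons by force
      then show ?thesis using closed(2) Cons by auto
    qed
  qed
  show ?thesis
  proof (intro exI[of _ es] conjI allI impI)
    fix w l assume "(w, l) \<in> set es"
    from bspec[OF inv this] show "valid w" "last w = I" "l = hev w" by simp_all
  qed (fact nf tri)+
qed

definition hcoef :: "hecke \<Rightarrow> nat \<Rightarrow> int poly" where
  "hcoef h k = lookup h (word (words4 ! k))"

text \<open>The form in which the computation is used: \<open>f\<close> is the leading index. Its
  injectivity serves independence; the last clause, that every representative is a leading index,
  serves spanning.\<close>

lemma leading_terms:
  "\<exists>f. (\<forall>w. normal w \<longrightarrow> hd w = J \<longrightarrow> last w = I \<longrightarrow> dominates (rev (reps J I)) (evw w) (f w)) \<and>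
    inj_on f {w. normal w \<and> hd w = J \<and> last w = I} \<and>
    (\<forall>k\<in>set (reps J I). \<exists>w. valid w \<and> hd w = J \<and> last w = I \<and> dominates (rev (reps J I)) (evw w) k)"
proof -
  obtain es where "\<forall>w. normal w \<longrightarrow> last w = I \<longrightarrow> (w, hev w) \<in> set es"
    "\<forall>w l. (w, l) \<in> set es \<longrightarrow> valid w \<and> last w = I \<and> l = hev w"
    "\<forall>J. tri_ok (reps J I) (leads (rev (reps J I)) J es)"
    using basis[of I] by iprover
  note es = this[rule_format]
  let ?ks = "rev (reps J I)" and ?es = "filter (\<lambda>(w, l). hd w = J) es"
  let ?lead = "\<lambda>(w, l). lead ?ks l"
  have tri: "list_all (\<lambda>x. x \<noteq> None) (map ?lead ?es)" "distinct (map ?lead ?es)"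
    "\<And>k. k \<in> set (reps J I) \<Longrightarrow> Some k \<in> set (map ?lead ?es)"
    using es(3)[of J] unfolding tri_ok_def leads_conv list_all_iff by simp_all
  have dom: "dominates ?ks (evw w) k" if "(w, l) \<in> set es" "lead ?ks l = Some k" for w l k
    using es(2)[OF that(1)] that(2) represents_hev[of w] sorted_reps reps_less
    by (intro lead_dominates[of ?ks l]) auto
  define f where "f w = the (lead ?ks (hev w))" for w
  have f: "lead ?ks (hev w) = Some (f w) \<and> (w, hev w) \<in> set ?es" if "normal w" "hd w = J" "last w = I" for w
  proof -
    have w: "(w, hev w) \<in> set ?es" using es(1)[OF that(1,3)] that(2) by simp
    then have "lead ?ks (hev w) \<noteq> None" using tri(1) unfolding list_all_iff by force
    then show ?thesis using w by (auto simp: f_def)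
  qed
  show ?thesis
  proof (intro exI[of _ f] conjI allI impI ballI)
    fix w assume "normal w" "hd w = J" "last w = I"
    from f[OF this] show "dominates ?ks (evw w) (f w)" by (intro dom[of w "hev w"]) simp_all
  next
    show "inj_on f {w. normal w \<and> hd w = J \<and> last w = I}"
    proof (rule inj_onI)
      fix w w' assume w: "w \<in> {w. normal w \<and> hd w = J \<and> last w = I}" "w' \<in> {w. normal w \<and> hd w = J \<and> last w = I}"
        and eq: "f w = f w'"
      have "inj_on ?lead (set ?es)" using tri(2) by (simp only: distinct_map)
      moreover have "?lead (w, hev w) = ?lead (w', hev w')"
        using f[of w] f[of w'] w eq by simp
      moreover have "(w, hev w) \<in> set ?es" "(w', hev w') \<in> set ?es"
        using f[of w] f[of w'] w by simp_all
      ultimately have "(w, hev w) = (w', hev w')" by (rule inj_onD)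
      then show "w = w'" by simp
    qed
  next
    fix k assume "k \<in> set (reps J I)"
    from tri(3)[OF this] obtain w l where "(w, l) \<in> set ?es" "lead ?ks l = Some k" by auto
    then show "\<exists>w. valid w \<and> hd w = J \<and> last w = I \<and> dominates ?ks (evw w) k"
      using es(2)[of w l] dom[of w l k] by auto
  qed
qed

text \<open>At the largest leading index all other words of \<open>N\<close> have coefficient 0,
  because their leading indices are strictly smaller, and the word attaining it has coefficient 1.
  So its scalar would have to vanish.\<close>

lemma normal_independent:
  fixes y :: "vertex list \<Rightarrow>\<^sub>0 int poly"
  assumes fin: "finite N" and N: "N \<subseteq> {w. normal w \<and> hd w = J \<and> last w = I}"
    and zero: "(\<Sum>w\<in>N. scale (lookup y w) (evw w)) = 0"
    and ne: "\<And>w. w \<in> N \<Longrightarrow> lookup y w \<noteq> 0"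
  shows "N = {}"
proof (rule ccontr)
  assume "N \<noteq> {}"
  obtain f where "\<forall>w. normal w \<longrightarrow> hd w = J \<longrightarrow> last w = I \<longrightarrow> dominates (rev (reps J I)) (evw w) (f w)"
    "inj_on f {w. normal w \<and> hd w = J \<and> last w = I}"
    using leading_terms[of J I] by iprover
  note f = this[rule_format]
  have "Max (f ` N) \<in> f ` N"
    using fin \<open>N \<noteq> {}\<close> by (intro Max_in) simp_all
  then obtain w where w: "w \<in> N" "f w = Max (f ` N)" by (elim imageE) simp
  have max: "f u \<le> f w" if "u \<in> N" for u
    unfolding w(2) using fin that by (intro Max_ge) simp_all
  have fw: "f w \<in> set (reps J I)" "hcoef (evw w) (f w) = 1"
    using f(1)[of w] N w(1) by (auto simp: dominates_def hcoef_def)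
  have other: "hcoef (evw u) (f w) = 0" if "u \<in> N" "u \<noteq> w" for u
  proof -
    have "f u \<noteq> f w" using f(2) N that w(1) by (auto dest: inj_onD)
    then have "f u < f w" using max[OF that(1)] by simp
    then show ?thesis using f(1)[of u] N that fw(1) by (auto simp: dominates_def hcoef_def)
  qed
  have "0 = (\<Sum>u\<in>N. lookup y u * hcoef (evw u) (f w))"
    using arg_cong[OF zero, of "\<lambda>h. hcoef h (f w)"] by (simp add: hcoef_def lookup_sum)
  also have "\<dots> = (\<Sum>u\<in>{w}. lookup y u * hcoef (evw u) (f w))"
    using fin w(1) other by (intro sum.mono_neutral_right) auto
  also have "\<dots> = lookup y w" using fw(2) by simp
  finally show False using ne[OF w(1)] by simp
qed

text \<open>Coefficients do not change under left multiplication by generators in J and right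
  multiplication by generators in I. An element outside the list of representatives can be shortened
  in one of these ways, so induction on length ends at a representative.\<close>

lemma biinvariant_eq_0:
  assumes l: "h \<in> left_invariant (vs J)" and r: "h \<in> right_invariant (vs I)"
    and z: "\<And>k. k \<in> set (reps J I) \<Longrightarrow> hcoef h k = 0"
  shows "h = 0"
proof (rule HW_eqI)
  show "h \<in> HW" using l by (simp add: left_invariant_def)
  fix w assume "w \<in> W"
  then show "lookup h w = lookup 0 w"
  proof (induction "len w" arbitrary: w rule: less_induct)
    case less
    obtain js where js: "js \<in> set words4" "w = word js" using W_words4[OF less.prems] by blast
    then obtain k where k: "k < 24" "w = word (words4 ! k)"
      using length_lists by (auto simp: in_set_conv_nth)
    show ?case
    proof (cases "k \<in> set (reps J I)")
      case True
      then show ?thesis using z k by (simp add: hcoef_def)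
    next
      case False
      then consider i where "i \<in> set (bits J)" "\<not> fst (ltab i ! k)"
        | i where "i \<in> set (bits I)" "\<not> inversions (perms4 ! k) < inversions (swap_at i (perms4 ! k))"
        using k(1) by (auto simp: reps_def list_all_iff)
      then show ?thesis
      proof cases
        case 1
        have i: "i \<in> gens" "i \<in> vs J" using 1(1) bits_gens by (auto simp: vs_def)
        have "len (lact i w) < len w"
          using ltab_nth(3)[OF i(1) k(1)] 1(2) len_lact[OF less.prems i(1)] k(2) by auto
        then have "lookup h (lact i w) = 0"
          using less.hyps[of "lact i w"] less.prems i(1) by simp
        then show ?thesis
          using left_invariant_lookup[OF l i(2) bits_gens(2) less.prems] by simp
      next
        case 2
        have i: "i \<in> gens" "i \<in> vs I" using 2(1) bits_gens by (auto simp: vs_def)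
        have "perms4 ! k = enc w"
          using k length_lists by (simp add: enc_word flip: perms4_words4)
        then have "len (ract i w) < len w"
          using 2(2) len_ract[OF less.prems i(1)] i(1) less.prems
          by (auto simp: len_inversions enc_ract)
        then have "lookup h (ract i w) = 0"
          using less.hyps[of "ract i w"] less.prems i(1) by simp
        then show ?thesis
          using right_invariant_lookup[OF r i(2) bits_gens(2) less.prems] by simp
      qed
    qed
  qed
qed simp

lemma invariant_diff_scale:
  "a \<in> left_invariant S' \<Longrightarrow> b \<in> left_invariant S' \<Longrightarrow> a + scale c b \<in> left_invariant S'"
  "a \<in> right_invariant S' \<Longrightarrow> b \<in> right_invariant S' \<Longrightarrow> a + scale c b \<in> right_invariant S'"
  by (auto simp: left_invariant_def right_invariant_def scale.scale_right_distrib mult.commute)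

text \<open>Elimination from the largest index down to 0: at step m the word with leading index m is
  added with the coefficient still missing there. Its own coefficient is 1, and those at larger
  representatives vanish, so what was achieved before is not disturbed.\<close>

lemma normal_spanning:
  assumes "g \<in> left_invariant (vs J)" "g \<in> right_invariant (vs I)"
  shows "\<exists>x\<in>Qcar. \<forall>u. Phi x (slot u (xelt (vs u))) = (if u = I then slot J g else (\<lambda>L. 0))"
proof -
  have step: "\<exists>x\<in>Qcar. \<exists>h. h \<in> left_invariant (vs J) \<and> h \<in> right_invariant (vs I) \<and>
      (\<forall>k\<in>set (reps J I). m \<le> k \<longrightarrow> hcoef (g - h) k = 0) \<and>
      (\<forall>u. Phi x (slot u (xelt (vs u))) = (if u = I then slot J h else (\<lambda>L. 0)))" if "m \<le> 24" for m
    using that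
  proof (induction rule: inc_induct)
    case base
    show ?case
    proof (intro bexI[of _ 0] exI[of _ 0] conjI ballI allI impI)
      show "0 \<in> left_invariant (vs J)" "0 \<in> right_invariant (vs I)"
        by (simp_all add: left_invariant_def right_invariant_def)
      fix k assume "k \<in> set (reps J I)" "24 \<le> k"
      then show "hcoef (g - 0) k = 0" using reps_less[of k J I] by simp
    qed (auto simp: slot_def)
  next
    case (step m)
    then obtain x h where x: "x \<in> Qcar" and h: "h \<in> left_invariant (vs J)" "h \<in> right_invariant (vs I)"
      and zero: "\<And>k. k \<in> set (reps J I) \<Longrightarrow> Suc m \<le> k \<Longrightarrow> hcoef (g - h) k = 0"
      and Phi: "\<And>u. Phi x (slot u (xelt (vs u))) = (if u = I then slot J h else (\<lambda>L. 0))"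
      by blast
    show ?case
    proof (cases "m \<in> set (reps J I)")
      case False
      have "hcoef (g - h) k = 0" if "k \<in> set (reps J I)" "m \<le> k" for k
        using zero[OF that(1)] that False by (cases "m = k") auto
      then show ?thesis using x h Phi by blast
    next
      case True
      obtain w where w: "valid w" "hd w = J" "last w = I" "dominates (rev (reps J I)) (evw w) m"
        using leading_terms[of J I] True by (elim exE conjE) (drule (1) bspec, iprover)
      define c where "c = hcoef (g - h) m"
      show ?thesis
      proof (intro bexI[of _ "x + scale c (wd w)"] exI[of _ "h + scale c (evw w)"] conjI ballI allI impI)
        show "x + scale c (wd w) \<in> Qcar"
          by (intro Q_closed x wd_Q)
        show "h + scale c (evw w) \<in> left_invariant (vs J)"
          using xmod_left_invariant[OF evw_xmod[OF w(1)]] w(2) by (intro invariant_diff_scale h) simp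
        show "h + scale c (evw w) \<in> right_invariant (vs I)"
          using evw_right[OF w(1)] w(3) by (intro invariant_diff_scale h) simp
        show "hcoef (g - (h + scale c (evw w))) k = 0" if "k \<in> set (reps J I)" "m \<le> k" for k
        proof (cases "k = m")
          case True
          then show ?thesis using w(4) by (simp add: dominates_def hcoef_def c_def lookup_add lookup_minus)
        next
          case False
          then have "hcoef (g - h) k = 0" "hcoef (evw w) k = 0"
            using zero[OF that(1)] that w(4) by (auto simp: dominates_def hcoef_def)
          then show ?thesis by (simp add: hcoef_def lookup_add lookup_minus)
        qed
        show "Phi (x + scale c (wd w)) (slot u (xelt (vs u))) =
            (if u = I then slot J (h + scale c (evw w)) else (\<lambda>L. 0))" for u
          using Phi[of u] Phi_wd[OF valid_ne[OF w(1)], of u] w(2,3) by (auto simp: slot_def)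
      qed
    qed
  qed
  obtain x h where x: "x \<in> Qcar" and h: "h \<in> left_invariant (vs J)" "h \<in> right_invariant (vs I)"
    and zero: "\<And>k. k \<in> set (reps J I) \<Longrightarrow> hcoef (g - h) k = 0"
    and Phi: "\<And>u. Phi x (slot u (xelt (vs u))) = (if u = I then slot J h else (\<lambda>L. 0))"
    using step[of 0] by auto
  have "g + scale (- 1) h = 0"
    using biinvariant_eq_0[OF invariant_diff_scale(1)[OF assms(1) h(1), of "- 1"]
      invariant_diff_scale(2)[OF assms(2) h(2), of "- 1"]] zero by simp
  then have "g = h" by simp
  then show ?thesis using x Phi by blast
qed

section \<open>Kernel and image of the canonical homomorphism\<close>

lemma Qq_minus: "a \<in> Qcar \<Longrightarrow> b \<in> Qcar \<Longrightarrow> a \<ominus>\<^bsub>Qq\<^esub> b = a - b"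
proof -
  assume a: "a \<in> Qcar" and b: "b \<in> Qcar"
  have "scale (- 1) b \<in> Qcar" by (rule Q_closed(4)[OF b])
  then have "\<ominus>\<^bsub>Qq\<^esub> b = - b"
    using abelian_group.minus_equality[OF ring.is_abelian_group[OF ring_Qq], of "- b" b] b by simp
  then show ?thesis unfolding a_minus_def by simp
qed

lemma relations_Q: assumes "(l, r) \<in> relations" shows "l \<in> Qcar" "r \<in> Qcar" "l - r \<in> Qcar"
proof -
  show l: "l \<in> Qcar" by (rule conjunct1[OF relations_Phi[OF assms]])
  show "r \<in> Qcar" by (rule conjunct1[OF conjunct2[OF relations_Phi[OF assms]]])
  with l show "l - r \<in> Qcar" by (rule Q_closed(3))
qed

lemma relators_I: "(l, r) \<in> relations \<Longrightarrow> l - r \<in> relators"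
  unfolding relators_def mem_Collect_eq
  by (rule exI[of _ l], rule exI[of _ r]) (simp only: Qq_minus[OF relations_Q(1,2)] simp_thms)

lemma relators_E: assumes "x \<in> relators" obtains l r where "(l, r) \<in> relations" "x = l - r"
proof -
  obtain l r where lr: "(l, r) \<in> relations" "x = l \<ominus>\<^bsub>Qq\<^esub> r"
    using assms unfolding relators_def mem_Collect_eq by (elim exE conjE)
  show ?thesis using lr(2) unfolding Qq_minus[OF relations_Q(1,2)[OF lr(1)]] by (rule that[OF lr(1)])
qed

lemma relators_Q: "relators \<subseteq> carrier Qq"
proof
  fix x assume "x \<in> relators"
  then show "x \<in> carrier Qq" unfolding Qq_simps by (rule relators_E) (simp only: relations_Q(3))
qed

lemma ideal_Idl: "ideal (Idl\<^bsub>Qq\<^esub> relators) Qq"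
  by (rule ring.genideal_ideal[OF ring_Qq relators_Q])

lemma relation_Idl: "(l, r) \<in> relations \<Longrightarrow> eqv (Idl\<^bsub>Qq\<^esub> relators) l r"
  unfolding eqv_def
  by (intro conjI relations_Q(1,2) subsetD[OF ring.genideal_self[OF ring_Qq relators_Q]] relators_I)

lemma base_rules_Idl: "\<forall>x\<in>set base_rules. ok_rule (Idl\<^bsub>Qq\<^esub> relators) x"
proof
  fix x assume x: "x \<in> set base_rules"
  obtain w p where wp: "x = (w, p)" by (cases x)
  have "x \<in> set rules" using x by (simp add: rules_def set_add_overlaps)
  then have w: "valid w" "all_reduce w p"
    using decreasing_rules unfolding decreasing_iff wp by auto
  have "eqv (Idl\<^bsub>Qq\<^esub> relators) (wd w) (sem p)"
    using base_relations[OF x] relation_Idl eqv_sym[OF ideal_Idl] unfolding wp word_pair_def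
    by (elim disjE) simp_all
  then show "ok_rule (Idl\<^bsub>Qq\<^esub> relators) x"
    using valid_ne[OF w(1)] all_reduce_good[OF w(2)] unfolding wp ok_rule_def by simp
qed

lemma phi0_apply: "m \<in> Xsum \<Longrightarrow> phi0 x m = Phi x m"
  by (simp add: phi0_def)

lemma phi0_eqI:
  assumes "f \<in> carrier Eq" "x \<in> Qcar" "\<And>u. Phi x (slot u (xelt (vs u))) = f (slot u (xelt (vs u)))"
  shows "phi0 x = f"
  by (rule Eq_slots_eqI[OF phi0_carrier[OF assms(2)] assms(1)]) (simp add: phi0_apply assms(3))

lemma ideal_kernel: "ideal (a_kernel Qq Eq phi0) Qq"
proof -
  have "phi0 \<in> ring_hom Qq Eq" using phi0_canonical by (simp add: canonical_homs_def algebra_hom_def)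
  then show ?thesis
    by (rule ring_hom_ring.kernel_is_ideal[OF ring_hom_ringI2[OF ring_Qq ring_Eq]])
qed

lemma kernel_iff: "x \<in> a_kernel Qq Eq phi0 \<longleftrightarrow> x \<in> Qcar \<and> phi0 x = \<zero>\<^bsub>Eq\<^esub>"
  unfolding a_kernel_def' by simp

lemma Idl_subset_kernel: "Idl\<^bsub>Qq\<^esub> relators \<subseteq> a_kernel Qq Eq phi0"
proof (rule ring.genideal_minimal[OF ring_Qq ideal_kernel], rule subsetI)
  fix x assume "x \<in> relators"
  then obtain l r where lr: "(l, r) \<in> relations" "x = l - r" by (rule relators_E)
  have Q: "x \<in> Qcar" unfolding lr(2) by (rule relations_Q(3)[OF lr(1)])
  show "x \<in> a_kernel Qq Eq phi0"
    unfolding kernel_iff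
  proof (intro conjI Q phi0_eqI)
    show "Phi x (slot u (xelt (vs u))) = \<zero>\<^bsub>Eq\<^esub> (slot u (xelt (vs u)))" for u
      using relations_Phi[OF lr(1), of u] unfolding lr(2) by simp
  qed simp
qed

lemma Phi_sum: "Phi (\<Sum>a\<in>A. scale (c a) (F a)) m = (\<lambda>L. \<Sum>a\<in>A. scale (c a) (Phi (F a) m L))"
  by (induction A rule: infinite_finite_induct) simp_all

text \<open>Words with different starting vertices are tested on different generators, and words
  with different end vertices have values in different components. The combination thus splits into
  one piece for each pair of vertices, to which independence applies.\<close>

lemma Phi_normal_eq_0:
  fixes y :: "vertex list \<Rightarrow>\<^sub>0 int poly"
  assumes y: "keys y \<subseteq> {w. normal w}"
    and zero: "\<And>I. Phi (lin wd y) (slot I (xelt (vs I))) = (\<lambda>L. 0)"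
  shows "y = 0"
proof -
  have "{w \<in> keys y. hd w = J \<and> last w = I} = {}" (is "?N = {}") for I J
  proof (rule normal_independent[of _ J I y])
    show "?N \<subseteq> {w. normal w \<and> hd w = J \<and> last w = I}" using y by blast
    have "w \<noteq> []" if "w \<in> keys y" for w
      using y that valid_ne by (auto simp: normal_def)
    then have "scale c (Phi (wd w) (slot I (xelt (vs I))) (vs J)) =
        (if hd w = J \<and> last w = I then scale c (evw w) else 0)" if "w \<in> keys y" for w c
      using Phi_wd[of w I] that by (auto simp: slot_def)
    then have "Phi (lin wd y) (slot I (xelt (vs I))) (vs J) =
        (\<Sum>w\<in>keys y. if hd w = J \<and> last w = I
          then scale (lookup y w) (evw w) else 0)"
      unfolding lin_def Phi_sum by (intro sum.cong) simp_all
    then show "(\<Sum>w\<in>?N. scale (lookup y w) (evw w)) = 0"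
      unfolding zero by (simp add: sum.inter_filter)
  qed (simp_all add: in_keys_iff)
  then have "keys y = {}" by blast
  then show ?thesis by simp
qed

lemma kernel_eq_Idl: "a_kernel Qq Eq phi0 = Idl\<^bsub>Qq\<^esub> relators"
proof (rule antisym[OF subsetI Idl_subset_kernel])
  let ?I = "Idl\<^bsub>Qq\<^esub> relators"
  fix x assume "x \<in> a_kernel Qq Eq phi0"
  then have x: "x \<in> Qcar" "phi0 x = \<zero>\<^bsub>Eq\<^esub>" unfolding kernel_iff by blast+
  obtain y :: "vertex list \<Rightarrow>\<^sub>0 int poly" where y: "keys y \<subseteq> {w. normal w}" "eqv ?I x (lin wd y)"
    using has_nf_all[OF ideal_Idl base_rules_Idl x(1)] unfolding has_nf_def by iprover
  have "x - lin wd y \<in> a_kernel Qq Eq phi0"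
    using y(2) Idl_subset_kernel unfolding eqv_def by blast
  then have "phi0 (x - lin wd y) = \<zero>\<^bsub>Eq\<^esub>" unfolding kernel_iff by blast
  then have zero: "Phi (lin wd y) m = (\<lambda>L. 0)" if "m \<in> Xsum" for m
  proof -
    have "Phi x m = (\<lambda>L. 0)"
      using fun_cong[OF x(2), of m] that by (simp add: phi0_apply)
    moreover have "(\<lambda>L. Phi x m L - Phi (lin wd y) m L) = (\<lambda>L. 0)"
      using fun_cong[OF \<open>phi0 (x - lin wd y) = _\<close>, of m] that by (simp add: phi0_apply)
    ultimately show ?thesis by (simp add: fun_eq_iff)
  qed
  from Phi_normal_eq_0[OF y(1) zero[OF slot_xelt]] have "lin wd y = 0" by simp
  then show "x \<in> ?I" using y(2) eqv_0[OF ideal_Idl] by simp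
qed

text \<open>Left invariance is that of x_J H. Right invariance passes from x_I to its image because
  x_I T_i = q x_I and \<open>f\<close> is compatible with T_i and with scalars.\<close>

lemma Eq_component_invariant:
  assumes f: "f \<in> carrier Eq"
  shows "f (slot I (xelt (vs I))) (vs J) \<in> left_invariant (vs J)"
    "f (slot I (xelt (vs I))) (vs J) \<in> right_invariant (vs I)"
proof -
  let ?m = "slot I (xelt (vs I))"
  have fm: "f ?m \<in> Xsum" by (rule EqD(1)[OF f slot_xelt])
  show "f ?m (vs J) \<in> left_invariant (vs J)"
    by (rule xmod_left_invariant[OF Xsum_xmod[OF fm]])
  show "f ?m (vs J) \<in> right_invariant (vs I)"
    unfolding right_invariant_def mem_Collect_eq
  proof (intro conjI ballI Xsum_HW[OF fm])
    fix i assume i: "i \<in> vs I"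
    then have g: "i \<in> gens" using bits_gens(2) by blast
    then have T: "T (sg i) \<in> HW" by (intro HW_simps(6) simple_W g)
    have x: "xelt (vs I) \<in> HW" "gen_right i (xelt (vs I)) = scale q (xelt (vs I))"
      using xelt_invariant(2)[of I] i unfolding right_invariant_def by blast+
    have "(\<lambda>L. hecke_mult (?m L) (T (sg i))) = (\<lambda>L. scale q (?m L))"
      unfolding slot_hecke_mult[symmetric] hecke_mult_simple(2)[OF g x(1)] x(2) by (auto simp: slot_def)
    then have "(\<lambda>L. hecke_mult (f ?m L) (T (sg i))) = (\<lambda>L. scale q (f ?m L))"
      using EqD(3)[OF f slot_xelt T] Eq_scale[OF f slot_xelt] by metis
    from fun_cong[OF this, of "vs J"] show "gen_right i (f ?m (vs J)) = scale q (f ?m (vs J))"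
      unfolding hecke_mult_simple(2)[OF g Xsum_HW[OF fm]] .
  qed
qed

lemma phi0_surjective:
  assumes f: "f \<in> carrier Eq"
  shows "\<exists>x\<in>Qcar. phi0 x = f"
proof -
  let ?g = "\<lambda>I. f (slot I (xelt (vs I)))"
  \<comment> \<open>Matrix entries: \<open>X J I\<close> is a chosen preimage of the component of
    \<open>f\<close> from x_I H to x_J H. Summing over the targets J gives the column
    \<open>Z I\<close>, and summing the columns over I gives a preimage of \<open>f\<close>.\<close>
  define X where "X J I = (SOME x. x \<in> Qcar \<and> (\<forall>u. Phi x (slot u (xelt (vs u))) =
      (if u = I then slot J (?g I (vs J)) else (\<lambda>L. 0))))" for J I
  have ex: "\<exists>x. x \<in> Qcar \<and> (\<forall>u. Phi x (slot u (xelt (vs u))) =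
      (if u = I then slot J (?g I (vs J)) else (\<lambda>L. 0)))" for J I
    using normal_spanning[OF Eq_component_invariant(1)[OF f, of I J] Eq_component_invariant(2)[OF f, of I J]]
    unfolding Bex_def .
  have X': "X J I \<in> Qcar \<and> (\<forall>u. Phi (X J I) (slot u (xelt (vs u))) =
      (if u = I then slot J (?g I (vs J)) else (\<lambda>L. 0)))" for J I
    unfolding X_def
    using someI_ex[OF ex[of I J]] .
  note X = conjunct1[OF X'] spec[OF conjunct2[OF X']]
  define Z where "Z I = (\<Sum>J\<leftarrow>vertices. X J I)" for I
  have list: "(\<Sum>J\<leftarrow>l. F J) \<in> Qcar \<and> Phi (\<Sum>J\<leftarrow>l. F J) m = (\<lambda>L. \<Sum>J\<leftarrow>l. Phi (F J) m L)"
    if "\<And>J. F J \<in> Qcar" for l :: "vertex list" and F m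
  proof (induction l)
    case Nil
    show ?case using Q_closed(1) by (simp del: mem_Collect_eq)
  next
    case (Cons J l)
    then show ?case
      using Q_closed(2)[OF that[of J] conjunct1[OF Cons]] by (simp del: mem_Collect_eq)
  qed
  have Z: "Z I \<in> Qcar" "Phi (Z I) (slot u (xelt (vs u))) = (if u = I then ?g I else (\<lambda>L. 0))" for I u
  proof -
    show "Z I \<in> Qcar" unfolding Z_def using list[OF X(1)] by (rule conjunct1)
    have "(\<lambda>L. \<Sum>J\<leftarrow>vertices. slot J (?g I (vs J)) L) = ?g I"
      by (rule Xsum_slots[symmetric, OF EqD(1)[OF f slot_xelt]])
    then show "Phi (Z I) (slot u (xelt (vs u))) = (if u = I then ?g I else (\<lambda>L. 0))"
      unfolding Z_def conjunct2[OF list[OF X(1)]] X(2) by simp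
  qed
  have "phi0 (\<Sum>I\<leftarrow>vertices. Z I) = f"
  proof (rule phi0_eqI[OF f])
    show "(\<Sum>I\<leftarrow>vertices. Z I) \<in> Qcar" using list[OF Z(1)] by (rule conjunct1)
    have "(\<Sum>I\<leftarrow>vertices. (if u = I then F I else (\<lambda>L. 0)) L) = F u L"
      for u L and F :: "vertex \<Rightarrow> nat set \<Rightarrow> hecke"
      by (cases u) (simp_all add: vertices_def)
    then show "Phi (\<Sum>I\<leftarrow>vertices. Z I) (slot u (xelt (vs u))) = ?g u" for u
      unfolding conjunct2[OF list[OF Z(1)]] Z(2) by simp
  qed
  then show ?thesis
    by (intro bexI[of _ "\<Sum>I\<leftarrow>vertices. Z I"] conjunct1[OF list[OF Z(1)]])
qed

theorem theorem8p3:
  shows "(\<exists>\<phi>. \<phi> \<in> canonical_homs) \<and>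
    (\<forall>\<phi> \<in> canonical_homs.
       \<phi> ` carrier Qq = carrier Eq \<and>
       a_kernel Qq Eq \<phi> = Idl\<^bsub>Qq\<^esub> relators)"
proof (intro conjI ballI)
  show "\<exists>\<phi>. \<phi> \<in> canonical_homs" by (intro exI[of _ phi0] phi0_canonical)
  fix \<phi> assume "\<phi> \<in> canonical_homs"
  then have eq: "\<phi> x = phi0 x" if "x \<in> carrier Qq" for x
    using canonical_unique that by simp
  have "\<phi> ` carrier Qq = phi0 ` carrier Qq"
    by (rule image_cong[OF refl eq])
  also have "\<dots> = carrier Eq"
  proof (intro antisym subsetI)
    fix f assume "f \<in> phi0 ` carrier Qq"
    then obtain x where "x \<in> carrier Qq" "f = phi0 x" by (elim imageE)
    then show "f \<in> carrier Eq" using phi0_carrier[of x] by (simp del: mem_Collect_eq)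
  next
    fix f assume "f \<in> carrier Eq"
    from phi0_surjective[OF this] obtain x where "x \<in> Qcar" "phi0 x = f" by (elim bexE)
    then show "f \<in> phi0 ` carrier Qq"
      by (intro image_eqI[of f phi0 x]) (simp_all only: Qq_simps)
  qed
  finally show "\<phi> ` carrier Qq = carrier Eq" .
  have "a_kernel Qq Eq \<phi> = a_kernel Qq Eq phi0"
    unfolding a_kernel_def' using eq by (intro Collect_cong conj_cong refl) simp
  then show "a_kernel Qq Eq \<phi> = Idl\<^bsub>Qq\<^esub> relators" using kernel_eq_Idl by simp
qed

end
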